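(* Consider the initial value problem $y'=f(t,y)$, $y(t_0)=y_0$, with $y(t)\in\mathbb{R}^N$, on a fixed interval $[t_0,T]$, and suppose that on a neighborhood of the exact trajectory: (i) $f(t,y)$ has bounded derivatives through order five; (ii) each Jacobian $J(t,y)=f_y(t,y)$ is diagonalizable, $J=X\Lambda X^{-1}$, with $\|X\|\,\|X^{-1}\|$ uniformly bounded; (iii) the $k$-th and $(k+1)$-th eigenvalue magnitudes of $hJ$ (in decreasing order of magnitude) remain separated, so that the cutoff $\omega_c$ and the selected parents vary in a locally Lipschitz way with $(t,y)$; (iv) $hJ$ has no eigenvalue coinciding with a singularity of the Padé denominators $Q_{m,n}$ used by the method; (v) the Arnoldi error in a one-step increment is of the same or higher local order as the step, or the projected actions $\widetilde\varphi_j(hJ)v$ are evaluated exactly. Then MIISO2, MIISO3, and MIISO4 converge on $[t_0,T]$ with global orders $p=2$, $3$, and $4$, respectively; that is, $\max_n\|y_n-y(t_n)\|\le C_T h^p$ with $C_T$ independent of $h$.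
   Context: Padé approximants. $[m/n]=P_{m,n}/Q_{m,n}$ is the Padé approximant of $e^z$: $\deg P_{m,n}=m$, $\deg Q_{m,n}=n$, $Q_{m,n}(0)=1$, $[m/n](z)-e^z=O(z^{m+n+1})$. $Q_N(z)=\sum_{j=0}^N(-z)^j/j!$, so $[0/N]=1/Q_N$. Repaired dissipative map. For $N'\in\{3,4\}$ let $\mathcal{W}_{N'}=\{\mathrm{Re}(z)\le0,\ |Q_{N'}(z)|<1\}$, $R_{\mathrm{raw}}=[0/N']$, $R_{\mathrm{fix}}=[1/(N'-1)]$, $\delta=0.10$, $\omega_*=\sqrt3$ ($N'=3$) or $\sqrt8$ ($N'=4$); for $0<|y|<\omega_*$ let $x_b(y)<0$ be the unique negative root $x$ of $|Q_{N'}(x+iy)|=1$. The weight $\theta_{\mathrm{wedge}}(z)\in[0,1]$ equals $1$ on $\mathcal{W}_{N'}$ and at the origin, decreases linearly to $0$ across a transition pad around $\mathcal{W}_{N'}$ with outer edge $\mathrm{Re}(z)=(1+\delta)x_b(\mathrm{Im}(z))$ or $|\mathrm{Im}(z)|=(1+\delta)\omega_*$, and is $0$ outside. With $\theta=\theta_{\mathrm{wedge}}(z)$, $R_D(z)=|R_{\mathrm{fix}}(z)|^{\theta}|R_{\mathrm{raw}}(z)|^{1-\theta}\exp(i[(1-\theta)\arg R_{\mathrm{raw}}(z)+\theta\arg R_{\mathrm{fix}}(z)])$, with continuous branches of $\arg$ vanishing at $0$. Amplification map. Parents: MIISO2: $R_C=[1/1]$, $R_D=[0/2]$; MIISO3: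 $R_C=[2/2]$, $R_D$ the repaired map with $N'=3$; MIISO4: $R_C=[2/2]$, $R_D$ the repaired map with $N'=4$. The cutoff is $\omega_c=|\lambda_k(hJ_n)|$, the modulus of the $k$-th largest-magnitude eigenvalue of $hJ_n$, with $k$ the (fixed) outlier count. Fix $r\in(0,1)$, an integer $s>1$ (defaults $r=0.99$, $s=4$), $\omega_0=r\omega_c$, and the taper $\theta(\omega)=0$ for $\omega\le\omega_0$, $\bigl(\frac{\omega-\omega_0}{\omega_c-\omega_0}\bigr)^s$ for $\omega_0<\omega<\omega_c$, $1$ for $\omega\ge\omega_c$. Then $R(z)=|R_D(z)|^{\theta(|z|)}|R_C(z)|^{1-\theta(|z|)}\exp(i[(1-\theta(|z|))\arg R_C(z)+\theta(|z|)\arg R_D(z)])$, with $R=R_C$ where $\theta=0$ and $R=R_D$ where $\theta=1$. Modified $\varphi$-functions. $\widetilde\varphi_0=R$, $\widetilde\varphi_1(z)=(R(z)-1)/z$, $\widetilde\varphi_{j+1}(z)=(\widetilde\varphi_j(z)-1/j!)/z$ (with value $1/j!$ for $\widetilde\varphi_j$ at $z=0$). For diagonalizable $A=X\Lambda X^{-1}$, $\widetilde\varphi_j(A)=X\,\mathrm{diag}(\widetilde\varphi_j(\lambda_i))X^{-1}$. The actions $\widetilde\varphi_j(hJ)v$ are evaluated exactly or approximated by an $m$-step Arnoldi (Krylov) projection $\|v\|V_m\widetilde\varphi_j(H_m)e_1$. Steps. With step size $h>0$, $t_n=t_0+nh$, $f_n=f(t_n,y_n)$, $J_n=f_y(t_n,y_n)$,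 $f_{t,n}=f_t(t_n,y_n)$: MIISO2: $y_{n+1}=y_n+h\widetilde\varphi_1(hJ_n)f_n+\frac12h^2f_{t,n}$. MIISO3: $v_1=\widetilde\varphi_1(hJ_n)f_n$, $v_2=\widetilde\varphi_2(hJ_n)f_{t,n}$, $Y_2=y_n+hv_1+h^2v_2$, $D_2=f(t_n+h,Y_2)-f_n-J_n(Y_2-y_n)-hf_{t,n}$, $y_{n+1}=y_n+hv_1+h^2v_2+2h\widetilde\varphi_3(hJ_n)D_2$. MIISO4: $Y_2=y_n+\frac12h\widetilde\varphi_1(\frac12hJ_n)f_n+\frac14h^2\widetilde\varphi_2(\frac12hJ_n)f_{t,n}$, $D_2=f(t_n+\frac12h,Y_2)-f_n-J_n(Y_2-y_n)-\frac12hf_{t,n}$, $Y_3=y_n+h\widetilde\varphi_1(hJ_n)f_n+h^2\widetilde\varphi_2(hJ_n)f_{t,n}$, $D_3=f(t_n+h,Y_3)-f_n-J_n(Y_3-y_n)-hf_{t,n}$, $y_{n+1}=Y_3+h\bigl[(16\widetilde\varphi_3(hJ_n)-48\widetilde\varphi_4(hJ_n))D_2+(-2\widetilde\varphi_3(hJ_n)+12\widetilde\varphi_4(hJ_n))D_3\bigr]$. The orders are asymptotic as $h\to0$ (non-stiff regime). *)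

theory Defs
  imports
    "HOL-Analysis.Analysis"
    "HOL-Library.Landau_Symbols"
    "HOL-Computational_Algebra.Polynomial"
begin

section \<open>Pade approximants of the exponential\<close>

definition is_pade_exp :: "nat \<Rightarrow> nat \<Rightarrow> complex poly \<Rightarrow> complex poly \<Rightarrow> bool" where
  "is_pade_exp m n P Q \<longleftrightarrow>
     degree P = m \<and> degree Q = n \<and> poly Q 0 = 1 \<and>
     (\<lambda>z. poly P z / poly Q z - exp z) \<in> O[at 0](\<lambda>z. z ^ (m + n + 1))"

definition pade_pair :: "nat \<Rightarrow> nat \<Rightarrow> complex poly \<times> complex poly" where
  "pade_pair m n = (SOME PQ. is_pade_exp m n (fst PQ) (snd PQ))"

definition pade_denom :: "nat \<Rightarrow> nat \<Rightarrow> complex poly" where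
  "pade_denom m n = snd (pade_pair m n)"

definition pade :: "nat \<Rightarrow> nat \<Rightarrow> complex \<Rightarrow> complex" where
  "pade m n z = poly (fst (pade_pair m n)) z / poly (pade_denom m n) z"

text \<open>A rational function with zeros or poles has no continuous argument on the whole plane.
  A branch is therefore a choice of argument at every point that vanishes at 0 and is continuous
  on some open set containing 0; the position of the cuts is left open.
  (At a pole the quotient is 0 by convention and \<^const>\<open>is_Arg\<close> imposes nothing.)\<close>

definition arg_branch :: "(complex \<Rightarrow> complex) \<Rightarrow> (complex \<Rightarrow> real) \<Rightarrow> bool" where
  "arg_branch R a \<longleftrightarrow>
     a 0 = 0 \<and> (\<forall>z. is_Arg (R z) (a z)) \<and> (\<exists>D. open D \<and> 0 \<in> D \<and> continuous_on D a)"


section \<open>Geometric blending of stability functions\<close>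

text \<open>A map together with a chosen argument of its values.\<close>

type_synonym polar_map = "(complex \<Rightarrow> complex) \<times> (complex \<Rightarrow> real)"

text \<open>\<open>w\<close> is the weight of \<open>F\<close>. The cases 0 and 1 are separate because
  \<open>0 powr 0 = 0\<close> in the library.\<close>

definition polar_blend :: "real \<Rightarrow> polar_map \<Rightarrow> polar_map \<Rightarrow> complex \<Rightarrow> complex" where
  "polar_blend w F G z =
     (if w = 0 then fst G z
      else if w = 1 then fst F z
      else of_real (cmod (fst F z) powr w * cmod (fst G z) powr (1 - w))
             * cis ((1 - w) * snd G z + w * snd F z))"


section \<open>The repaired dissipative map\<close>

definition Q_trunc :: "nat \<Rightarrow> complex \<Rightarrow> complex" where
  "Q_trunc N z = (\<Sum>j\<le>N. (- z) ^ j / fact j)"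

definition wedge :: "nat \<Rightarrow> complex set" where
  "wedge N = {z. Re z \<le> 0 \<and> cmod (Q_trunc N z) < 1}"

definition omega_star :: "nat \<Rightarrow> real" where
  "omega_star N = (if N = 3 then sqrt 3 else sqrt 8)"

definition wedge_edge :: "nat \<Rightarrow> real \<Rightarrow> real" where
  "wedge_edge N y = (THE x. x < 0 \<and> cmod (Q_trunc N (Complex x y)) = 1)"

definition pad_width :: real where
  "pad_width = 1 / 10"

text \<open>The wedge together with its transition pad, in the closed left half plane.
  \<open>wedge_edge\<close> is meaningful only for \<open>0 < \<bar>Im z\<bar> < omega_star N\<close>; beyond that the
  pad is bounded by the horizontal lines \<open>\<bar>Im z\<bar> = (1 + pad_width) * omega_star N\<close>.\<close>

definition padded_wedge :: "nat \<Rightarrow> complex set" where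
  "padded_wedge N = {z. Re z \<le> 0 \<and>
     (0 < \<bar>Im z\<bar> \<and> \<bar>Im z\<bar> < omega_star N \<and> (1 + pad_width) * wedge_edge N (Im z) \<le> Re z \<or>
      omega_star N \<le> \<bar>Im z\<bar> \<and> \<bar>Im z\<bar> \<le> (1 + pad_width) * omega_star N)}"

text \<open>The weight is 1 on the wedge and at the origin and 0 off the padded wedge. On the pad
  to the left of the wedge it falls linearly in \<open>Re z\<close> from 1 to 0; on the pad above and below the
  wedge it falls linearly in \<open>\<bar>Im z\<bar>\<close> to 0, starting from 1 on the imaginary axis and from an
  arbitrary value \<open>c (Re z)\<close> elsewhere (the wedge closes up at \<open>Im z = \<plusminus> omega_star N\<close>, so
  nothing prescribes that value).\<close>

definition wedge_weight :: "nat \<Rightarrow> (complex \<Rightarrow> real) \<Rightarrow> bool" where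
  "wedge_weight N \<theta> \<longleftrightarrow>
     (\<forall>z. 0 \<le> \<theta> z \<and> \<theta> z \<le> 1) \<and>
     \<theta> 0 = 1 \<and> (\<forall>z \<in> wedge N. \<theta> z = 1) \<and>
     (\<forall>z. z \<notin> padded_wedge N \<longrightarrow> z \<noteq> 0 \<longrightarrow> \<theta> z = 0) \<and>
     (\<forall>x y. 0 < \<bar>y\<bar> \<longrightarrow> \<bar>y\<bar> < omega_star N \<longrightarrow>
        (1 + pad_width) * wedge_edge N y \<le> x \<longrightarrow> x \<le> wedge_edge N y \<longrightarrow>
        \<theta> (Complex x y) = ((1 + pad_width) * wedge_edge N y - x) / (pad_width * wedge_edge N y)) \<and>
     (\<exists>c. c 0 = 1 \<and>
        (\<forall>x y. x \<le> 0 \<longrightarrow> omega_star N \<le> \<bar>y\<bar> \<longrightarrow> \<bar>y\<bar> \<le> (1 + pad_width) * omega_star N \<longrightarrow>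
           \<theta> (Complex x y) =
             c x * (((1 + pad_width) * omega_star N - \<bar>y\<bar>) / (pad_width * omega_star N))))"

definition pade_polar :: "(nat \<Rightarrow> nat \<Rightarrow> complex \<Rightarrow> real) \<Rightarrow> nat \<Rightarrow> nat \<Rightarrow> polar_map" where
  "pade_polar \<alpha> m n = (pade m n, \<alpha> m n)"

text \<open>The phase occurring in the blend serves as the argument of the repaired map.\<close>

definition repaired_map ::
  "(nat \<Rightarrow> nat \<Rightarrow> complex \<Rightarrow> real) \<Rightarrow> (complex \<Rightarrow> real) \<Rightarrow> nat \<Rightarrow> polar_map" where
  "repaired_map \<alpha> \<theta> N =
     (\<lambda>z. polar_blend (\<theta> z) (pade_polar \<alpha> 1 (N - 1)) (pade_polar \<alpha> 0 N) z,
      \<lambda>z. (1 - \<theta> z) * \<alpha> 0 N z + \<theta> z * \<alpha> 1 (N - 1) z)"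


section \<open>The amplification map\<close>

datatype miiso = MIISO2 | MIISO3 | MIISO4

fun miiso_order :: "miiso \<Rightarrow> nat" where
  "miiso_order MIISO2 = 2"
| "miiso_order MIISO3 = 3"
| "miiso_order MIISO4 = 4"

text \<open>Degrees of the Pade approximants from which the map of a method is built.\<close>

fun pade_used :: "miiso \<Rightarrow> (nat \<times> nat) set" where
  "pade_used MIISO2 = {(1, 1), (0, 2)}"
| "pade_used MIISO3 = {(2, 2), (0, 3), (1, 2)}"
| "pade_used MIISO4 = {(2, 2), (0, 4), (1, 3)}"

fun parent_C :: "(nat \<Rightarrow> nat \<Rightarrow> complex \<Rightarrow> real) \<Rightarrow> miiso \<Rightarrow> polar_map" where
  "parent_C \<alpha> MIISO2 = pade_polar \<alpha> 1 1"
| "parent_C \<alpha> MIISO3 = pade_polar \<alpha> 2 2"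
| "parent_C \<alpha> MIISO4 = pade_polar \<alpha> 2 2"

fun parent_D ::
  "(nat \<Rightarrow> nat \<Rightarrow> complex \<Rightarrow> real) \<Rightarrow> (complex \<Rightarrow> real) \<Rightarrow> miiso \<Rightarrow> polar_map" where
  "parent_D \<alpha> \<theta> MIISO2 = pade_polar \<alpha> 0 2"
| "parent_D \<alpha> \<theta> MIISO3 = repaired_map \<alpha> \<theta> 3"
| "parent_D \<alpha> \<theta> MIISO4 = repaired_map \<alpha> \<theta> 4"

definition taper :: "real \<Rightarrow> nat \<Rightarrow> real \<Rightarrow> real \<Rightarrow> real" where
  "taper r s \<omega>c \<omega> =
     (if \<omega> \<le> r * \<omega>c then 0
      else if \<omega> < \<omega>c then ((\<omega> - r * \<omega>c) / (\<omega>c - r * \<omega>c)) ^ s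
      else 1)"

definition amp_map ::
  "(nat \<Rightarrow> nat \<Rightarrow> complex \<Rightarrow> real) \<Rightarrow> (complex \<Rightarrow> real) \<Rightarrow> miiso \<Rightarrow> real \<Rightarrow> nat \<Rightarrow>
   real \<Rightarrow> complex \<Rightarrow> complex" where
  "amp_map \<alpha> \<theta> M r s \<omega>c z =
     polar_blend (taper r s \<omega>c (cmod z)) (parent_D \<alpha> \<theta> M) (parent_C \<alpha> M) z"

primrec mod_phi :: "(complex \<Rightarrow> complex) \<Rightarrow> nat \<Rightarrow> complex \<Rightarrow> complex" where
  "mod_phi R 0 z = R z"
| "mod_phi R (Suc j) z =
     (if z = 0 then 1 / fact (Suc j) else (mod_phi R j z - 1 / fact j) / z)"


section \<open>Eigenvalues and functions of diagonalizable matrices\<close>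

definition cmatrix :: "real^'n^'n \<Rightarrow> complex^'n^'n" where
  "cmatrix A = (\<chi> i j. of_real (A $ i $ j))"

definition cvector :: "real^'n \<Rightarrow> complex^'n" where
  "cvector v = (\<chi> i. of_real (v $ i))"

definition charpoly :: "complex^'n^'n \<Rightarrow> complex poly" where
  "charpoly A = det (\<chi> i j. (if i = j then [:0, 1:] else 0) - [:A $ i $ j:])"

definition eigvals :: "real^'n^'n \<Rightarrow> complex multiset" where
  "eigvals A = proots (charpoly (cmatrix A))"

text \<open>Modulus of the \<open>k\<close>-th largest eigenvalue in magnitude, \<open>1 \<le> k \<le> CARD('n)\<close>,
  counted with multiplicity.\<close>

definition eig_modulus :: "nat \<Rightarrow> real^'n^'n \<Rightarrow> real" where
  "eig_modulus k A = rev (sorted_list_of_multiset (image_mset cmod (eigvals A))) ! (k - 1)"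

definition diag_matrix :: "complex^'n \<Rightarrow> complex^'n^'n" where
  "diag_matrix d = (\<chi> i j. if i = j then d $ i else 0)"

definition diagonalizes :: "complex^'n^'n \<Rightarrow> complex^'n^'n \<Rightarrow> complex^'n \<Rightarrow> bool" where
  "diagonalizes A X d \<longleftrightarrow> invertible X \<and> A = X ** diag_matrix d ** matrix_inv X"

text \<open>The value does not depend on the diagonalization chosen; it is unspecified
  if there is none.\<close>

definition matrix_fun :: "(complex \<Rightarrow> complex) \<Rightarrow> complex^'n^'n \<Rightarrow> complex^'n^'n" where
  "matrix_fun \<phi> A = (SOME B. \<exists>X d. diagonalizes A X d \<and>
     B = X ** diag_matrix (\<chi> i. \<phi> (d $ i)) ** matrix_inv X)"

text \<open>The same for matrices of order \<open>l\<close>, given by their entries with indices below \<open>l\<close>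
  (the order of a projected matrix depends on the data); \<open>Y\<close> is the inverse of \<open>X\<close>.\<close>

definition diagonalizes_n ::
  "nat \<Rightarrow> (nat \<Rightarrow> nat \<Rightarrow> complex) \<Rightarrow> (nat \<Rightarrow> nat \<Rightarrow> complex) \<Rightarrow> (nat \<Rightarrow> complex) \<Rightarrow>
   (nat \<Rightarrow> nat \<Rightarrow> complex) \<Rightarrow> bool" where
  "diagonalizes_n l H X d Y \<longleftrightarrow>
     (\<forall>i<l. \<forall>j<l. (\<Sum>a<l. X i a * Y a j) = (if i = j then 1 else 0)) \<and>
     (\<forall>i<l. \<forall>j<l. H i j = (\<Sum>a<l. X i a * d a * Y a j))"

definition matrix_fun_n ::
  "nat \<Rightarrow> (complex \<Rightarrow> complex) \<Rightarrow> (nat \<Rightarrow> nat \<Rightarrow> complex) \<Rightarrow> nat \<Rightarrow> nat \<Rightarrow> complex" where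
  "matrix_fun_n l \<phi> H = (SOME B. \<exists>X d Y. diagonalizes_n l H X d Y \<and>
     B = (\<lambda>i j. \<Sum>a<l. X i a * \<phi> (d a) * Y a j))"


section \<open>Actions of matrix functions: exact and by Arnoldi projection\<close>

text \<open>Parents, weights and taper are symmetric under complex conjugation, so near 0 the maps
  \<open>amp_map\<close> and \<open>mod_phi\<close> commute with conjugation and the action of a real matrix on a real
  vector is real; taking real parts only returns it to the real space.\<close>

definition exact_action :: "(complex \<Rightarrow> complex) \<Rightarrow> real^'n^'n \<Rightarrow> real^'n \<Rightarrow> real^'n" where
  "exact_action \<phi> A v = (\<chi> i. Re ((matrix_fun \<phi> (cmatrix A) *v cvector v) $ i))"

text \<open>Columns of \<open>V\<^sub>m\<close>. The list stays shorter than \<open>m\<close> after a breakdown (in particular it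
  is empty for \<open>v = 0\<close>).\<close>

primrec arnoldi_basis :: "real^'n^'n \<Rightarrow> real^'n \<Rightarrow> nat \<Rightarrow> (real^'n) list" where
  "arnoldi_basis A v 0 = []"
| "arnoldi_basis A v (Suc m) =
     (let V = arnoldi_basis A v m;
          u = (if V = [] then v else A *v last V);
          w = u - (\<Sum>q\<leftarrow>V. (q \<bullet> u) *\<^sub>R q)
      in if w = 0 then V else V @ [w /\<^sub>R norm w])"

definition arnoldi_action ::
  "nat \<Rightarrow> (complex \<Rightarrow> complex) \<Rightarrow> real^'n^'n \<Rightarrow> real^'n \<Rightarrow> real^'n" where
  "arnoldi_action m \<phi> A v =
     (let V = arnoldi_basis A v m;
          l = length V;
          H = (\<lambda>i j. complex_of_real (V ! i \<bullet> (A *v (V ! j))))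
      in norm v *\<^sub>R (\<Sum>i<l. Re (matrix_fun_n l \<phi> H i 0) *\<^sub>R (V ! i)))"


section \<open>The integrators\<close>

text \<open>The right-hand side is a function of the pair \<open>(t, y)\<close>.\<close>

definition f_y :: "(real \<times> (real^'n) \<Rightarrow> real^'n) \<Rightarrow> real \<Rightarrow> real^'n \<Rightarrow> real^'n^'n" where
  "f_y f t y = jacobian (\<lambda>x. f (t, x)) (at y)"

definition f_t :: "(real \<times> (real^'n) \<Rightarrow> real^'n) \<Rightarrow> real \<Rightarrow> real^'n \<Rightarrow> real^'n" where
  "f_t f t y = vector_derivative (\<lambda>\<tau>. f (\<tau>, y)) (at t)"

type_synonym 'n action =
  "(complex \<Rightarrow> complex) \<Rightarrow> real^'n^'n \<Rightarrow> real^'n \<Rightarrow> real^'n"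

text \<open>In the steps \<open>\<Phi> j A v\<close> stands for the action of the \<open>j\<close>-th modified phi-function of \<open>A\<close>
  on \<open>v\<close>.\<close>

definition miiso2_step ::
  "(nat \<Rightarrow> real^'n^'n \<Rightarrow> real^'n \<Rightarrow> real^'n) \<Rightarrow> (real \<times> (real^'n) \<Rightarrow> real^'n) \<Rightarrow>
   real \<Rightarrow> real \<Rightarrow> real^'n \<Rightarrow> real^'n" where
  "miiso2_step \<Phi> f h t y =
     y + h *\<^sub>R \<Phi> 1 (h *\<^sub>R f_y f t y) (f (t, y)) + (h\<^sup>2 / 2) *\<^sub>R f_t f t y"

definition miiso3_step ::
  "(nat \<Rightarrow> real^'n^'n \<Rightarrow> real^'n \<Rightarrow> real^'n) \<Rightarrow> (real \<times> (real^'n) \<Rightarrow> real^'n) \<Rightarrow>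
   real \<Rightarrow> real \<Rightarrow> real^'n \<Rightarrow> real^'n" where
  "miiso3_step \<Phi> f h t y =
     (let J = f_y f t y; fn = f (t, y); ft = f_t f t y;
          v1 = \<Phi> 1 (h *\<^sub>R J) fn;
          v2 = \<Phi> 2 (h *\<^sub>R J) ft;
          Y2 = y + h *\<^sub>R v1 + h\<^sup>2 *\<^sub>R v2;
          D2 = f (t + h, Y2) - fn - J *v (Y2 - y) - h *\<^sub>R ft
      in y + h *\<^sub>R v1 + h\<^sup>2 *\<^sub>R v2 + (2 * h) *\<^sub>R \<Phi> 3 (h *\<^sub>R J) D2)"

definition miiso4_step ::
  "(nat \<Rightarrow> real^'n^'n \<Rightarrow> real^'n \<Rightarrow> real^'n) \<Rightarrow> (real \<times> (real^'n) \<Rightarrow> real^'n) \<Rightarrow>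
   real \<Rightarrow> real \<Rightarrow> real^'n \<Rightarrow> real^'n" where
  "miiso4_step \<Phi> f h t y =
     (let J = f_y f t y; fn = f (t, y); ft = f_t f t y;
          Y2 = y + (h / 2) *\<^sub>R \<Phi> 1 ((h / 2) *\<^sub>R J) fn + (h\<^sup>2 / 4) *\<^sub>R \<Phi> 2 ((h / 2) *\<^sub>R J) ft;
          D2 = f (t + h / 2, Y2) - fn - J *v (Y2 - y) - (h / 2) *\<^sub>R ft;
          Y3 = y + h *\<^sub>R \<Phi> 1 (h *\<^sub>R J) fn + h\<^sup>2 *\<^sub>R \<Phi> 2 (h *\<^sub>R J) ft;
          D3 = f (t + h, Y3) - fn - J *v (Y3 - y) - h *\<^sub>R ft
      in Y3 + h *\<^sub>R ((16 *\<^sub>R \<Phi> 3 (h *\<^sub>R J) D2 - 48 *\<^sub>R \<Phi> 4 (h *\<^sub>R J) D2)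
                   + (- 2 *\<^sub>R \<Phi> 3 (h *\<^sub>R J) D3 + 12 *\<^sub>R \<Phi> 4 (h *\<^sub>R J) D3)))"

fun miiso_scheme ::
  "miiso \<Rightarrow> (nat \<Rightarrow> real^'n^'n \<Rightarrow> real^'n \<Rightarrow> real^'n) \<Rightarrow> (real \<times> (real^'n) \<Rightarrow> real^'n) \<Rightarrow>
   real \<Rightarrow> real \<Rightarrow> real^'n \<Rightarrow> real^'n" where
  "miiso_scheme MIISO2 = miiso2_step"
| "miiso_scheme MIISO3 = miiso3_step"
| "miiso_scheme MIISO4 = miiso4_step"

text \<open>The cutoff is always that of \<open>h J\<close>, also where the functions are applied to
  \<open>h J / 2\<close>.\<close>

definition miiso_step ::
  "(nat \<Rightarrow> nat \<Rightarrow> complex \<Rightarrow> real) \<Rightarrow> (complex \<Rightarrow> real) \<Rightarrow> miiso \<Rightarrow> real \<Rightarrow> nat \<Rightarrow> nat \<Rightarrow>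
   'n action \<Rightarrow> (real \<times> (real^'n) \<Rightarrow> real^'n) \<Rightarrow> real \<Rightarrow> real \<Rightarrow> real^'n \<Rightarrow> real^'n" where
  "miiso_step \<alpha> \<theta> M r s k act f h t y =
     (let \<omega>c = eig_modulus k (h *\<^sub>R f_y f t y)
      in miiso_scheme M (\<lambda>j. act (mod_phi (amp_map \<alpha> \<theta> M r s \<omega>c) j)) f h t y)"

primrec iterates ::
  "(real \<Rightarrow> 'v \<Rightarrow> 'v) \<Rightarrow> real \<Rightarrow> real \<Rightarrow> 'v \<Rightarrow> nat \<Rightarrow> 'v" where
  "iterates S h t0 y0 0 = y0"
| "iterates S h t0 y0 (Suc n) = S (t0 + real n * h) (iterates S h t0 y0 n)"


section \<open>Bounded derivatives\<close>

text \<open>All derivatives of orders 1 to \<open>k\<close> exist on \<open>S\<close> and are bounded there, expressed through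
  iterated derivatives in fixed directions; in finite dimension this is the same as boundedness of
  the Frechet derivatives as multilinear maps.\<close>

primrec bounded_derivs ::
  "nat \<Rightarrow> 'a::euclidean_space set \<Rightarrow> ('a \<Rightarrow> 'b::euclidean_space) \<Rightarrow> bool" where
  "bounded_derivs 0 S F \<longleftrightarrow> True"
| "bounded_derivs (Suc k) S F \<longleftrightarrow>
     (\<forall>x\<in>S. F differentiable (at x)) \<and>
     (\<forall>v. bounded ((\<lambda>x. frechet_derivative F (at x) v) ` S) \<and>
          bounded_derivs k S (\<lambda>x. frechet_derivative F (at x) v))"

end

theory Submission
  imports Defs
begin

text \<open>Write \<open>f\<^sub>i\<close> for the \<open>i\<close>-th derivative of \<open>f\<close> along the vector field \<open>(1, f)\<close>. One step of a
  method of order \<open>p\<close> is compared with the Taylor polynomial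
  \<open>x + \<Sum>\<^sub>i\<^sub><\<^sub>p h\<^sup>i\<^sup>+\<^sup>1 / (i + 1)! f\<^sub>i(x)\<close>, which has a Lipschitz constant \<open>1 + O(h)\<close> and reproduces the
  exact solution up to \<open>O(h\<^sup>p\<^sup>+\<^sup>1)\<close>; a discrete Gronwall argument in a tube around the trajectory
  then gives convergence of order \<open>p\<close>.

  The eigenvalues of \<open>h J\<close> are \<open>O(h)\<close>, so only the germ at 0 of the amplification map matters. There
  every Pade approximant involved is \<open>exp (z + O(z\<^sup>p\<^sup>+\<^sup>1))\<close>, and geometric blending takes convex
  combinations of the exponents. Hence the map agrees with \<open>exp\<close> to order \<open>p\<close>, uniformly in the
  cutoff, and through bounded condition numbers the modified phi-functions of \<open>h J\<close> agree with
  truncated power series. The classical order conditions of the exponential Rosenbrock methods do the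
  rest.\<close>

section \<open>Bounded derivatives\<close>

text \<open>The map from a state to its numerical successor is awkward to differentiate: it depends
  on the state through an eigenvalue modulus, which sets the cutoff, and through a diagonalization.
  The step is therefore compared with the Taylor polynomial at one and the same state, and the
  Lipschitz estimate is taken from the polynomial alone. This asks for a comparison that is uniform
  over a tube, so the estimates fix their constants before the state, the cutoff and the weight. A
  second obstacle is that the phi-function of index \<open>j\<close> is accurate only to order
  \<open>p + 1 - j\<close>, since each recursion divides by the argument. The loss is made good by
  powers of \<open>h\<close> in front, by defects of size O(h^2), and in the fourth order scheme by
  a combination of defects that is O(h^3). The Taylor polynomial is treated as an approximate
  integral curve of \<open>aug f\<close>; its own defect, the values of \<open>f\<close> along it
  and the exact solution are all handled by one induction, \<open>lie_tower_curve\<close>. Repeated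
  mean value estimates replace integration, so the constants do not shrink like reciprocal
  factorials.\<close>

lemma bounded_derivs_mono:
  "bounded_derivs k S F \<Longrightarrow> j \<le> k \<Longrightarrow> T \<subseteq> S \<Longrightarrow> bounded_derivs j T F"
proof (induction k arbitrary: j F)
  case (Suc k)
  show ?case
  proof (cases j)
    case (Suc i)
    then show ?thesis
      using Suc.prems Suc.IH[of _ i] by (auto intro: bounded_subset[OF _ image_mono])
  qed simp
qed simp

text \<open>Derivatives at a point of an open set depend only on the values in that set, so equality
  on \<open>S\<close> passes through every level of the recursion.\<close>

lemma bounded_derivs_cong:
  assumes "open S" "\<And>x. x \<in> S \<Longrightarrow> F x = G x" "bounded_derivs k S F"
  shows "bounded_derivs k S G"
  using assms(2,3)
proof (induction k arbitrary: F G)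
  case (Suc k)
  have d: "frechet_derivative F (at x) = frechet_derivative G (at x)" if "x \<in> S" for x
    by (rule frechet_derivative_transform_within_open[OF _ assms(1) that]) (use Suc.prems that in auto)
  have "G differentiable (at x)" if "x \<in> S" for x
  proof -
    have "(F has_derivative frechet_derivative F (at x)) (at x)"
      using Suc.prems that frechet_derivative_works by auto
    then have "(G has_derivative frechet_derivative F (at x)) (at x)"
      by (rule has_derivative_transform_within_open[OF _ assms(1) that]) (use Suc.prems in auto)
    then show ?thesis
      by (auto simp: differentiable_def)
  qed
  moreover have "bounded ((\<lambda>x. frechet_derivative G (at x) v) ` S)" for v
  proof -
    have "(\<lambda>x. frechet_derivative G (at x) v) ` S = (\<lambda>x. frechet_derivative F (at x) v) ` S"
      using d by (intro image_cong) auto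
    then show ?thesis
      using Suc.prems by auto
  qed
  moreover have "bounded_derivs k S (\<lambda>x. frechet_derivative G (at x) v)" for v
    by (rule Suc.IH[of "\<lambda>x. frechet_derivative F (at x) v"]) (use Suc.prems d in auto)
  ultimately show ?case
    by simp
qed simp

text \<open>\<open>bounded_derivs\<close> leaves the values of the function unconstrained; the
  product rule needs them bounded, so order zero is added to obtain a class closed under
  products.\<close>

definition smooth_bdd ::
  "nat \<Rightarrow> 'a::euclidean_space set \<Rightarrow> ('a \<Rightarrow> 'b::euclidean_space) \<Rightarrow> bool" where
  "smooth_bdd k S F \<longleftrightarrow> bounded (F ` S) \<and> bounded_derivs k S F"

lemma smooth_bdd_mono: "smooth_bdd k S F \<Longrightarrow> j \<le> k \<Longrightarrow> smooth_bdd j S F"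
  unfolding smooth_bdd_def using bounded_derivs_mono by blast

lemma smooth_bdd_Suc:
  "smooth_bdd (Suc k) S F \<longleftrightarrow> bounded (F ` S) \<and> (\<forall>x\<in>S. F differentiable (at x)) \<and>
     (\<forall>v. smooth_bdd k S (\<lambda>x. frechet_derivative F (at x) v))"
  unfolding smooth_bdd_def by auto

lemma smooth_bdd_cong:
  assumes "open S" "\<And>x. x \<in> S \<Longrightarrow> F x = G x" "smooth_bdd k S F"
  shows "smooth_bdd k S G"
  using assms bounded_derivs_cong[of S F G k] image_cong[of S S F G] unfolding smooth_bdd_def by auto

text \<open>Lets any known derivative \<open>D\<close> stand in for
  \<open>frechet_derivative\<close>, so that the rules of calculus can be used in the closure
  proofs.\<close>

lemma smooth_bdd_SucI:
  assumes "open S" "bounded (F ` S)" "\<And>x. x \<in> S \<Longrightarrow> (F has_derivative D x) (at x)"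
    and "\<And>v. smooth_bdd k S (\<lambda>x. D x v)"
  shows "smooth_bdd (Suc k) S F"
  unfolding smooth_bdd_Suc
proof (intro conjI ballI allI)
  show "smooth_bdd k S (\<lambda>x. frechet_derivative F (at x) v)" for v
    by (rule smooth_bdd_cong[OF assms(1) _ assms(4)[of v]]) (metis assms(3) frechet_derivative_at)
qed (use assms differentiable_def in blast)+

lemma smooth_bdd_has_derivative:
  "smooth_bdd (Suc k) S F \<Longrightarrow> x \<in> S \<Longrightarrow> (F has_derivative frechet_derivative F (at x)) (at x)"
  unfolding smooth_bdd_Suc using frechet_derivative_works by blast

lemma smooth_bdd_const:
  assumes "open S" shows "smooth_bdd k S (\<lambda>x. c)"
proof (induction k arbitrary: c)
  case 0
  then show ?case by (auto simp: smooth_bdd_def image_constant_conv)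
next
  case (Suc k)
  show ?case
    by (rule smooth_bdd_SucI[OF assms _ has_derivative_const Suc]) (auto simp: image_constant_conv)
qed

lemma smooth_bdd_linear:
  assumes "open S" "bounded_linear L" "smooth_bdd k S F"
  shows "smooth_bdd k S (\<lambda>x. L (F x))"
  using assms(3)
proof (induction k arbitrary: F)
  case 0
  then show ?case
    using bounded_linear_image[OF _ assms(2)] by (auto simp: smooth_bdd_def image_image[symmetric])
next
  case (Suc k)
  show ?case
  proof (rule smooth_bdd_SucI[OF assms(1)])
    show "bounded ((\<lambda>x. L (F x)) ` S)"
      using bounded_linear_image[OF _ assms(2)] Suc.prems by (auto simp: smooth_bdd_def image_image[symmetric])
    show "((\<lambda>x. L (F x)) has_derivative (\<lambda>v. L (frechet_derivative F (at x) v))) (at x)" if "x \<in> S" for x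
      by (rule bounded_linear.has_derivative[OF assms(2) smooth_bdd_has_derivative[OF Suc.prems that]])
  qed (use Suc in \<open>auto simp: smooth_bdd_Suc\<close>)
qed

lemma smooth_bdd_add:
  assumes "open S" "smooth_bdd k S F" "smooth_bdd k S G"
  shows "smooth_bdd k S (\<lambda>x. F x + G x)"
  using assms(2,3)
proof (induction k arbitrary: F G)
  case 0
  then show ?case
    by (auto simp: smooth_bdd_def bounded_plus_comp)
next
  case (Suc k)
  show ?case
  proof (rule smooth_bdd_SucI[OF assms(1)])
    show "bounded ((\<lambda>x. F x + G x) ` S)"
      using Suc.prems by (auto simp: smooth_bdd_def bounded_plus_comp)
    show "((\<lambda>x. F x + G x) has_derivative
        (\<lambda>v. frechet_derivative F (at x) v + frechet_derivative G (at x) v)) (at x)" if "x \<in> S" for x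
      by (intro has_derivative_add smooth_bdd_has_derivative[OF Suc.prems(1) that]
          smooth_bdd_has_derivative[OF Suc.prems(2) that])
  qed (use Suc in \<open>auto simp: smooth_bdd_Suc\<close>)
qed

lemma smooth_bdd_sum:
  assumes "open S" "\<And>i. i \<in> I \<Longrightarrow> smooth_bdd k S (F i)"
  shows "smooth_bdd k S (\<lambda>x. \<Sum>i\<in>I. F i x)"
  using assms(2)
  by (induction I rule: infinite_finite_induct) (auto intro: smooth_bdd_const smooth_bdd_add assms(1))

lemma bounded_scaleR_comp:
  fixes a :: "'a \<Rightarrow> real" and F :: "'a \<Rightarrow> 'b::real_normed_vector"
  assumes "bounded (a ` S)" "bounded (F ` S)"
  shows "bounded ((\<lambda>x. a x *\<^sub>R F x) ` S)"
proof -
  obtain A B where "\<And>x. x \<in> S \<Longrightarrow> norm (a x) \<le> A" "\<And>x. x \<in> S \<Longrightarrow> norm (F x) \<le> B"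
    using assms unfolding bounded_iff by auto
  then have "norm (a x *\<^sub>R F x) \<le> A * B" if "x \<in> S" for x
    using that by (smt (verit) mult_mono norm_ge_zero norm_scaleR real_norm_def)
  then show ?thesis
    unfolding bounded_iff by auto
qed

lemma smooth_bdd_scaleR:
  fixes a :: "'a::euclidean_space \<Rightarrow> real" and F :: "'a \<Rightarrow> 'b::euclidean_space"
  assumes "open S" "smooth_bdd k S a" "smooth_bdd k S F"
  shows "smooth_bdd k S (\<lambda>x. a x *\<^sub>R F x)"
  using assms(2,3)
proof (induction k arbitrary: F a)
  case 0
  then show ?case
    by (auto simp: smooth_bdd_def bounded_scaleR_comp)
next
  case (Suc k)
  show ?case
  proof (rule smooth_bdd_SucI[OF assms(1)])
    show "bounded ((\<lambda>x. a x *\<^sub>R F x) ` S)"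
      using Suc.prems by (auto simp: smooth_bdd_def bounded_scaleR_comp)
    show "((\<lambda>x. a x *\<^sub>R F x) has_derivative
        (\<lambda>v. a x *\<^sub>R frechet_derivative F (at x) v + frechet_derivative a (at x) v *\<^sub>R F x)) (at x)"
      if "x \<in> S" for x
      by (intro has_derivative_scaleR smooth_bdd_has_derivative[OF Suc.prems(1) that]
          smooth_bdd_has_derivative[OF Suc.prems(2) that])
    show "smooth_bdd k S
        (\<lambda>x. a x *\<^sub>R frechet_derivative F (at x) v + frechet_derivative a (at x) v *\<^sub>R F x)" for v
      \<comment> \<open>The factor that is not differentiated has to be weakened from level
        \<open>Suc k\<close> to level \<open>k\<close> before the induction hypothesis
        applies.\<close>
      using Suc.prems smooth_bdd_mono[OF Suc.prems(1), of k] smooth_bdd_mono[OF Suc.prems(2), of k]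
      by (intro smooth_bdd_add assms(1) Suc.IH) (auto simp: smooth_bdd_Suc)
  qed
qed

text \<open>The recursion bounds each directional derivative with its own constant; expanding the
  direction in the finite basis turns these into one operator bound uniform on
  \<open>S\<close>.\<close>

lemma smooth_bdd_derivative_bound:
  assumes "smooth_bdd (Suc k) S F"
  shows "\<exists>L. \<forall>x\<in>S. \<forall>v. norm (frechet_derivative F (at x) v) \<le> L * norm v"
proof -
  have "\<exists>b. \<forall>x\<in>S. norm (frechet_derivative F (at x) e) \<le> b" for e
    using assms unfolding smooth_bdd_def bounded_derivs.simps bounded_iff by auto
  then obtain b where b: "\<And>x e. x \<in> S \<Longrightarrow> norm (frechet_derivative F (at x) e) \<le> b e"
    by metis
  have "norm (frechet_derivative F (at x) v) \<le> (\<Sum>e\<in>Basis. b e) * norm v" if "x \<in> S" for x v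
  proof -
    interpret D: linear "frechet_derivative F (at x)"
      using smooth_bdd_has_derivative[OF assms that] by (rule has_derivative_linear)
    have "frechet_derivative F (at x) v = frechet_derivative F (at x) (\<Sum>e\<in>Basis. (v \<bullet> e) *\<^sub>R e)"
      by (simp add: euclidean_representation)
    also have "\<dots> = (\<Sum>e\<in>Basis. (v \<bullet> e) *\<^sub>R frechet_derivative F (at x) e)"
      by (simp add: D.sum D.scale)
    also have "norm \<dots> \<le> (\<Sum>e\<in>Basis. norm v * b e)"
      using b[OF that] Basis_le_norm
      by (intro sum_norm_le) (auto intro!: mult_mono)
    finally show ?thesis
      by (simp add: sum_distrib_left mult.commute)
  qed
  then show ?thesis
    by blast
qed

section \<open>Iterated derivatives along a vector field\<close>

text \<open>The Lie derivative of \<open>g\<close> along \<open>V\<close>. For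
  \<open>V = aug f\<close> it is the total time derivative along solutions, and iterating it from
  \<open>aug f\<close> itself gives the higher derivatives of the solution.\<close>

definition lie :: "('a::euclidean_space \<Rightarrow> 'a) \<Rightarrow> ('a \<Rightarrow> 'b::euclidean_space) \<Rightarrow> 'a \<Rightarrow> 'b" where
  "lie V g x = frechet_derivative g (at x) (V x)"

text \<open>The direction \<open>V x\<close> moves with \<open>x\<close>, while the smoothness class
  speaks of fixed directions; expanding \<open>V x\<close> in the basis leaves sums of products of
  functions in the class. One derivative of \<open>g\<close> is spent.\<close>

lemma smooth_bdd_lie:
  assumes S: "open S" and V: "smooth_bdd k S V" and g: "smooth_bdd (Suc k) S g"
  shows "smooth_bdd k S (lie V g)"
proof (rule smooth_bdd_cong[OF S])
  fix x assume "x \<in> S"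
  interpret D: linear "frechet_derivative g (at x)"
    using smooth_bdd_has_derivative[OF g \<open>x \<in> S\<close>] by (rule has_derivative_linear)
  show "(\<Sum>e\<in>Basis. (V x \<bullet> e) *\<^sub>R frechet_derivative g (at x) e) = lie V g x"
    unfolding lie_def by (subst (2) euclidean_representation[of "V x", symmetric]) (simp add: D.sum D.scale del: euclidean_representation)
next
  show "smooth_bdd k S (\<lambda>x. \<Sum>e\<in>Basis. (V x \<bullet> e) *\<^sub>R frechet_derivative g (at x) e)"
    using g by (intro smooth_bdd_sum smooth_bdd_scaleR S smooth_bdd_linear[OF S _ V, of "\<lambda>w. w \<bullet> _"]
        bounded_linear_inner_left) (auto simp: smooth_bdd_Suc)
qed

lemma smooth_bdd_lie_iterate:
  assumes S: "open S" and V: "smooth_bdd k S V" and g: "smooth_bdd k S g" and "j \<le> k"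
  shows "smooth_bdd (k - j) S ((lie V ^^ j) g)"
  using \<open>j \<le> k\<close>
proof (induction j)
  case (Suc j)
  then have *: "smooth_bdd (Suc (k - Suc j)) S ((lie V ^^ j) g)"
    by (simp add: Suc_diff_Suc)
  have "smooth_bdd (k - Suc j) S V"
    by (rule smooth_bdd_mono[OF V]) simp
  from smooth_bdd_lie[OF S this *] show ?case
    by simp
qed (use g in simp)

text \<open>Keeps what the Taylor estimates consume: one constant for the field, for the members of
  the tower and for their derivatives. Members with index up to \<open>m\<close> are differentiable,
  and \<open>g (Suc m)\<close> occurs only as a derivative along \<open>V\<close>.\<close>

definition lie_tower :: "'a::real_normed_vector set \<Rightarrow> ('a \<Rightarrow> 'a) \<Rightarrow> real \<Rightarrow> nat \<Rightarrow> (nat \<Rightarrow> 'a \<Rightarrow> 'b::real_normed_vector) \<Rightarrow> bool" where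
  "lie_tower S V B m g \<longleftrightarrow> (\<forall>x\<in>S. norm (V x) \<le> B \<and> (\<forall>j\<le>m. norm (g j x) \<le> B \<and>
     (\<exists>D. (g j has_derivative D) (at x) \<and> (\<forall>v. norm (D v) \<le> B * norm v) \<and> D (V x) = g (Suc j) x)))"

lemma lie_tower_exists:
  assumes S: "open S" and V: "smooth_bdd (Suc m) S V" and g: "smooth_bdd (Suc m) S g"
  shows "\<exists>B>0. lie_tower S V B m (\<lambda>j. (lie V ^^ j) g)"
proof -
  have s: "smooth_bdd (Suc (m - j)) S ((lie V ^^ j) g)" if "j \<le> m" for j
    using smooth_bdd_lie_iterate[OF S V g, of j] that by (simp add: Suc_diff_le)
  have "\<exists>b. \<forall>x\<in>S. norm ((lie V ^^ j) g x) \<le> b" if "j \<le> m" for j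
    using s[OF that] by (auto simp: smooth_bdd_def bounded_iff)
  then obtain b where b: "\<And>j x. j \<le> m \<Longrightarrow> x \<in> S \<Longrightarrow> norm ((lie V ^^ j) g x) \<le> b j"
    by metis
  have "\<exists>L. \<forall>x\<in>S. \<forall>v. norm (frechet_derivative ((lie V ^^ j) g) (at x) v) \<le> L * norm v" if "j \<le> m" for j
    using smooth_bdd_derivative_bound[OF s[OF that]] .
  then obtain L where L: "\<And>j x v. j \<le> m \<Longrightarrow> x \<in> S \<Longrightarrow>
      norm (frechet_derivative ((lie V ^^ j) g) (at x) v) \<le> L j * norm v"
    by metis
  obtain c where c: "\<And>x. x \<in> S \<Longrightarrow> norm (V x) \<le> c"
    using V by (auto simp: smooth_bdd_def bounded_iff)
  define B where "B = 1 + \<bar>c\<bar> + (\<Sum>j\<le>m. \<bar>b j\<bar>) + (\<Sum>j\<le>m. \<bar>L j\<bar>)"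
  have nn: "0 \<le> (\<Sum>j\<le>m. \<bar>b j\<bar>)" "0 \<le> (\<Sum>j\<le>m. \<bar>L j\<bar>)"
    by (simp_all add: sum_nonneg)
  have bB: "b j \<le> B" "L j \<le> B" if "j \<le> m" for j
    using member_le_sum[of j "{..m}" "\<lambda>j. \<bar>b j\<bar>"] member_le_sum[of j "{..m}" "\<lambda>j. \<bar>L j\<bar>"] that nn
    by (auto simp: B_def)
  have "norm (V x) \<le> B" if "x \<in> S" for x
    using c[OF that] nn unfolding B_def by linarith
  moreover have "norm ((lie V ^^ j) g x) \<le> B" if "x \<in> S" "j \<le> m" for x j
    using b[OF that(2,1)] bB(1)[OF that(2)] by simp
  moreover have "\<exists>D. ((lie V ^^ j) g has_derivative D) (at x) \<and> (\<forall>v. norm (D v) \<le> B * norm v) \<and>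
      D (V x) = (lie V ^^ Suc j) g x" if "x \<in> S" "j \<le> m" for x j
  proof (intro exI conjI allI)
    show "((lie V ^^ j) g has_derivative frechet_derivative ((lie V ^^ j) g) (at x)) (at x)"
      by (rule smooth_bdd_has_derivative[OF s[OF that(2)] that(1)])
    show "norm (frechet_derivative ((lie V ^^ j) g) (at x) v) \<le> B * norm v" for v
      using L[OF that(2,1), of v] mult_right_mono[OF bB(2)[OF that(2)], of "norm v"] by simp
  qed (simp add: lie_def)
  moreover have "B > 0"
    using nn unfolding B_def by linarith
  ultimately show ?thesis
    unfolding lie_tower_def by blast
qed

section \<open>Taylor expansion along approximate solution curves\<close>

text \<open>The mean value inequality on \<open>{0..s}\<close>, where the derivative is at most
  \<open>M * s ^ n\<close>. Compared with integration the factor \<open>1 / (n + 1)\<close> is given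
  up.\<close>

lemma vector_derivative_power_bound:
  fixes u :: "real \<Rightarrow> 'b::real_normed_vector"
  assumes u: "\<And>s. s \<in> {0..h} \<Longrightarrow> (u has_vector_derivative v s) (at s within {0..h})"
    and v: "\<And>s. s \<in> {0..h} \<Longrightarrow> norm (v s) \<le> M * s ^ n"
    and "0 \<le> M" and s: "s \<in> {0..h}"
  shows "norm (u s - u 0) \<le> M * s ^ Suc n"
proof -
  have "norm (u s - u 0) \<le> (M * s ^ n) * norm (s - 0)"
  proof (rule differentiable_bound[where S = "{0..s}" and f' = "\<lambda>t c. c *\<^sub>R v t"])
    fix t assume t: "t \<in> {0..s}"
    show "(u has_derivative (\<lambda>c. c *\<^sub>R v t)) (at t within {0..s})"
      using has_vector_derivative_within_subset[OF u, of t "{0..s}"] t s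
      by (auto simp: has_vector_derivative_def)
    have "norm (v t) \<le> M * s ^ n"
      using v[of t] t s \<open>0 \<le> M\<close> by (auto intro!: mult_left_mono power_mono elim!: order_trans)
    then show "onorm (\<lambda>c. c *\<^sub>R v t) \<le> M * s ^ n"
      by (simp add: onorm_scaleR_left onorm_id)
  qed (use s in auto)
  then show ?thesis
    using s by (simp add: mult_ac)
qed

definition taylor_sum :: "nat \<Rightarrow> (nat \<Rightarrow> 'b::real_vector) \<Rightarrow> real \<Rightarrow> 'b" where
  "taylor_sum k c s = (\<Sum>l<k. (s ^ l / fact l) *\<^sub>R c l)"

text \<open>The primitive of \<open>taylor_sum k c\<close> that vanishes at 0; \<open>k\<close>
  counts terms, and the highest power is also \<open>k\<close>.\<close>

definition taylor_prim :: "nat \<Rightarrow> (nat \<Rightarrow> 'b::real_vector) \<Rightarrow> real \<Rightarrow> 'b" where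
  "taylor_prim k c s = (\<Sum>l<k. (s ^ Suc l / fact (Suc l)) *\<^sub>R c l)"

lemma taylor_sum_shift: "taylor_sum (Suc k) c s = c 0 + taylor_prim k (\<lambda>l. c (Suc l)) s"
  by (simp add: taylor_sum_def taylor_prim_def sum.lessThan_Suc_shift del: sum.lessThan_Suc fact_Suc)

lemma taylor_prim_0 [simp]: "taylor_prim k c 0 = 0"
  by (simp add: taylor_prim_def)

lemma has_vector_derivative_taylor_prim:
  "(taylor_prim k c has_vector_derivative taylor_sum k c s) (at s within A)"
  unfolding taylor_prim_def taylor_sum_def
proof (rule has_vector_derivative_sum)
  fix l
  have "((\<lambda>x. x ^ Suc l / fact (Suc l)) has_vector_derivative (s ^ l / fact l)) (at s within A)"
    unfolding has_real_derivative_iff_has_vector_derivative[symmetric]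
    by (auto intro!: derivative_eq_intros simp: divide_simps simp del: power_Suc of_nat_Suc)
  from has_vector_derivative_scaleR[OF _ has_vector_derivative_const[of "c l"], of _ _ s A, 
      OF this[unfolded has_real_derivative_iff_has_vector_derivative[symmetric]]]
  show "((\<lambda>x. (x ^ Suc l / fact (Suc l)) *\<^sub>R c l) has_vector_derivative (s ^ l / fact l) *\<^sub>R c l) (at s within A)"
    by simp
qed

lemma lie_towerD:
  assumes "lie_tower S V B m g" "x \<in> S"
  shows "norm (V x) \<le> B" "j \<le> m \<Longrightarrow> norm (g j x) \<le> B"
  using assms by (auto simp: lie_tower_def)

text \<open>Along a curve with defect O(s^k) the derivative of \<open>g j\<close> is
  \<open>g (Suc j)\<close> up to O(s^k), because the derivatives in the tower are bounded.
  Integrating the estimate for index \<open>j + 1\<close> gains one power of \<open>s\<close> for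
  index \<open>j\<close>; the defect permits this as long as \<open>i \<le> k\<close>.\<close>

lemma lie_tower_curve:
  assumes tower: "lie_tower S V B m g" and B: "0 < B" and C: "0 \<le> C" and h: "h \<le> 1"
    and p: "\<And>s. s \<in> {0..h} \<Longrightarrow> p s \<in> S"
      "\<And>s. s \<in> {0..h} \<Longrightarrow> (p has_vector_derivative p' s) (at s within {0..h})"
    and err: "\<And>s. s \<in> {0..h} \<Longrightarrow> norm (p' s - V (p s)) \<le> C * s ^ k"
    and "i \<le> k" "j + i \<le> m" "s \<in> {0..h}"
  shows "norm (g j (p s) - taylor_sum (Suc i) (\<lambda>l. g (j + l) (p 0)) s) \<le> B * (B + C) * real (Suc i) * s ^ Suc i"
  using assms(8-)
proof (induction i arbitrary: j s)
  have deriv: "\<exists>D. ((\<lambda>s. g j (p s)) has_vector_derivative D) (at s within {0..h}) \<and>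
      norm (D - g (Suc j) (p s)) \<le> B * C * s ^ k \<and> norm D \<le> B * (B + C)" if j: "j \<le> m" and s: "s \<in> {0..h}" for j s
  proof -
    note that = j s
    obtain D where D: "(g j has_derivative D) (at (p s))" "\<And>v. norm (D v) \<le> B * norm v"
        "D (V (p s)) = g (Suc j) (p s)"
      using tower p(1)[OF s] j unfolding lie_tower_def by metis
    have "((g j \<circ> p) has_vector_derivative D (p' s)) (at s within {0..h})"
      by (rule vector_derivative_diff_chain_within[OF p(2)[OF that(2)] has_derivative_at_withinI[OF D(1)]])
    moreover have "norm (D (p' s) - g (Suc j) (p s)) \<le> B * (C * s ^ k)"
      using D(2)[of "p' s - V (p s)"] mult_left_mono[OF err[OF that(2)], of B] B
        linear_diff[OF has_derivative_linear[OF D(1)], of "p' s" "V (p s)"] D(3)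
      by (metis less_imp_le order_trans)
    moreover have "norm (p' s) \<le> B + C"
    proof -
      have "s ^ k \<le> 1"
        using that(2) h by (auto intro: power_le_one)
      then have "C * s ^ k \<le> C"
        using C by (simp add: mult_left_le)
      then show ?thesis
        using err[OF that(2)] lie_towerD(1)[OF tower p(1)[OF that(2)]] norm_triangle_sub[of "p' s" "V (p s)"]
        by linarith
    qed
    then have "norm (D (p' s)) \<le> B * (B + C)"
      using D(2)[of "p' s"] mult_left_mono[of "norm (p' s)" "B + C" B] B by linarith
    ultimately show ?thesis
      by (auto simp: o_def mult.assoc)
  qed
  {
    case 0
    obtain D where D: "\<And>s. s \<in> {0..h} \<Longrightarrow> ((\<lambda>s. g j (p s)) has_vector_derivative D s) (at s within {0..h})"
        "\<And>s. s \<in> {0..h} \<Longrightarrow> norm (D s) \<le> B * (B + C)"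
      using deriv[of j] 0 by (metis add_0_right)
    show ?case
      using vector_derivative_power_bound[OF D(1), of "B * (B + C)" 0 s] D(2) 0 B C
      by (simp add: taylor_sum_def)
  next
    case (Suc i)
    \<comment> \<open>Subtracting the primitive of the Taylor sum at index \<open>Suc j\<close>
      leaves a function whose derivative is the error at that index plus the contribution of the
      defect.\<close>
    let ?u = "\<lambda>s. g j (p s) - taylor_prim (Suc i) (\<lambda>l. g (Suc j + l) (p 0)) s"
    obtain D where D: "\<And>s. s \<in> {0..h} \<Longrightarrow> ((\<lambda>s. g j (p s)) has_vector_derivative D s) (at s within {0..h})"
        "\<And>s. s \<in> {0..h} \<Longrightarrow> norm (D s - g (Suc j) (p s)) \<le> B * C * s ^ k"
      using deriv[of j] Suc.prems by (metis le_add1 le_trans)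
    have "norm (?u s - ?u 0) \<le> (B * (B + C) * real (Suc (Suc i))) * s ^ Suc (Suc i)"
    proof (rule vector_derivative_power_bound[OF has_vector_derivative_diff[OF D(1) has_vector_derivative_taylor_prim]])
      fix t assume t: "t \<in> {0..h}"
      have "norm (g (Suc j) (p t) - taylor_sum (Suc i) (\<lambda>l. g (Suc j + l) (p 0)) t)
          \<le> B * (B + C) * real (Suc i) * t ^ Suc i"
        by (rule Suc.IH) (use Suc.prems t in auto)
      \<comment> \<open>\<open>Suc i \<le> k\<close> and \<open>t \<le> 1\<close> absorb the defect
        in the error of the Taylor sum.\<close>
      moreover have "B * C * t ^ k \<le> B * (B + C) * t ^ Suc i"
        using t h Suc.prems B C by (intro mult_mono power_decreasing mult_nonneg_nonneg) auto
      ultimately have "norm (D t - taylor_sum (Suc i) (\<lambda>l. g (Suc j + l) (p 0)) t)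
          \<le> B * (B + C) * t ^ Suc i + B * (B + C) * real (Suc i) * t ^ Suc i"
        using D(2)[OF t] norm_triangle_ineq[of "D t - g (Suc j) (p t)"
            "g (Suc j) (p t) - taylor_sum (Suc i) (\<lambda>l. g (Suc j + l) (p 0)) t"] by simp
      then show "norm (D t - taylor_sum (Suc i) (\<lambda>l. g (Suc j + l) (p 0)) t)
          \<le> (B * (B + C) * real (Suc (Suc i))) * t ^ Suc i"
        by (simp add: algebra_simps)
    qed (use Suc.prems B C in auto)
    then show ?case
      by (simp add: taylor_sum_shift del: power_Suc of_nat_Suc)
        (simp add: algebra_simps del: power_Suc of_nat_Suc)
  }
qed

section \<open>The Taylor polynomial of the flow, regarded as a curve\<close>

definition taylor_curve :: "nat \<Rightarrow> (nat \<Rightarrow> 'a::real_vector \<Rightarrow> 'a) \<Rightarrow> real \<Rightarrow> 'a \<Rightarrow> 'a" where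
  "taylor_curve k g s x = x + taylor_prim k (\<lambda>l. g l x) s"

text \<open>An exact integral curve has zero defect, so the preceding estimate holds with
  \<open>C = 0\<close>; one more integration passes from the field to the curve.\<close>

lemma solution_taylor_curve:
  assumes tower: "lie_tower S (g 0) B m g" and B: "0 < B" and h: "h \<le> 1"
    and p: "\<And>s. s \<in> {0..h} \<Longrightarrow> p s \<in> S"
      "\<And>s. s \<in> {0..h} \<Longrightarrow> (p has_vector_derivative g 0 (p s)) (at s within {0..h})"
    and "i \<le> m" "s \<in> {0..h}"
  shows "norm (p s - taylor_curve (Suc i) g s (p 0)) \<le> B * B * real (Suc i) * s ^ Suc (Suc i)"
proof -
  let ?u = "\<lambda>s. p s - taylor_prim (Suc i) (\<lambda>l. g l (p 0)) s"
  have "norm (?u s - ?u 0) \<le> B * B * real (Suc i) * s ^ Suc (Suc i)"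
  proof (rule vector_derivative_power_bound[OF has_vector_derivative_diff[OF p(2) has_vector_derivative_taylor_prim]])
    fix t assume "t \<in> {0..h}"
    then show "norm (g 0 (p t) - taylor_sum (Suc i) (\<lambda>l. g l (p 0)) t) \<le> B * B * real (Suc i) * t ^ Suc i"
      using lie_tower_curve[OF tower B order_refl h p, of i i 0 t] \<open>i \<le> m\<close> by simp
  qed (use assms in auto)
  then show ?thesis
    by (simp add: taylor_curve_def algebra_simps del: power_Suc of_nat_Suc)
qed

lemma norm_taylor_sum_le:
  assumes "\<And>l. l < k \<Longrightarrow> norm (c l) \<le> B" "0 \<le> s" "s \<le> 1"
  shows "norm (taylor_sum k c s) \<le> real k * B"
proof -
  have "norm ((s ^ l / fact l) *\<^sub>R c l) \<le> B" if "l < k" for l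
  proof -
    have "s ^ l / fact l \<le> 1"
      using assms by (simp add: divide_le_eq order_trans[OF power_le_one fact_ge_1])
    then show ?thesis
      using assms(1)[OF that] assms(2) mult_left_le_one_le[of "norm (c l)" "s ^ l / fact l"] by simp
  qed
  then have "norm (taylor_sum k c s) \<le> (\<Sum>l<k. B)"
    unfolding taylor_sum_def by (intro sum_norm_le) auto
  then show ?thesis
    by simp
qed

lemma norm_taylor_prim_le:
  assumes "\<And>l. l < k \<Longrightarrow> norm (c l) \<le> B" "0 \<le> s" "s \<le> 1"
  shows "norm (taylor_prim k c s) \<le> s * (real k * B)"
proof -
  have "norm ((s ^ Suc l / fact (Suc l)) *\<^sub>R c l) \<le> s * B" if "l < k" for l
  proof -
    have "s ^ l / fact (Suc l) \<le> 1"
      using assms by (simp add: divide_le_eq order_trans[OF power_le_one fact_ge_1] del: fact_Suc)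
    then have "s ^ l / fact (Suc l) * norm (c l) \<le> B"
      using assms(1)[OF that] assms(2) mult_left_le_one_le[of "norm (c l)" "s ^ l / fact (Suc l)"]
      by (simp del: fact_Suc)
    from mult_left_mono[OF this assms(2)] show ?thesis
      using assms(2) by (simp add: mult_ac abs_mult del: fact_Suc)
  qed
  then have "norm (taylor_prim k c s) \<le> (\<Sum>l<k. s * B)"
    unfolding taylor_prim_def by (intro sum_norm_le) auto
  then show ?thesis
    by (simp add: mult_ac)
qed

lemma taylor_curve_mem:
  assumes tower: "lie_tower S (g 0) B m g" and "0 < B" and S: "cball x \<rho> \<subseteq> S" and "k \<le> Suc m"
    and "0 \<le> s" "s \<le> 1" "s * (real k * B) \<le> \<rho>"
  shows "taylor_curve k g s x \<in> S"
proof -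
  have "0 \<le> s * (real k * B)"
    using assms by simp
  with assms(7) have "0 \<le> \<rho>"
    by linarith
  then have "x \<in> S"
    using S by auto
  then have "norm (taylor_prim k (\<lambda>l. g l x) s) \<le> s * (real k * B)"
    using assms lie_towerD(2)[OF tower] by (intro norm_taylor_prim_le) auto
  then have "taylor_curve k g s x \<in> cball x \<rho>"
    using assms by (auto simp: taylor_curve_def dist_norm)
  then show ?thesis
    using S by blast
qed

lemma has_vector_derivative_taylor_curve:
  "((\<lambda>s. taylor_curve k g s x) has_vector_derivative taylor_sum k (\<lambda>l. g l x) s) (at s within A)"
  using has_vector_derivative_add[OF has_vector_derivative_const[of x] has_vector_derivative_taylor_prim]
  by (simp add: taylor_curve_def)

lemma taylor_curve_defect:
  assumes tower: "lie_tower S (g 0) B m g" and B: "0 < B" and "k \<le> Suc m" "j \<le> k"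
  shows "\<exists>C\<ge>0. \<forall>x h s. cball x \<rho> \<subseteq> S \<longrightarrow> h \<le> 1 \<longrightarrow> h * (real k * B) \<le> \<rho> \<longrightarrow> s \<in> {0..h} \<longrightarrow>
    norm (taylor_sum k (\<lambda>l. g l x) s - g 0 (taylor_curve k g s x)) \<le> C * s ^ j"
  using \<open>j \<le> k\<close>
proof (induction j)
  have mem: "x \<in> S \<and> taylor_curve k g s x \<in> S"
    if "cball x \<rho> \<subseteq> S" "h \<le> 1" "h * (real k * B) \<le> \<rho>" "s \<in> {0..h}" for x h s
  proof -
    have *: "s * (real k * B) \<le> \<rho>" "0 \<le> s * (real k * B)"
      using that B mult_right_mono[of s h "real k * B"] by auto
    then have "x \<in> S"
      using that(1) by auto
    then show ?thesis
      using taylor_curve_mem[OF tower B that(1) \<open>k \<le> Suc m\<close>, of s] * that by auto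
  qed
  {
    case 0
    have "norm (taylor_sum k (\<lambda>l. g l x) s - g 0 (taylor_curve k g s x)) \<le> (real k * B + B) * s ^ 0"
      if "cball x \<rho> \<subseteq> S" "h \<le> 1" "h * (real k * B) \<le> \<rho>" "s \<in> {0..h}" for x h s
    proof -
      have "norm (taylor_sum k (\<lambda>l. g l x) s) \<le> real k * B"
        using mem[OF that] lie_towerD(2)[OF tower] \<open>k \<le> Suc m\<close> that by (intro norm_taylor_sum_le) auto
      then show ?thesis
        using lie_towerD(1)[OF tower, of "taylor_curve k g s x"] mem[OF that]
          norm_triangle_ineq4[of "taylor_sum k (\<lambda>l. g l x) s" "g 0 (taylor_curve k g s x)"] by simp
    qed
    moreover have "real k * B + B \<ge> 0"
      using B by simp
    ultimately show ?case
      by blast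
  next
    case (Suc j)
    obtain C where C: "C \<ge> 0" "\<And>x h s. \<lbrakk>cball x \<rho> \<subseteq> S; h \<le> 1; h * (real k * B) \<le> \<rho>; s \<in> {0..h}\<rbrakk> \<Longrightarrow>
        norm (taylor_sum k (\<lambda>l. g l x) s - g 0 (taylor_curve k g s x)) \<le> C * s ^ j"
      using Suc by auto
    define C' where "C' = B * (B + C) * real (Suc j) + real k * B"
    have "norm (taylor_sum k (\<lambda>l. g l x) s - g 0 (taylor_curve k g s x)) \<le> C' * s ^ Suc j"
      if *: "cball x \<rho> \<subseteq> S" "h \<le> 1" "h * (real k * B) \<le> \<rho>" "s \<in> {0..h}" for x h s
    proof -
      have "norm (g 0 (taylor_curve k g s x) - taylor_sum (Suc j) (\<lambda>l. g (0 + l) (taylor_curve k g 0 x)) s)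
          \<le> B * (B + C) * real (Suc j) * s ^ Suc j"
        by (rule lie_tower_curve[OF tower B C(1) *(2), of "\<lambda>s. taylor_curve k g s x"
              "taylor_sum k (\<lambda>l. g l x)" j])
          (use mem[OF *(1-3)] Suc.prems \<open>k \<le> Suc m\<close> C(2)[OF *(1-3)] *
            in \<open>auto intro: has_vector_derivative_taylor_curve\<close>)
      then have 1: "norm (g 0 (taylor_curve k g s x) - taylor_sum (Suc j) (\<lambda>l. g l x) s)
          \<le> B * (B + C) * real (Suc j) * s ^ Suc j"
        by (simp add: taylor_curve_def)
      \<comment> \<open>The terms of the velocity that the shorter sum omits carry powers of at
        least \<open>Suc j\<close>.\<close>
      have "taylor_sum k (\<lambda>l. g l x) s - taylor_sum (Suc j) (\<lambda>l. g l x) s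
          = (\<Sum>l = Suc j..<k. (s ^ l / fact l) *\<^sub>R g l x)"
        using sum_diff_nat_ivl[of 0 "Suc j" k "\<lambda>l. (s ^ l / fact l) *\<^sub>R g l x"] Suc.prems
        unfolding taylor_sum_def lessThan_atLeast0 by simp
      also have "norm \<dots> \<le> (\<Sum>l = Suc j..<k. B * s ^ Suc j)"
      proof (rule sum_norm_le)
        fix l assume l: "l \<in> {Suc j..<k}"
        have "s ^ l / fact l \<le> s ^ Suc j / 1"
          using l * by (intro frac_le power_decreasing) auto
        moreover have "norm (g l x) \<le> B"
          using l lie_towerD(2)[OF tower] \<open>k \<le> Suc m\<close> mem[OF *] by auto
        ultimately show "norm ((s ^ l / fact l) *\<^sub>R g l x) \<le> B * s ^ Suc j"
          using * mult_mono[of "s ^ l / fact l" "s ^ Suc j" "norm (g l x)" B]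
          by (simp add: mult.commute[of B] del: power_Suc)
      qed
      also have "\<dots> \<le> real k * B * s ^ Suc j"
        using * B by (simp add: mult.assoc del: power_Suc) (intro mult_right_mono; simp)
      finally have 2: "norm (taylor_sum k (\<lambda>l. g l x) s - taylor_sum (Suc j) (\<lambda>l. g l x) s) \<le> real k * B * s ^ Suc j" .
      have "norm (taylor_sum k (\<lambda>l. g l x) s - g 0 (taylor_curve k g s x))
          \<le> real k * B * s ^ Suc j + B * (B + C) * real (Suc j) * s ^ Suc j"
        using norm_triangle_le[OF add_mono[OF 2 1[unfolded norm_minus_commute[of "g 0 _"]]]] by simp
      then show ?thesis
        by (simp add: C'_def algebra_simps)
    qed
    moreover have "C' \<ge> 0"
      using B C(1) by (simp add: C'_def)
    ultimately show ?case
      by blast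
  }
qed

text \<open>One term more than the velocity contains: the defect O(s^k) still allows the estimate
  along curves with \<open>i = k\<close>, which reaches order \<open>Suc k\<close>. This yields the
  value of \<open>f\<close> at a stage of accuracy \<open>k\<close>.\<close>

lemma field_along_taylor_curve:
  assumes tower: "lie_tower S (g 0) B m g" and B: "0 < B" and "k \<le> m"
  shows "\<exists>C\<ge>0. \<forall>x s. cball x \<rho> \<subseteq> S \<longrightarrow> 0 \<le> s \<longrightarrow> s \<le> 1 \<longrightarrow> s * (real k * B) \<le> \<rho> \<longrightarrow>
    norm (g 0 (taylor_curve k g s x) - taylor_sum (Suc k) (\<lambda>l. g l x) s) \<le> C * s ^ Suc k"
proof -
  obtain C where C: "C \<ge> 0" "\<And>x h s. \<lbrakk>cball x \<rho> \<subseteq> S; h \<le> 1; h * (real k * B) \<le> \<rho>; s \<in> {0..h}\<rbrakk> \<Longrightarrow>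
      norm (taylor_sum k (\<lambda>l. g l x) s - g 0 (taylor_curve k g s x)) \<le> C * s ^ k"
    using taylor_curve_defect[OF tower B _ order_refl, of k \<rho>] \<open>k \<le> m\<close> by auto
  have "norm (g 0 (taylor_curve k g s x) - taylor_sum (Suc k) (\<lambda>l. g l x) s)
      \<le> B * (B + C) * real (Suc k) * s ^ Suc k"
    if *: "cball x \<rho> \<subseteq> S" "0 \<le> s" "s \<le> 1" "s * (real k * B) \<le> \<rho>" for x s
  proof -
    have "taylor_curve k g t x \<in> S" if "t \<in> {0..s}" for t
      using that * mult_right_mono[of t s "real k * B"] B \<open>k \<le> m\<close>
      by (intro taylor_curve_mem[OF tower B *(1)]) auto
    then have "norm (g 0 (taylor_curve k g s x) - taylor_sum (Suc k) (\<lambda>l. g (0 + l) (taylor_curve k g 0 x)) s)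
        \<le> B * (B + C) * real (Suc k) * s ^ Suc k"
      by (intro lie_tower_curve[OF tower B C(1) *(3), of "\<lambda>s. taylor_curve k g s x"
              "taylor_sum k (\<lambda>l. g l x)" k])
        (use C(2)[OF *(1,3,4)] * \<open>k \<le> m\<close> in \<open>auto intro: has_vector_derivative_taylor_curve\<close>)
    then show ?thesis
      by (simp add: taylor_curve_def)
  qed
  moreover have "B * (B + C) * real (Suc k) \<ge> 0"
    using B C(1) by simp
  ultimately show ?thesis
    by blast
qed

text \<open>Each coefficient \<open>g l\<close> is Lipschitz with constant \<open>B\<close> on a
  convex set and comes with a factor \<open>s\<close>. The excess over 1 is therefore proportional
  to \<open>s\<close>, as the Gronwall argument requires.\<close>

lemma taylor_curve_lipschitz:
  assumes tower: "lie_tower S (g 0) B m g" and B: "0 < B" and "k \<le> Suc m" "0 \<le> s" "s \<le> 1"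
    and "convex A" "A \<subseteq> S" "x \<in> A" "z \<in> A"
  shows "norm (taylor_curve k g s x - taylor_curve k g s z) \<le> (1 + s * (real k * B)) * norm (x - z)"
proof -
  have g: "norm (g l x - g l z) \<le> B * norm (x - z)" if "l < k" for l
  proof -
    have "\<exists>D. (g l has_derivative D) (at w) \<and> (\<forall>v. norm (D v) \<le> B * norm v)" if "w \<in> A" for w
      using tower that \<open>A \<subseteq> S\<close> \<open>l < k\<close> \<open>k \<le> Suc m\<close> unfolding lie_tower_def
      by (metis less_Suc_eq_le order_less_le_trans subsetD)
    then obtain D where D: "\<And>w. w \<in> A \<Longrightarrow> (g l has_derivative D w) (at w)"
        "\<And>w v. w \<in> A \<Longrightarrow> norm (D w v) \<le> B * norm v"
      by metis
    show ?thesis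
      by (rule differentiable_bound[OF \<open>convex A\<close> _ _ \<open>x \<in> A\<close> \<open>z \<in> A\<close>, where f' = D])
        (use D B in \<open>auto intro: has_derivative_at_withinI onorm_bound\<close>)
  qed
  have "taylor_curve k g s x - taylor_curve k g s z = (x - z) + taylor_prim k (\<lambda>l. g l x - g l z) s"
    by (simp add: taylor_curve_def taylor_prim_def sum_subtractf scaleR_diff_right)
  also have "norm \<dots> \<le> norm (x - z) + s * (real k * (B * norm (x - z)))"
    using g assms by (intro norm_triangle_mono norm_taylor_prim_le) auto
  finally show ?thesis
    by (simp add: algebra_simps)
qed

section \<open>Functions of diagonalizable matrices\<close>

lemma matrix_inv_mult:
  assumes "invertible A" shows "matrix_inv A ** A = mat 1" "A ** matrix_inv A = mat 1"
proof -
  have "A ** matrix_inv A = mat 1 \<and> matrix_inv A ** A = mat 1"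
    unfolding matrix_inv_def by (rule someI_ex) (use assms in \<open>simp add: invertible_def\<close>)
  then show "matrix_inv A ** A = mat 1" "A ** matrix_inv A = mat 1"
    by auto
qed

lemma diag_matrix_mult_nth: "(diag_matrix d ** M) $ i $ j = d $ i * M $ i $ j"
  by (simp add: matrix_matrix_mult_def diag_matrix_def if_distrib[of "\<lambda>x. x * _"] cong: if_cong)

lemma mult_diag_matrix_nth: "(M ** diag_matrix d) $ i $ j = M $ i $ j * d $ j"
  by (simp add: matrix_matrix_mult_def diag_matrix_def if_distrib[of "\<lambda>x. _ * x"] cong: if_cong)

lemma diag_matrix_mult_vec_nth: "(diag_matrix d *v w) $ i = d $ i * w $ i"
  by (simp add: matrix_vector_mult_def diag_matrix_def if_distrib[of "\<lambda>x. x * _"] cong: if_cong)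

text \<open>\<open>Y\<^sup>-\<^sup>1 X\<close> intertwines the two diagonal matrices, hence also their images under \<open>\<phi>\<close>.\<close>

lemma diagonalizes_fun_unique:
  assumes "diagonalizes A X d" "diagonalizes A Y e"
  shows "X ** diag_matrix (\<chi> i. \<phi> (d $ i)) ** matrix_inv X = Y ** diag_matrix (\<chi> i. \<phi> (e $ i)) ** matrix_inv Y"
proof -
  have inv: "matrix_inv X ** X = mat 1" "X ** matrix_inv X = mat 1"
      "matrix_inv Y ** Y = mat 1" "Y ** matrix_inv Y = mat 1"
    using assms by (auto simp: diagonalizes_def matrix_inv_mult)
  have A: "X ** diag_matrix d ** matrix_inv X = Y ** diag_matrix e ** matrix_inv Y"
    using assms by (simp add: diagonalizes_def)
  define M where "M = matrix_inv Y ** X"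
  have "M ** diag_matrix d = matrix_inv Y ** (X ** diag_matrix d ** matrix_inv X) ** X"
    by (simp add: M_def matrix_mul_assoc[symmetric] inv)
  also have "\<dots> = diag_matrix e ** M"
    by (simp add: A M_def matrix_mul_assoc inv)
  finally have "M $ i $ j * d $ j = e $ i * M $ i $ j" for i j
    by (metis diag_matrix_mult_nth mult_diag_matrix_nth)
  \<comment> \<open>Where an entry of \<open>M\<close> is nonzero the two eigenvalues coincide, so
    their images under \<phi> do as well.\<close>
  then have "M $ i $ j = 0 \<or> d $ j = e $ i" for i j
    by (metis mult.commute mult_cancel_left)
  then have "M ** diag_matrix (\<chi> i. \<phi> (d $ i)) = diag_matrix (\<chi> i. \<phi> (e $ i)) ** M"
    unfolding vec_eq_iff mult_diag_matrix_nth diag_matrix_mult_nth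
    by (metis (no_types, lifting) mult.commute mult_zero_left vec_lambda_beta)
  then have "Y ** (M ** diag_matrix (\<chi> i. \<phi> (d $ i))) ** matrix_inv X
      = Y ** (diag_matrix (\<chi> i. \<phi> (e $ i)) ** M) ** matrix_inv X"
    by simp
  moreover have "Y ** (M ** N) ** matrix_inv X = X ** N ** matrix_inv X" for N
    by (simp add: M_def matrix_mul_assoc inv)
  moreover have "Y ** (N ** M) ** matrix_inv X = Y ** N ** matrix_inv Y" for N
    by (simp add: M_def matrix_mul_assoc[symmetric] inv)
  ultimately show ?thesis
    by simp
qed

text \<open>\<open>matrix_fun\<close> is a choice; uniqueness lets any convenient diagonalization
  compute it, in particular a well-conditioned one.\<close>

lemma matrix_fun_eq:
  assumes "diagonalizes A X d"
  shows "matrix_fun \<phi> A = X ** diag_matrix (\<chi> i. \<phi> (d $ i)) ** matrix_inv X"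
proof -
  have "\<exists>X d. diagonalizes A X d \<and> matrix_fun \<phi> A = X ** diag_matrix (\<chi> i. \<phi> (d $ i)) ** matrix_inv X"
    unfolding matrix_fun_def by (rule someI_ex) (use assms in blast)
  then show ?thesis
    using diagonalizes_fun_unique[OF assms] by metis
qed

text \<open>The eigenvector matrix is unchanged, so one condition number bound serves all multiples
  of a Jacobian.\<close>

lemma diagonalizes_scale:
  assumes "diagonalizes (cmatrix A) X d"
  shows "diagonalizes (cmatrix (c *\<^sub>R A)) X (\<chi> i. of_real c * d $ i)"
proof -
  have "cmatrix (c *\<^sub>R A) = c *\<^sub>R cmatrix A"
    by (simp add: cmatrix_def vec_eq_iff complex_eq_iff)
  also have "\<dots> = X ** (c *\<^sub>R diag_matrix d) ** matrix_inv X"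
    using assms by (simp add: diagonalizes_def matrix_scalar_ac scalar_matrix_assoc)
  also have "c *\<^sub>R diag_matrix d = diag_matrix (\<chi> i. of_real c * d $ i)"
    by (simp add: diag_matrix_def vec_eq_iff complex_eq_iff)
  finally show ?thesis
    using assms by (simp add: diagonalizes_def)
qed

section \<open>Norms and eigenvalues of complexified real matrices\<close>

lemma bounded_linear_complex_matrix: "bounded_linear ((*v) (A :: complex^'n^'m))"
proof -
  have "linear ((*v) A)"
    by (rule matrix_vector_mul_linear)
  then show ?thesis
    by (simp add: linear_conv_bounded_linear)
qed

lemma norm_cvector: "norm (cvector v) = norm v"
  by (simp add: norm_vec_def cvector_def)

lemma norm_Re_vec_le: "norm (\<chi> i. Re (w $ i)) \<le> norm w"
  unfolding norm_vec_def by (rule L2_set_mono) (auto simp: abs_Re_le_cmod)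

lemma norm_Im_vec_le: "norm (\<chi> i. Im (w $ i)) \<le> norm w"
  unfolding norm_vec_def by (rule L2_set_mono) (auto simp: abs_Im_le_cmod)

lemma norm_smult_complex_vec: "norm (c *s w) = cmod c * norm (w :: complex^'n)"
  unfolding norm_vec_def L2_set_def
  by (simp add: norm_mult power_mult_distrib sum_distrib_left[symmetric] real_sqrt_mult)

lemma cmatrix_mult_cvector: "cmatrix A *v cvector v = cvector (A *v v)"
  by (simp add: cmatrix_def cvector_def matrix_vector_mult_def vec_eq_iff)

text \<open>Real and imaginary parts are treated separately, which costs the factor 2. This factor
  returns as the radius \<open>2 * b\<close> in which scalar functions are compared.\<close>

lemma norm_cmatrix_mult_le:
  assumes "\<And>u. norm (A *v u) \<le> b * norm u" "0 \<le> b"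
  shows "norm (cmatrix A *v w) \<le> 2 * b * norm w"
proof -
  define u v where "u = (\<chi> i. Re (w $ i))" and "v = (\<chi> i. Im (w $ i))"
  have "w = cvector u + \<i> *s cvector v"
    by (simp add: u_def v_def cvector_def vec_eq_iff complex_eq_iff)
  then have "cmatrix A *v w = cvector (A *v u) + \<i> *s cvector (A *v v)"
    by (simp add: matrix_vector_mult_add_rdistrib matrix_vector_right_distrib vector_scalar_commute
        cmatrix_mult_cvector)
  also have "norm \<dots> \<le> b * norm u + b * norm v"
    by (rule norm_triangle_mono) (simp_all add: norm_cvector norm_smult_complex_vec assms)
  also have "\<dots> \<le> b * norm w + b * norm w"
    unfolding u_def v_def using assms(2) by (intro add_mono mult_left_mono norm_Re_vec_le norm_Im_vec_le)
  finally show ?thesis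
    by simp
qed

lemma diagonalizes_eigenvector:
  assumes "diagonalizes A X d"
  shows "A *v (X *v axis i 1) = d $ i *s (X *v axis i 1)" "X *v axis i 1 \<noteq> 0"
proof -
  have inv: "matrix_inv X ** X = mat 1"
    using assms by (auto simp: diagonalizes_def matrix_inv_mult)
  have "A *v (X *v axis i 1) = X *v (diag_matrix d *v (matrix_inv X *v (X *v axis i 1)))"
    using assms by (simp add: diagonalizes_def matrix_vector_mul_assoc matrix_mul_assoc)
  also have "matrix_inv X *v (X *v axis i 1) = axis i 1"
    by (simp add: matrix_vector_mul_assoc inv)
  also have "diag_matrix d *v axis i 1 = d $ i *s axis i 1"
    by (auto simp: vec_eq_iff diag_matrix_mult_vec_nth axis_def)
  finally show "A *v (X *v axis i 1) = d $ i *s (X *v axis i 1)"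
    by (simp add: vector_scalar_commute)
  show "X *v axis i 1 \<noteq> 0"
  proof
    assume "X *v axis i 1 = 0"
    then have "matrix_inv X *v (X *v axis i 1) = 0"
      by simp
    then show False
      by (simp add: matrix_vector_mul_assoc inv axis_eq_0_iff)
  qed
qed

lemma diagonalizes_eigenvalue_le:
  assumes "diagonalizes A X d" "\<And>w. norm (A *v w) \<le> b * norm w"
  shows "cmod (d $ i) \<le> b"
proof -
  let ?w = "X *v axis i 1"
  have "cmod (d $ i) * norm ?w \<le> b * norm ?w"
    using assms(2)[of ?w] diagonalizes_eigenvector(1)[OF assms(1), of i] by (simp add: norm_smult_complex_vec)
  then show ?thesis
    using diagonalizes_eigenvector(2)[OF assms(1), of i] by simp
qed

lemma norm_diag_matrix_mult_le:
  assumes "\<And>i. cmod (d $ i) \<le> b" "0 \<le> b"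
  shows "norm (diag_matrix d *v w) \<le> b * norm w"
proof -
  have "norm (diag_matrix d *v w) \<le> L2_set (\<lambda>i. b * norm (w $ i)) UNIV"
    unfolding norm_vec_def using assms
    by (intro L2_set_mono) (auto simp: diag_matrix_mult_vec_nth norm_mult intro!: mult_right_mono)
  also have "\<dots> = b * norm w"
    using assms(2) by (simp add: norm_vec_def L2_set_right_distrib)
  finally show ?thesis .
qed

lemma diagonalizes_power:
  assumes "diagonalizes A X d"
  shows "((*v) A ^^ i) u = X *v (diag_matrix (\<chi> k. d $ k ^ i) *v (matrix_inv X *v u))"
proof (induction i)
  case 0
  have "diag_matrix (\<chi> k. d $ k ^ 0) *v x = x" for x
    by (simp add: vec_eq_iff diag_matrix_mult_vec_nth)
  moreover have "X *v (matrix_inv X *v u) = u"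
    using assms by (simp add: diagonalizes_def matrix_vector_mul_assoc matrix_inv_mult)
  ultimately show ?case
    by simp
next
  case (Suc i)
  have "((*v) A ^^ Suc i) u = X *v (diag_matrix d *v (matrix_inv X *v (X *v (diag_matrix (\<chi> k. d $ k ^ i) *v (matrix_inv X *v u)))))"
    using Suc assms by (simp add: diagonalizes_def matrix_vector_mul_assoc matrix_mul_assoc)
  also have "matrix_inv X *v (X *v x) = x" for x
    using assms by (simp add: diagonalizes_def matrix_vector_mul_assoc matrix_inv_mult)
  also have "diag_matrix d *v (diag_matrix (\<chi> k. d $ k ^ i) *v x) = diag_matrix (\<chi> k. d $ k ^ Suc i) *v x" for x
    by (simp add: vec_eq_iff diag_matrix_mult_vec_nth)
  finally show ?case .
qed

text \<open>In the eigenbasis the error is diagonal with entries at most \<open>E\<close>, and the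
  change of basis costs the condition number. Passing to real parts fixes the polynomial part, which
  is real, and does not enlarge the rest.\<close>

lemma exact_action_expansion:
  fixes a :: "nat \<Rightarrow> real" and A :: "real^'n^'n"
  assumes diag: "diagonalizes (cmatrix A) X d"
    and K: "onorm ((*v) X) * onorm ((*v) (matrix_inv X)) \<le> K"
    and A: "\<And>u. norm (A *v u) \<le> b * norm u" "0 \<le> b"
    and \<phi>: "\<And>z. cmod z \<le> 2 * b \<Longrightarrow> cmod (\<phi> z - (\<Sum>i<l. of_real (a i) * z ^ i)) \<le> E"
  shows "norm (exact_action \<phi> A v - (\<Sum>i<l. a i *\<^sub>R ((*v) A ^^ i) v)) \<le> K * E * norm v"
proof -
  let ?u = "matrix_inv X *v cvector v"
  let ?p = "\<lambda>z. \<Sum>i<l. of_real (a i) * z ^ i"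
  have pow: "((*v) (cmatrix A) ^^ i) (cvector v) = cvector (((*v) A ^^ i) v)" for i
    by (induction i) (auto simp: cmatrix_mult_cvector)
  have dle: "cmod (d $ i) \<le> 2 * b" for i
    by (rule diagonalizes_eigenvalue_le[OF diag norm_cmatrix_mult_le[OF A]])
  have "E \<ge> 0"
    using \<phi>[OF dle] norm_ge_zero order_trans by blast
  have "linear (cvector :: real^'n \<Rightarrow> _)"
    by (rule linearI) (auto simp: cvector_def vec_eq_iff complex_eq_iff)
  then have "cvector (\<Sum>i<l. a i *\<^sub>R ((*v) A ^^ i) v) = (\<Sum>i<l. a i *\<^sub>R ((*v) (cmatrix A) ^^ i) (cvector v))"
    unfolding pow by (simp add: linear_sum linear_scale)
  also have "\<dots> = X *v (\<Sum>i<l. a i *\<^sub>R (diag_matrix (\<chi> k. d $ k ^ i) *v ?u))"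
    unfolding diagonalizes_power[OF diag]
    by (simp only: linear_sum[OF matrix_vector_mul_linear] linear_scale[OF matrix_vector_mul_linear])
  also have "(\<Sum>i<l. a i *\<^sub>R (diag_matrix (\<chi> k. d $ k ^ i) *v ?u)) = diag_matrix (\<chi> i. ?p (d $ i)) *v ?u"
  proof (subst vec_eq_iff, rule allI)
    fix k
    have "(\<Sum>i<l. a i *\<^sub>R (diag_matrix (\<chi> k. d $ k ^ i) *v ?u)) $ k = (\<Sum>i<l. of_real (a i) * (d $ k ^ i * ?u $ k))"
      by (simp only: sum_component vector_scaleR_component diag_matrix_mult_vec_nth vec_lambda_beta)
        (simp only: scaleR_conv_of_real)
    then show "(\<Sum>i<l. a i *\<^sub>R (diag_matrix (\<chi> k. d $ k ^ i) *v ?u)) $ k = (diag_matrix (\<chi> i. ?p (d $ i)) *v ?u) $ k"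
      unfolding diag_matrix_mult_vec_nth vec_lambda_beta sum_distrib_right by (simp only: mult.assoc)
  qed
  finally have "matrix_fun \<phi> (cmatrix A) *v cvector v - cvector (\<Sum>i<l. a i *\<^sub>R ((*v) A ^^ i) v)
      = X *v (diag_matrix (\<chi> i. \<phi> (d $ i)) *v ?u - diag_matrix (\<chi> i. ?p (d $ i)) *v ?u)"
    by (simp only: matrix_fun_eq[OF diag] matrix_vector_mul_assoc[symmetric] matrix_vector_mult_diff_distrib)
  also have "diag_matrix (\<chi> i. \<phi> (d $ i)) *v ?u - diag_matrix (\<chi> i. ?p (d $ i)) *v ?u
      = diag_matrix (\<chi> i. \<phi> (d $ i) - ?p (d $ i)) *v ?u"
    by (simp add: vec_eq_iff diag_matrix_mult_vec_nth left_diff_distrib)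
  finally have eq: "matrix_fun \<phi> (cmatrix A) *v cvector v - cvector (\<Sum>i<l. a i *\<^sub>R ((*v) A ^^ i) v)
      = X *v (diag_matrix (\<chi> i. \<phi> (d $ i) - ?p (d $ i)) *v ?u)" .
  have "norm (X *v (diag_matrix (\<chi> i. \<phi> (d $ i) - ?p (d $ i)) *v ?u))
      \<le> onorm ((*v) X) * norm (diag_matrix (\<chi> i. \<phi> (d $ i) - ?p (d $ i)) *v ?u)"
    by (rule onorm[OF bounded_linear_complex_matrix])
  also have "\<dots> \<le> onorm ((*v) X) * (E * (onorm ((*v) (matrix_inv X)) * norm v))"
  proof (rule mult_left_mono[OF _ onorm_pos_le[OF bounded_linear_complex_matrix]])
    have "norm (diag_matrix (\<chi> i. \<phi> (d $ i) - ?p (d $ i)) *v ?u) \<le> E * norm ?u"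
      by (rule norm_diag_matrix_mult_le) (use \<phi> dle \<open>E \<ge> 0\<close> in auto)
    also have "norm ?u \<le> onorm ((*v) (matrix_inv X)) * norm v"
      using onorm[OF bounded_linear_complex_matrix, of "matrix_inv X" "cvector v"] by (simp add: norm_cvector)
    finally show "norm (diag_matrix (\<chi> i. \<phi> (d $ i) - ?p (d $ i)) *v ?u) \<le> E * (onorm ((*v) (matrix_inv X)) * norm v)"
      using \<open>E \<ge> 0\<close> by (simp add: mult_left_mono)
  qed
  also have "\<dots> = (onorm ((*v) X) * onorm ((*v) (matrix_inv X))) * (E * norm v)"
    by (simp add: mult_ac)
  also have "\<dots> \<le> K * (E * norm v)"
    using K \<open>E \<ge> 0\<close> by (intro mult_right_mono) auto
  finally have "norm (matrix_fun \<phi> (cmatrix A) *v cvector v - cvector (\<Sum>i<l. a i *\<^sub>R ((*v) A ^^ i) v)) \<le> K * E * norm v"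
    by (simp add: eq mult_ac)
  moreover have "exact_action \<phi> A v - (\<Sum>i<l. a i *\<^sub>R ((*v) A ^^ i) v)
      = (\<chi> i. Re ((matrix_fun \<phi> (cmatrix A) *v cvector v - cvector (\<Sum>i<l. a i *\<^sub>R ((*v) A ^^ i) v)) $ i))"
    by (simp only: exact_action_def cvector_def vec_eq_iff vector_minus_component vec_lambda_beta minus_complex.sel Re_complex_of_real)  simp
  ultimately show ?thesis
    using norm_Re_vec_le[of "matrix_fun \<phi> (cmatrix A) *v cvector v - cvector (\<Sum>i<l. a i *\<^sub>R ((*v) A ^^ i) v)"]
    by simp
qed

section \<open>Pade approximants and the amplification map near the origin\<close>

lemma isCont_complex_poly: "isCont (poly p) (z :: complex)"
  using poly_DERIV DERIV_isCont by blast

lemma exp_taylor_small: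
  assumes "cmod z \<le> 1"
  shows "cmod (exp z - (\<Sum>i<Suc n. z ^ i / fact i)) \<le> 3 * cmod z ^ Suc n"
proof -
  have "exp (cmod z) * cmod z ^ Suc n / fact n \<le> 3 * cmod z ^ Suc n / 1"
    using exp_le exp_mono[OF assms]
    by (intro frac_le mult_right_mono order_trans[OF _ exp_le] zero_le_mult_iff[THEN iffD2]) auto
  then show ?thesis
    using Taylor_exp_field[of z n] by (simp add: lessThan_Suc_atMost)
qed

text \<open>Reduces the order condition to a polynomial identity: \<open>S\<close> is the cofactor
  left when the product of \<open>Q\<close> with the Taylor polynomial is subtracted from
  \<open>P\<close>. The remainder of the exponential series is small, and dividing by
  \<open>Q\<close> is harmless near 0 because \<open>Q\<close> is 1 there.\<close>

lemma is_pade_expI: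
  assumes deg: "degree P = m" "degree Q = n" and Q: "poly Q 0 = 1"
    and S: "\<And>z. poly P z - poly Q z * (\<Sum>i<Suc (m + n). z ^ i / fact i) = z ^ Suc (m + n) * poly S z"
  shows "is_pade_exp m n P Q"
proof -
  let ?r = "\<lambda>z. exp z - (\<Sum>i<Suc (m + n). z ^ i / fact i)"
  let ?g = "\<lambda>z::complex. z ^ Suc (m + n)"
  have ev: "eventually (\<lambda>z. cmod z \<le> 1) (at 0)"
    unfolding eventually_at by (auto intro!: exI[of _ 1])
  have evQ: "eventually (\<lambda>z. poly Q z \<noteq> 0) (at 0)"
    using tendsto_imp_eventually_ne[of "poly Q" 1 "at 0" 0] isCont_complex_poly[where p = Q and z = 0] Q
    by (simp add: isCont_def)
  have "((\<lambda>z. 1 / poly Q z) \<longlongrightarrow> 1 / poly Q 0) (at 0)" "(poly S \<longlongrightarrow> poly S 0) (at 0)"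
    using Q tendsto_divide[OF tendsto_const[of 1] isCont_complex_poly[unfolded isCont_def, where p = Q and z = 0]]
    by (auto intro: isCont_complex_poly[unfolded isCont_def])
  then have b1: "(\<lambda>z. 1 / poly Q z) \<in> O[at 0](\<lambda>_. 1)" "poly S \<in> O[at 0](\<lambda>_. 1)"
    using bigoI_tendsto[of "\<lambda>z. 1 / poly Q z" "\<lambda>_. 1" "1 / poly Q 0" "at 0"]
      bigoI_tendsto[of "poly S" "\<lambda>_. 1" "poly S 0" "at 0"] by auto
  have b2: "poly Q \<in> O[at 0](\<lambda>_. 1)"
    using isCont_complex_poly[where p = Q and z = 0] by (intro bigoI_tendsto[where c = "poly Q 0"]) (auto simp: isCont_def)
  have "?r \<in> O[at 0](?g)"
    by (rule bigoI[of _ 3], rule eventually_mono[OF ev]) (use exp_taylor_small in \<open>auto simp: norm_power norm_mult simp del: sum.lessThan_Suc\<close>)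
  then have "(\<lambda>z. ?g z * poly S z - poly Q z * ?r z) \<in> O[at 0](?g)"
    using landau_o.big.mult[OF b2, of ?r ?g] landau_o.big.mult[OF landau_o.big_refl[of ?g] b1(2)]
    by (intro sum_in_bigo) simp_all
  then have "(\<lambda>z. (?g z * poly S z - poly Q z * ?r z) * (1 / poly Q z)) \<in> O[at 0](\<lambda>z. ?g z * 1)"
    by (intro landau_o.big.mult b1)
  moreover have "eventually (\<lambda>z. (?g z * poly S z - poly Q z * ?r z) * (1 / poly Q z) = poly P z / poly Q z - exp z) (at 0)"
    using evQ
  proof eventually_elim
    case (elim z)
    then show ?case
      unfolding S[of z, symmetric] by (simp add: field_simps del: sum.lessThan_Suc power_Suc)
  qed
  ultimately have "(\<lambda>z. poly P z / poly Q z - exp z) \<in> O[at 0](?g)"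
    by (subst (asm) landau_o.big.in_cong) auto
  then show ?thesis
    using deg Q by (simp add: is_pade_exp_def)
qed

text \<open>\<open>pade_pair\<close> is a choice, so its order property rests on existence. The
  witnesses are the classical fractions, with the cofactors \<open>S\<close> found by multiplying
  out; for numerator degree 0 the denominators are Taylor polynomials of
  \<open>exp (- z)\<close>.\<close>

lemma pade_exp_exists:
  "\<exists>P Q. is_pade_exp 1 1 P Q" "\<exists>P Q. is_pade_exp 0 2 P Q" "\<exists>P Q. is_pade_exp 2 2 P Q"
  "\<exists>P Q. is_pade_exp 0 3 P Q" "\<exists>P Q. is_pade_exp 1 2 P Q" "\<exists>P Q. is_pade_exp 0 4 P Q"
  "\<exists>P Q. is_pade_exp 1 3 P Q"
proof -
  note eqs = eval_nat_numeral fact_Suc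
  have "is_pade_exp 1 1 [:1, 1/2:] [:1, -1/2:]"
    by (rule is_pade_expI[where S = "[:1/4:]"]) (simp_all add: eqs field_simps)
  then show "\<exists>P Q. is_pade_exp 1 1 P Q" by blast
  have "is_pade_exp 0 2 [:1:] [:1, -1, 1/2:]"
    by (rule is_pade_expI[where S = "[:0, -1/4:]"]) (simp_all add: eqs field_simps)
  then show "\<exists>P Q. is_pade_exp 0 2 P Q" by blast
  have "is_pade_exp 2 2 [:1, 1/2, 1/12:] [:1, -1/2, 1/12:]"
    by (rule is_pade_expI[where S = "[:1/144, -1/288:]"]) (simp_all add: eqs field_simps)
  then show "\<exists>P Q. is_pade_exp 2 2 P Q" by blast
  have "is_pade_exp 0 3 [:1:] [:1, -1, 1/2, -1/6:]"
    by (rule is_pade_expI[where S = "[:1/12, 0, 1/36:]"]) (simp_all add: eqs field_simps)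
  then show "\<exists>P Q. is_pade_exp 0 3 P Q" by blast
  have "is_pade_exp 1 2 [:1, 1/3:] [:1, -2/3, 1/6:]"
    by (rule is_pade_expI[where S = "[:1/36, -1/36:]"]) (simp_all add: eqs field_simps)
  then show "\<exists>P Q. is_pade_exp 1 2 P Q" by blast
  have "is_pade_exp 0 4 [:1:] [:1, -1, 1/2, -1/6, 1/24:]"
    by (rule is_pade_expI[where S = "[:0, -1/72, 0, -1/576:]"]) (simp_all add: eqs field_simps)
  then show "\<exists>P Q. is_pade_exp 0 4 P Q" by blast
  have "is_pade_exp 1 3 [:1, 1/4:] [:1, -3/4, 1/4, -1/24:]"
    by (rule is_pade_expI[where S = "[:1/96, -1/288, 1/576:]"]) (simp_all add: eqs field_simps)
  then show "\<exists>P Q. is_pade_exp 1 3 P Q" by blast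
qed

lemma pade_pair_used:
  assumes "(m, n) \<in> pade_used M"
  shows "is_pade_exp m n (fst (pade_pair m n)) (pade_denom m n)"
proof -
  have "\<exists>P Q. is_pade_exp m n P Q"
    using assms pade_exp_exists by (cases M) auto
  then have "\<exists>PQ. is_pade_exp m n (fst PQ) (snd PQ)"
    by auto
  then show ?thesis
    unfolding pade_denom_def pade_pair_def by (rule someI_ex)
qed

text \<open>In this form blending becomes a convex combination of the exponents \<open>L\<close>, which makes all
  estimates uniform in the weight, hence in the cutoff.\<close>

definition exp_polar :: "nat \<Rightarrow> polar_map \<Rightarrow> bool" where
  "exp_polar q P \<longleftrightarrow> (\<exists>C \<rho>. 0 \<le> C \<and> 0 < \<rho> \<and> (\<forall>z. cmod z \<le> \<rho> \<longrightarrow>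
     (\<exists>L. fst P z = exp L \<and> snd P z = Im L \<and> cmod (L - z) \<le> C * cmod z ^ q)))"

lemma exp_polar_mono:
  assumes "exp_polar q P" "p \<le> q" shows "exp_polar p P"
proof -
  obtain C \<rho> where C: "0 \<le> C" "0 < \<rho>" "\<And>z. cmod z \<le> \<rho> \<Longrightarrow>
     \<exists>L. fst P z = exp L \<and> snd P z = Im L \<and> cmod (L - z) \<le> C * cmod z ^ q"
    using assms(1) unfolding exp_polar_def by blast
  have "\<exists>L. fst P z = exp L \<and> snd P z = Im L \<and> cmod (L - z) \<le> C * cmod z ^ p" if "cmod z \<le> min \<rho> 1" for z
  proof -
    have "C * cmod z ^ q \<le> C * cmod z ^ p"
      using C(1) that assms(2) by (intro mult_left_mono power_decreasing) auto
    then show ?thesis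
      using C(3)[of z] that order_trans by fastforce
  qed
  then show ?thesis
    unfolding exp_polar_def using C(1,2) by (intro exI[of _ C] exI[of _ "min \<rho> 1"]) auto
qed

text \<open>The exponent is \<open>z\<close> plus the principal logarithm of the approximant divided
  by \<open>exp z\<close>, a quotient close to 1. The given branch is the imaginary part of this
  exponent, since both are arguments of the same number and both are small near 0.\<close>

lemma exp_polar_pade:
  assumes pade: "is_pade_exp m n (fst (pade_pair m n)) (pade_denom m n)"
    and branch: "arg_branch (pade m n) (\<alpha> m n)"
  shows "exp_polar (m + n + 1) (pade_polar \<alpha> m n)"
proof -
  let ?K = "m + n + 1"
  let ?R = "pade m n"
  \<comment> \<open>The order condition speaks of a punctured neighbourhood; continuity supplies the
    value at 0 itself.\<close>
  have "isCont (\<lambda>z. ?R z - exp z) 0"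
    using pade unfolding pade_def is_pade_exp_def by (intro continuous_intros isCont_complex_poly) auto
  then have lim: "((\<lambda>z. ?R z - exp z) \<longlongrightarrow> ?R 0 - exp 0) (at 0)"
    by (simp add: isCont_def)
  have bigo: "(\<lambda>z. ?R z - exp z) \<in> O[at 0](\<lambda>z. z ^ ?K)"
    using pade unfolding pade_def is_pade_exp_def by simp
  then obtain c where c: "c > 0" "eventually (\<lambda>z. cmod (?R z - exp z) \<le> c * cmod (z ^ ?K)) (at 0)"
    by (elim landau_o.bigE) auto
  have "((\<lambda>z. ?R z - exp z) \<longlongrightarrow> 0) (at 0)"
  proof (rule Lim_null_comparison[OF c(2)])
    have "((\<lambda>z. c * cmod (z ^ ?K)) \<longlongrightarrow> c * cmod (0 ^ ?K)) (at 0)"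
      by (intro tendsto_intros)
    then show "((\<lambda>z. c * cmod (z ^ ?K)) \<longlongrightarrow> 0) (at 0)"
      by simp
  qed
  then have "?R 0 - exp 0 = 0"
    using lim tendsto_unique by (metis trivial_limit_at)
  moreover obtain d where d: "d > 0" "\<And>z. z \<noteq> 0 \<Longrightarrow> cmod z < d \<Longrightarrow> cmod (?R z - exp z) \<le> c * cmod (z ^ ?K)"
    using c(2) unfolding eventually_at by (auto simp: dist_norm)
  ultimately have R: "cmod (?R z - exp z) \<le> c * cmod z ^ ?K" if "cmod z < d" for z
    using that by (cases "z = 0") (auto simp: norm_power norm_mult)
  obtain D where D: "open D" "0 \<in> D" "continuous_on D (\<alpha> m n)" and \<alpha>: "\<alpha> m n 0 = 0" "\<And>z. is_Arg (?R z) (\<alpha> m n z)"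
    using branch unfolding arg_branch_def by auto
  have "isCont (\<alpha> m n) 0"
    using D continuous_on_eq_continuous_at by blast
  then obtain e where e: "e > 0" "\<And>z. cmod z < e \<Longrightarrow> \<bar>\<alpha> m n z\<bar> < 1"
    using \<alpha>(1) unfolding continuous_at_eps_delta by (metis zero_less_one dist_norm diff_zero real_norm_def)
  \<comment> \<open>The radii keep the order estimate valid, the branch below 1, the powers
    decreasing, and the relative error \<open>u\<close> at most 1/4.\<close>
  define \<rho> where "\<rho> = min (min (d / 2) (e / 2)) (min 1 (1 / (12 * c)))"
  have "\<rho> > 0"
    using d e c by (simp add: \<rho>_def)
  have "\<exists>L. ?R z = exp L \<and> \<alpha> m n z = Im L \<and> cmod (L - z) \<le> 6 * c * cmod z ^ ?K" if z: "cmod z \<le> \<rho>" for z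
  proof -
    have *: "cmod z < d" "cmod z < e" "cmod z \<le> 1" "cmod z \<le> 1 / (12 * c)"
      using z d(1) e(1) by (auto simp: \<rho>_def)
    define u where "u = ?R z * exp (- z) - 1"
    have "u = (?R z - exp z) * exp (- z)"
      by (simp add: u_def algebra_simps exp_minus_inverse)
    also have "cmod \<dots> \<le> (c * cmod z ^ ?K) * 3"
      unfolding norm_mult
    proof (rule mult_mono[OF R[OF *(1)]])
      have "cmod (exp (- z)) \<le> exp (cmod (- z))"
        by (rule norm_exp)
      also have "\<dots> \<le> exp 1"
        using *(3) by simp
      finally show "cmod (exp (- z)) \<le> 3"
        using exp_le by linarith
    qed (use c in auto)
    finally have u: "cmod u \<le> 3 * c * cmod z ^ ?K"
      by simp
    also have "\<dots> \<le> 3 * c * cmod z ^ 1"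
      using c *(3) by (intro mult_left_mono power_decreasing) auto
    also have "\<dots> \<le> 1 / 4"
      using *(4) c(1) by (simp add: field_simps)
    finally have u4: "cmod u \<le> 1 / 4" .
    then have Ln: "cmod (Ln (1 + u)) \<le> 2 * cmod u"
      by (intro norm_Ln_le) auto
    have "1 + u \<noteq> 0"
      using u4 by (metis add.commute add_eq_0_iff norm_minus_cancel norm_one not_less one_le_numeral
          divide_less_eq_1_pos less_le_trans zero_less_numeral one_less_numeral_iff semiring_norm(76))
    define L where "L = z + Ln (1 + u)"
    have RL: "?R z = exp L"
      using \<open>1 + u \<noteq> 0\<close> by (simp add: L_def exp_add u_def exp_minus)
    have "\<bar>Im L\<bar> \<le> cmod L"
      by (rule abs_Im_le_cmod)
    also have "\<dots> \<le> 1 + 1 / 2"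
      unfolding L_def by (rule norm_triangle_mono) (use *(3) Ln u4 in auto)
    \<comment> \<open>At most 3/2 from \<open>L\<close> and less than 1 from the branch, together
      below a full turn.\<close>
    finally have "\<bar>Im L - \<alpha> m n z\<bar> < 2 * pi"
      using e(2)[OF *(2)] pi_gt3 by linarith
    moreover have "is_Arg (?R z) (Im L)"
      unfolding is_Arg_def RL by (simp add: norm_exp_eq_Re exp_of_real[symmetric] exp_add[symmetric] complex_eq[symmetric])
    ultimately have "Im L = \<alpha> m n z"
      using is_Arg_eqI[OF _ \<alpha>(2)[of z]] RL by simp
    moreover have "cmod (L - z) \<le> 6 * c * cmod z ^ ?K"
      using Ln u by (simp add: L_def)
    ultimately show ?thesis
      using RL by auto
  qed
  then show ?thesis
    unfolding exp_polar_def pade_polar_def using c(1) \<open>\<rho> > 0\<close>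
    by (intro exI[of _ "6 * c"] exI[of _ \<rho>]) auto
qed

section \<open>Blending as averaging of exponents\<close>

lemma polar_blend_exp:
  assumes "fst F z = exp L" "snd F z = Im L" "fst G z = exp L'" "snd G z = Im L'"
  shows "polar_blend w F G z = exp (w *\<^sub>R L + (1 - w) *\<^sub>R L')"
proof -
  have "of_real (cmod (exp L) powr w * cmod (exp L') powr (1 - w)) * cis ((1 - w) * Im L' + w * Im L)
      = exp (w *\<^sub>R L + (1 - w) *\<^sub>R L')"
    by (subst (3) exp_eq_polar) (simp add: norm_exp_eq_Re powr_def mult_exp_exp add.commute)
  then show ?thesis
    using assms by (auto simp: polar_blend_def)
qed

text \<open>\<open>C\<close> and the radius are chosen before \<open>w\<close>, so the weight may
  vary with the point and with the cutoff. The phase is recorded as well, because a blend can be a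
  parent of another blend.\<close>

lemma polar_blend_near_0:
  assumes "exp_polar q F" "exp_polar q G"
  shows "\<exists>C \<rho>. 0 \<le> C \<and> 0 < \<rho> \<and> (\<forall>z w. cmod z \<le> \<rho> \<longrightarrow> 0 \<le> w \<longrightarrow> w \<le> 1 \<longrightarrow>
     (\<exists>L. polar_blend w F G z = exp L \<and> (1 - w) * snd G z + w * snd F z = Im L \<and> cmod (L - z) \<le> C * cmod z ^ q))"
proof -
  obtain C \<rho> where C: "0 \<le> C" "0 < \<rho>" "\<And>z. cmod z \<le> \<rho> \<Longrightarrow>
     \<exists>L. fst F z = exp L \<and> snd F z = Im L \<and> cmod (L - z) \<le> C * cmod z ^ q"
    using assms(1) unfolding exp_polar_def by blast
  obtain C' \<rho>' where C': "0 \<le> C'" "0 < \<rho>'" "\<And>z. cmod z \<le> \<rho>' \<Longrightarrow>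
     \<exists>L. fst G z = exp L \<and> snd G z = Im L \<and> cmod (L - z) \<le> C' * cmod z ^ q"
    using assms(2) unfolding exp_polar_def by blast
  have "\<exists>L. polar_blend w F G z = exp L \<and> (1 - w) * snd G z + w * snd F z = Im L \<and> cmod (L - z) \<le> (C + C') * cmod z ^ q"
    if z: "cmod z \<le> min \<rho> \<rho>'" and w: "0 \<le> w" "w \<le> 1" for z w
  proof -
    obtain L where L: "fst F z = exp L" "snd F z = Im L" "cmod (L - z) \<le> C * cmod z ^ q"
      using C(3)[of z] z by auto
    obtain L' where L': "fst G z = exp L'" "snd G z = Im L'" "cmod (L' - z) \<le> C' * cmod z ^ q"
      using C'(3)[of z] z by auto
    have "(w *\<^sub>R L + (1 - w) *\<^sub>R L') - z = w *\<^sub>R (L - z) + (1 - w) *\<^sub>R (L' - z)"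
      by (simp add: algebra_simps)
    also have "cmod \<dots> \<le> 1 * (C * cmod z ^ q) + 1 * (C' * cmod z ^ q)"
      unfolding norm_scaleR[symmetric]
      by (rule norm_triangle_mono) (use L(3) L'(3) w in \<open>auto intro: order_trans[OF mult_left_le_one_le]\<close>)
    finally show ?thesis
      using polar_blend_exp[OF L(1,2) L'(1,2), of w] L(2) L'(2) by (auto simp: algebra_simps)
  qed
  then show ?thesis
    using C(1,2) C'(1,2) by (intro exI[of _ "C + C'"] exI[of _ "min \<rho> \<rho>'"]) auto
qed

text \<open>At each point the exponent is an average of two exponents close to \<open>z\<close>,
  whatever the weight is there, and the phase carried by the repaired map is its imaginary
  part.\<close>

lemma exp_polar_repaired:
  assumes "exp_polar q (pade_polar \<alpha> 1 (N - 1))" "exp_polar q (pade_polar \<alpha> 0 N)"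
    and "\<And>z. 0 \<le> \<theta> z \<and> \<theta> z \<le> 1"
  shows "exp_polar q (repaired_map \<alpha> \<theta> N)"
  using polar_blend_near_0[OF assms(1,2)] assms(3) unfolding exp_polar_def repaired_map_def pade_polar_def
  by simp meson

lemma taper_bounds:
  assumes "r < 1" shows "0 \<le> taper r s \<omega>c \<omega>" "taper r s \<omega>c \<omega> \<le> 1"
proof -
  have "0 \<le> (\<omega> - r * \<omega>c) / (\<omega>c - r * \<omega>c) \<and> (\<omega> - r * \<omega>c) / (\<omega>c - r * \<omega>c) \<le> 1"
    if "r * \<omega>c < \<omega>" "\<omega> < \<omega>c"
    using that by (auto simp: divide_simps)
  then show "0 \<le> taper r s \<omega>c \<omega>" "taper r s \<omega>c \<omega> \<le> 1"
    by (auto simp: taper_def power_le_one)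
qed

text \<open>All parents agree with the exponential to order at least
  \<open>Suc (miiso_order M)\<close>, and blending preserves this. The cutoff is quantified after
  the constants.\<close>

lemma amp_map_near_0:
  assumes r: "r < 1"
    and branches: "\<And>m n. (m, n) \<in> pade_used M \<Longrightarrow> arg_branch (pade m n) (\<alpha> m n)"
    and w3: "M = MIISO3 \<Longrightarrow> wedge_weight 3 \<theta>" and w4: "M = MIISO4 \<Longrightarrow> wedge_weight 4 \<theta>"
  shows "\<exists>C \<rho>. 0 \<le> C \<and> 0 < \<rho> \<and> (\<forall>\<omega>c z. cmod z \<le> \<rho> \<longrightarrow>
     cmod (amp_map \<alpha> \<theta> M r s \<omega>c z - exp z) \<le> C * cmod z ^ Suc (miiso_order M))"
proof -
  have pp: "exp_polar q (pade_polar \<alpha> m n)" if "(m, n) \<in> pade_used M" "q \<le> m + n + 1" for m n q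
    using exp_polar_mono[OF exp_polar_pade[where \<alpha> = \<alpha>, OF pade_pair_used[OF that(1)] branches[OF that(1)]] that(2)] .
  have "exp_polar (Suc (miiso_order M)) (parent_C \<alpha> M) \<and> exp_polar (Suc (miiso_order M)) (parent_D \<alpha> \<theta> M)"
  proof (cases M)
    case MIISO2
    then show ?thesis
      by (auto intro!: pp)
  next
    case MIISO3
    then have "\<And>z. 0 \<le> \<theta> z \<and> \<theta> z \<le> 1"
      using w3 by (auto simp: wedge_weight_def)
    with MIISO3 show ?thesis
      by (auto intro!: pp exp_polar_repaired)
  next
    case MIISO4
    then have "\<And>z. 0 \<le> \<theta> z \<and> \<theta> z \<le> 1"
      using w4 by (auto simp: wedge_weight_def)
    with MIISO4 show ?thesis
      by (auto intro!: pp exp_polar_repaired)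
  qed
  then obtain C \<rho> where C: "0 \<le> C" "0 < \<rho>" and L: "\<And>z w. cmod z \<le> \<rho> \<Longrightarrow> 0 \<le> w \<Longrightarrow> w \<le> 1 \<Longrightarrow>
     \<exists>L. polar_blend w (parent_D \<alpha> \<theta> M) (parent_C \<alpha> M) z = exp L \<and> cmod (L - z) \<le> C * cmod z ^ Suc (miiso_order M)"
    using polar_blend_near_0 by meson
  \<comment> \<open>Makes \<open>C * cmod z ^ Suc (miiso_order M)\<close> at most 1, so that the
    series of \<open>exp (L - z)\<close> can be bounded; the factor 9 below is 3 for
    \<open>exp z\<close> times 3 for that series.\<close>
  define \<rho>' where "\<rho>' = min \<rho> (min 1 (1 / (C + 1)))"
  have "cmod (amp_map \<alpha> \<theta> M r s \<omega>c z - exp z) \<le> 9 * C * cmod z ^ Suc (miiso_order M)" if z: "cmod z \<le> \<rho>'" for \<omega>c z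
  proof -
    obtain L where L: "amp_map \<alpha> \<theta> M r s \<omega>c z = exp L" "cmod (L - z) \<le> C * cmod z ^ Suc (miiso_order M)"
      unfolding amp_map_def using L[of z "taper r s \<omega>c (cmod z)", OF _ taper_bounds[OF r]] z
      by (auto simp: \<rho>'_def simp del: power_Suc)
    have z1: "cmod z \<le> 1" "cmod z \<le> 1 / (C + 1)"
      using z by (auto simp: \<rho>'_def)
    have "C * cmod z ^ Suc (miiso_order M) \<le> C * cmod z ^ 1"
      using C z1 by (intro mult_left_mono power_decreasing) auto
    also have "\<dots> \<le> C * (1 / (C + 1))"
      using z1 C by (intro mult_left_mono) auto
    also have "\<dots> \<le> 1"
      using C by (simp add: field_simps)
    finally have d1: "cmod (L - z) \<le> 1"
      using L(2) by simp
    have "exp L - exp z = exp z * (exp (L - z) - 1)"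
      by (simp add: exp_diff field_simps)
    also have "cmod \<dots> \<le> 3 * (3 * cmod (L - z))"
      unfolding norm_mult
    proof (rule mult_mono)
      have "cmod (exp z) \<le> exp 1"
        using norm_exp[of z] z1(1) by (metis exp_le_cancel_iff order_trans)
      then show "cmod (exp z) \<le> 3"
        using exp_le by linarith
      show "cmod (exp (L - z) - 1) \<le> 3 * cmod (L - z)"
        using exp_taylor_small[OF d1, of 0] by simp
    qed auto
    also have "\<dots> \<le> 9 * (C * cmod z ^ Suc (miiso_order M))"
      using L(2) by simp
    finally show ?thesis
      by (simp add: L(1))
  qed
  moreover have "\<rho>' > 0"
    using C by (simp add: \<rho>'_def)
  ultimately show ?thesis
    using C(1) by (intro exI[of _ "9 * C"] exI[of _ \<rho>']) auto
qed

text \<open>Each division by \<open>z\<close> lowers the order by one and shifts the series, with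
  the same constant. The estimate is pointwise and sees only the value of \<open>R\<close> at
  \<open>z\<close>, so \<open>R\<close> may depend on the state through the cutoff.\<close>

lemma mod_phi_expansion:
  assumes R: "cmod (R z - exp z) \<le> C * cmod z ^ q" and z: "cmod z \<le> 1" and "j < q"
  shows "cmod (mod_phi R j z - (\<Sum>i<q - j. z ^ i / fact (i + j))) \<le> (C + 3) * cmod z ^ (q - j)"
  using \<open>j < q\<close>
proof (induction j)
  case 0
  then obtain n where q: "q = Suc n"
    by (cases q) auto
  have "cmod (R z - (\<Sum>i<q. z ^ i / fact i)) \<le> C * cmod z ^ q + 3 * cmod z ^ q"
    using norm_triangle_mono[OF R exp_taylor_small[OF z, of n]] by (simp add: q del: sum.lessThan_Suc)
  then show ?case
    by (simp add: distrib_right)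
next
  case (Suc j)
  define k where "k = q - Suc j"
  have k: "q - j = Suc k" "k > 0"
    using Suc.prems by (auto simp: k_def)
  show ?case
  proof (cases "z = 0")
    case True
    obtain n where n: "k = Suc n"
      using k by (cases k) auto
    \<comment> \<open>At 0 the prescribed value \<open>1 / fact (Suc j)\<close> is the constant term
      of the shifted series, with \<open>0 ^ 0 = 1\<close>.\<close>
    have "(\<Sum>i<Suc n. 0 ^ i / fact (i + Suc j)) = (1 / fact (Suc j) :: complex)"
      by (simp add: sum.lessThan_Suc_shift del: sum.lessThan_Suc fact_Suc)
    then show ?thesis
      using True by (simp add: k_def[symmetric] n del: sum.lessThan_Suc fact_Suc)
  next
    case False
    have "mod_phi R j z - (\<Sum>i<q - j. z ^ i / fact (i + j))
        = z * (mod_phi R (Suc j) z - (\<Sum>i<k. z ^ i / fact (i + Suc j)))"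
      using False by (simp add: k sum.lessThan_Suc_shift right_diff_distrib sum_distrib_left
          del: sum.lessThan_Suc fact_Suc) (simp add: field_simps)
    then have "cmod z * cmod (mod_phi R (Suc j) z - (\<Sum>i<k. z ^ i / fact (i + Suc j))) \<le> cmod z * ((C + 3) * cmod z ^ k)"
      using Suc by (simp add: k norm_mult[symmetric] mult_ac del: mod_phi.simps sum.lessThan_Suc fact_Suc)
    then show ?thesis
      using False by (simp add: k_def[symmetric] del: mod_phi.simps sum.lessThan_Suc fact_Suc)
  qed
qed

section \<open>Uniform orders of magnitude\<close>

definition unif_O :: "'w set \<Rightarrow> nat \<Rightarrow> (real \<Rightarrow> 'w \<Rightarrow> 'b::real_normed_vector) \<Rightarrow> bool" where
  "unif_O W k u \<longleftrightarrow> (\<exists>C\<ge>0. \<exists>h0>0. \<forall>h x. 0 < h \<longrightarrow> h \<le> h0 \<longrightarrow> x \<in> W \<longrightarrow> norm (u h x) \<le> C * h ^ k)"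

lemma unif_OI:
  assumes "0 < h0" "\<And>h x. 0 < h \<Longrightarrow> h \<le> h0 \<Longrightarrow> x \<in> W \<Longrightarrow> norm (u h x) \<le> C * h ^ k"
  shows "unif_O W k u"
proof -
  have "norm (u h x) \<le> \<bar>C\<bar> * h ^ k" if "0 < h" "h \<le> h0" "x \<in> W" for h x
  proof -
    have "C * h ^ k \<le> \<bar>C\<bar> * h ^ k"
      using that(1) by (intro mult_right_mono) auto
    then show ?thesis
      using assms(2)[OF that] by simp
  qed
  then show ?thesis
    unfolding unif_O_def using assms(1) by (intro exI[of _ "\<bar>C\<bar>"]) auto
qed

lemma unif_OE:
  assumes "unif_O W k u"
  obtains C h0 where "0 \<le> C" "0 < h0" "h0 \<le> 1"
    "\<And>h x. 0 < h \<Longrightarrow> h \<le> h0 \<Longrightarrow> x \<in> W \<Longrightarrow> norm (u h x) \<le> C * h ^ k"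
proof -
  obtain C h0 where "0 \<le> C" "0 < h0" "\<And>h x. 0 < h \<Longrightarrow> h \<le> h0 \<Longrightarrow> x \<in> W \<Longrightarrow> norm (u h x) \<le> C * h ^ k"
    using assms unfolding unif_O_def by auto
  then show thesis
    by (intro that[of C "min h0 1"]) auto
qed

lemma unif_O_cong:
  assumes "unif_O W k u" "0 < h1" "\<And>h x. 0 < h \<Longrightarrow> h \<le> h1 \<Longrightarrow> x \<in> W \<Longrightarrow> v h x = u h x"
  shows "unif_O W k v"
  using assms(1)
proof (rule unif_OE)
  fix C h0 :: real
  assume "0 < h0" "\<And>h x. 0 < h \<Longrightarrow> h \<le> h0 \<Longrightarrow> x \<in> W \<Longrightarrow> norm (u h x) \<le> C * h ^ k"
  then show ?thesis
    using assms(2,3) by (intro unif_OI[of "min h0 h1" W v C]) auto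
qed

lemma unif_O_mono:
  assumes "unif_O W k u" "j \<le> k" shows "unif_O W j u"
  using assms(1)
proof (rule unif_OE)
  fix C h0 :: real
  assume *: "0 \<le> C" "0 < h0" "h0 \<le> 1" "\<And>h x. 0 < h \<Longrightarrow> h \<le> h0 \<Longrightarrow> x \<in> W \<Longrightarrow> norm (u h x) \<le> C * h ^ k"
  have "norm (u h x) \<le> C * h ^ j" if "0 < h" "h \<le> h0" "x \<in> W" for h x
  proof -
    have "C * h ^ k \<le> C * h ^ j"
      using * that assms(2) by (intro mult_left_mono power_decreasing) auto
    then show ?thesis
      using *(4)[OF that] by simp
  qed
  then show ?thesis
    using *(2) by (rule unif_OI[rotated])
qed

lemma unif_O_add:
  assumes "unif_O W k u" "unif_O W k v"
  shows "unif_O W k (\<lambda>h x. u h x + v h x)"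
proof -
  obtain C h0 where C: "0 < h0" "\<And>h x. 0 < h \<Longrightarrow> h \<le> h0 \<Longrightarrow> x \<in> W \<Longrightarrow> norm (u h x) \<le> C * h ^ k"
    using assms(1) by (rule unif_OE) blast
  obtain D h1 where D: "0 < h1" "\<And>h x. 0 < h \<Longrightarrow> h \<le> h1 \<Longrightarrow> x \<in> W \<Longrightarrow> norm (v h x) \<le> D * h ^ k"
    using assms(2) by (rule unif_OE) blast
  have "norm (u h x + v h x) \<le> (C + D) * h ^ k" if "0 < h" "h \<le> min h0 h1" "x \<in> W" for h x
    using norm_triangle_mono[OF C(2) D(2), of h x h x] that by (simp add: distrib_right)
  then show ?thesis
    using C(1) D(1) by (intro unif_OI[of "min h0 h1"]) auto
qed

lemma unif_O_scaleR:
  assumes "unif_O W k u"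
  shows "unif_O W (l + k) (\<lambda>h x. (c * h ^ l) *\<^sub>R u h x)"
  using assms
proof (rule unif_OE)
  fix C h0 :: real
  assume *: "0 < h0" "\<And>h x. 0 < h \<Longrightarrow> h \<le> h0 \<Longrightarrow> x \<in> W \<Longrightarrow> norm (u h x) \<le> C * h ^ k"
  have "norm ((c * h ^ l) *\<^sub>R u h x) \<le> (\<bar>c\<bar> * C) * h ^ (l + k)" if "0 < h" "h \<le> h0" "x \<in> W" for h x
    using mult_left_mono[OF *(2)[OF that], of "\<bar>c\<bar> * h ^ l"] that(1)
    by (simp add: abs_mult power_add mult_ac)
  then show ?thesis
    using *(1) by (rule unif_OI[rotated])
qed

lemma unif_O_const_scaleR: "unif_O W k u \<Longrightarrow> unif_O W k (\<lambda>h x. c *\<^sub>R u h x)"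
  using unif_O_scaleR[of W k u 0 c] by simp

lemma unif_O_diff:
  assumes "unif_O W k u" "unif_O W k v"
  shows "unif_O W k (\<lambda>h x. u h x - v h x)"
  using unif_O_add[OF assms(1) unif_O_const_scaleR[OF assms(2), of "-1"]] by simp

lemma unif_O_linear:
  assumes "unif_O W k u" "\<And>x w. x \<in> W \<Longrightarrow> norm (A x w) \<le> B * norm w" "0 \<le> B"
  shows "unif_O W k (\<lambda>h x. A x (u h x))"
  using assms(1)
proof (rule unif_OE)
  fix C h0 :: real
  assume *: "0 < h0" "\<And>h x. 0 < h \<Longrightarrow> h \<le> h0 \<Longrightarrow> x \<in> W \<Longrightarrow> norm (u h x) \<le> C * h ^ k"
  have "norm (A x (u h x)) \<le> (B * C) * h ^ k" if "0 < h" "h \<le> h0" "x \<in> W" for h x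
    using assms(2)[OF that(3), of "u h x"] mult_left_mono[OF *(2)[OF that] assms(3)] by simp
  then show ?thesis
    using *(1) by (rule unif_OI[rotated])
qed

lemma unif_O_bounded:
  assumes "\<And>x. x \<in> W \<Longrightarrow> norm (u x) \<le> B"
  shows "unif_O W 0 (\<lambda>h. u)"
  using assms by (intro unif_OI[of 1 _ _ B]) auto

section \<open>Local errors of the integrators\<close>

lemma norm_snd_component_le: "norm (snd v) \<le> norm v"
  using norm_snd_le[of "snd v" "fst v"] by simp

text \<open>The autonomous form of the equation on pairs of time and state, so that time derivatives
  become part of the Lie derivatives.\<close>

definition aug :: "(real \<times> (real^'n) \<Rightarrow> real^'n) \<Rightarrow> real \<times> (real^'n) \<Rightarrow> real \<times> (real^'n)" where
  "aug f z = (1, f z)"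

text \<open>Two nested sets: balls of radius \<rho> about states in \<open>W\<close> stay in
  \<open>S\<close>, which leaves room for stages. Height 3 of the tower matches order 4, whose
  Taylor polynomial uses \<open>g 0\<close> to \<open>g 3\<close>. The Lipschitz bound on
  \<open>Df\<close> is stated on such balls because \<open>S\<close> need not be convex.\<close>

locale smooth_ode =
  fixes f :: "real \<times> (real^'n) \<Rightarrow> real^'n" and S W :: "(real \<times> (real^'n)) set"
    and g :: "nat \<Rightarrow> real \<times> (real^'n) \<Rightarrow> real \<times> (real^'n)" and Df :: "real \<times> (real^'n) \<Rightarrow> real \<times> (real^'n) \<Rightarrow> real^'n"
    and \<rho> B :: real and A :: "real \<times> (real^'n) \<Rightarrow> real^'n^'n" and ft :: "real \<times> (real^'n) \<Rightarrow> real^'n"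
  assumes S: "open S" and \<rho>: "0 < \<rho>" and W: "\<And>x. x \<in> W \<Longrightarrow> cball x \<rho> \<subseteq> S" and B: "0 < B"
    and g0: "g 0 = aug f" and tower: "lie_tower S (g 0) B 3 g"
    and Df: "\<And>z. z \<in> S \<Longrightarrow> (f has_derivative Df z) (at z)" "\<And>z v. z \<in> S \<Longrightarrow> norm (Df z v) \<le> B * norm v"
    and Df_lip: "\<And>x z v. x \<in> W \<Longrightarrow> z \<in> cball x \<rho> \<Longrightarrow> norm (Df z v - Df x v) \<le> B * norm (z - x) * norm v"
    and A: "\<And>z w. z \<in> S \<Longrightarrow> A z *v w = Df z (0, w)" and ft: "\<And>z. z \<in> S \<Longrightarrow> ft z = Df z (1, 0)"
begin

definition F :: "nat \<Rightarrow> real \<times> (real^'n) \<Rightarrow> real^'n" where "F j z = snd (g j z)"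

text \<open>The Taylor coefficients of \<open>f\<close> minus its linearization in the state, with
  the Jacobian frozen at the base point; the zeroth one is the time derivative, which the schemes
  subtract.\<close>

definition G :: "nat \<Rightarrow> real \<times> (real^'n) \<Rightarrow> real^'n" where "G j z = F (Suc j) z - A z *v F j z"

lemma W_S: "x \<in> W \<Longrightarrow> x \<in> S"
  using W[of x] \<rho> centre_in_cball[of x \<rho>] by (meson less_imp_le subsetD)

lemma F_0: "F 0 z = f z"
  by (simp add: F_def g0 aug_def)

text \<open>The time component of the field is constant, so its Lie derivatives vanish; hence the
  Taylor curve advances time by exactly \<open>s\<close>.\<close>

lemma fst_g: "j \<le> 3 \<Longrightarrow> z \<in> S \<Longrightarrow> fst (g j z) = (if j = 0 then 1 else 0)"
proof (induction j arbitrary: z)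
  case 0
  then show ?case by (simp add: g0 aug_def)
next
  case (Suc j)
  obtain D where D: "(g j has_derivative D) (at z)" "D (g 0 z) = g (Suc j) z"
    using tower Suc.prems unfolding lie_tower_def by (metis Suc_leD)
  have "((\<lambda>z. fst (g j z)) has_derivative (\<lambda>v. fst (D v))) (at z)"
    by (intro derivative_intros D)
  moreover have "((\<lambda>z. fst (g j z)) has_derivative (\<lambda>v. 0)) (at z)"
    by (rule has_derivative_transform_within_open[OF has_derivative_const S \<open>z \<in> S\<close>, of "if j = 0 then 1 else 0"])
      (use Suc in auto)
  ultimately have "(\<lambda>v. fst (D v)) = (\<lambda>v. 0)"
    by (rule has_derivative_unique)
  then show ?case
    using D(2) by (metis nat.simps(3))
qed

lemma F_1: "z \<in> S \<Longrightarrow> F 1 z = ft z + A z *v f z"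
proof -
  assume z: "z \<in> S"
  obtain D where D: "(g 0 has_derivative D) (at z)" "D (g 0 z) = g 1 z"
    using tower z unfolding lie_tower_def by (metis One_nat_def zero_le)
  have "((\<lambda>z. snd (g 0 z)) has_derivative (\<lambda>v. snd (D v))) (at z)"
    by (intro derivative_intros D)
  then have "(f has_derivative (\<lambda>v. snd (D v))) (at z)"
    by (simp add: g0 aug_def)
  then have eq: "(\<lambda>v. snd (D v)) = Df z"
    by (rule has_derivative_unique[OF _ Df(1)[OF z]])
  have "F 1 z = Df z (1, f z)"
    using D(2) fun_cong[OF eq, of "g 0 z"] unfolding F_def by (simp add: g0 aug_def)
  also have "(1::real, f z) = (1, 0) + (0, f z)"
    by simp
  also have "Df z \<dots> = ft z + A z *v f z"
    using linear_add[OF has_derivative_linear[OF Df(1)[OF z]]] by (simp only: A[OF z] ft[OF z])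
  finally show ?thesis .
qed

lemma G_0: "z \<in> S \<Longrightarrow> G 0 z = ft z"
  using F_1[of z] by (simp add: G_def F_0)

lemma norm_A: "z \<in> S \<Longrightarrow> norm (A z *v w) \<le> B * norm w"
  using Df(2)[of z "(0, w)"] A[of z w] by (simp add: norm_Pair)

lemma norm_F: "z \<in> S \<Longrightarrow> j \<le> 3 \<Longrightarrow> norm (F j z) \<le> B"
  unfolding F_def by (rule order_trans[OF norm_snd_component_le lie_towerD(2)[OF tower]])

lemma unif_O_F: "j \<le> 3 \<Longrightarrow> unif_O W 0 (\<lambda>h. F j)"
  using norm_F W_S by (intro unif_O_bounded[of _ _ B]) auto

lemma unif_O_A: "unif_O W k u \<Longrightarrow> unif_O W k (\<lambda>h x. A x *v u h x)"
  using norm_A W_S B by (intro unif_O_linear[where A = "\<lambda>x w. A x *v w" and B = B]) auto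

lemma unif_O_G: "j \<le> 2 \<Longrightarrow> unif_O W 0 (\<lambda>h. G j)"
  unfolding G_def by (intro unif_O_diff unif_O_F unif_O_A) auto

lemma taylor_curve_eq:
  assumes "x \<in> S" "1 \<le> k" "k \<le> 4"
  shows "taylor_curve k g s x = (fst x + s, snd x + taylor_prim k (\<lambda>l. F l x) s)"
proof (rule prod_eqI)
  obtain k' where k: "k = Suc k'"
    using assms by (cases k) auto
  have "fst (taylor_prim k (\<lambda>l. g l x) s) = (\<Sum>l<k. (s ^ Suc l / fact (Suc l)) * (if l = 0 then 1 else 0))"
    using assms by (auto simp: taylor_prim_def fst_sum fst_g intro!: sum.cong simp del: fact_Suc)
  also have "\<dots> = s"
    unfolding k by (simp add: sum.lessThan_Suc_shift del: sum.lessThan_Suc)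
  finally show "fst (taylor_curve k g s x) = fst (fst x + s, snd x + taylor_prim k (\<lambda>l. F l x) s)"
    by (simp add: taylor_curve_def)
qed (simp add: taylor_curve_def taylor_prim_def snd_sum F_def)

text \<open>A perturbation \<open>e = O(h\<^sup>k)\<close> of the stage contributes \<open>J e\<close> up to \<open>O(h\<^sup>k\<^sup>+\<^sup>1)\<close> to the
  value of \<open>f\<close>, which the subtracted linearization cancels.\<close>

lemma stage_defect:
  assumes k: "1 \<le> k" "k \<le> 3" and c: "0 < c" "c \<le> 1"
    and Y: "unif_O W k (\<lambda>h x. Y h x - (snd x + taylor_prim k (\<lambda>l. F l x) (c * h)))"
  shows "unif_O W (Suc k) (\<lambda>h x. f (fst x + c * h, Y h x) - f x - A x *v (Y h x - snd x) - (c * h) *\<^sub>R ft x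
    - (taylor_prim k (\<lambda>l. G l x) (c * h) - (c * h) *\<^sub>R ft x))"
proof -
  define e where "e h x = Y h x - (snd x + taylor_prim k (\<lambda>l. F l x) (c * h))" for h x
  obtain E h0 where E: "0 \<le> E" "0 < h0" "h0 \<le> 1"
      "\<And>h x. 0 < h \<Longrightarrow> h \<le> h0 \<Longrightarrow> x \<in> W \<Longrightarrow> norm (e h x) \<le> E * h ^ k"
    using Y unfolding e_def by (rule unif_OE) blast
  obtain C where C: "\<And>x s. \<lbrakk>cball x \<rho> \<subseteq> S; 0 \<le> s; s \<le> 1; s * (real k * B) \<le> \<rho>\<rbrakk> \<Longrightarrow>
      norm (g 0 (taylor_curve k g s x) - taylor_sum (Suc k) (\<lambda>l. g l x) s) \<le> C * s ^ Suc k" "0 \<le> C"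
    using field_along_taylor_curve[OF tower B k(2), of \<rho>] by meson
  \<comment> \<open>Both the point on the Taylor curve and the perturbed stage lie within
    \<open>h * M\<close> of the base point: \<open>real k * B\<close> accounts for the curve,
    \<open>E\<close> for the perturbation.\<close>
  define M where "M = real k * B + E"
  have M: "0 < M"
    using k B E by (simp add: M_def add_pos_nonneg)
  define h1 where "h1 = min h0 (\<rho> / M)"
  have h1: "0 < h1"
    using E \<rho> M by (simp add: h1_def)
  have main: "norm (f (fst x + c * h, Y h x) - f x - A x *v (Y h x - snd x) - (c * h) *\<^sub>R ft x
    - (taylor_prim k (\<lambda>l. G l x) (c * h) - (c * h) *\<^sub>R ft x)) \<le> (B * M * E + C) * h ^ Suc k"
    if h: "0 < h" "h \<le> h1" and x: "x \<in> W" for h x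
  proof -
    define s where "s = c * h"
    define z1 where "z1 = taylor_curve k g s x"
    define z2 where "z2 = z1 + (0, e h x)"
    have s: "0 \<le> s" "s \<le> h" "h \<le> 1"
      using c h E mult_left_le_one_le[of h c] by (auto simp: s_def h1_def)
    have hM: "h * M \<le> \<rho>"
      using h M by (simp add: h1_def pos_le_divide_eq)
    note xS = W_S[OF x]
    have z1: "z1 = (fst x + s, snd x + taylor_prim k (\<lambda>l. F l x) s)"
      unfolding z1_def using xS k by (intro taylor_curve_eq) auto
    then have z2: "z2 = (fst x + s, Y h x)"
      by (simp add: z2_def e_def s_def)
    have "norm (z1 - x) \<le> s * (real k * B)"
      using norm_taylor_prim_le[of k "\<lambda>l. g l x" B s] lie_towerD(2)[OF tower xS] s k
      by (simp add: z1_def taylor_curve_def)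
    also have "\<dots> \<le> h * (real k * B)"
      using s B by (intro mult_right_mono) auto
    finally have n1: "norm (z1 - x) \<le> h * (real k * B)" .
    have eh: "norm (e h x) \<le> E * h ^ k"
      using E(4)[of h x] h x by (simp add: h1_def)
    also have "\<dots> \<le> E * h ^ 1"
      using E(1) h(1) s(3) k by (intro mult_left_mono power_decreasing) auto
    finally have n2: "norm (e h x) \<le> h * E"
      by (simp add: mult.commute)
    have seg: "norm (z1 + t *\<^sub>R (z2 - z1) - x) \<le> h * M" if "t \<in> {0..1}" for t
    proof -
      have "norm (t *\<^sub>R (z2 - z1)) \<le> h * E"
        using that n2 mult_left_le_one_le[of "norm (e h x)" t] by (auto simp: z2_def norm_Pair abs_mult)
      then have "norm ((z1 - x) + t *\<^sub>R (z2 - z1)) \<le> h * (real k * B) + h * E"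
        by (rule norm_triangle_mono[OF n1])
      then show ?thesis
        by (simp add: M_def algebra_simps)
    qed
    have "norm (f z2 - f z1 - Df x (z2 - z1)) \<le> norm (z2 - z1) * (B * (h * M))"
    proof (rule differentiable_bound_linearization[where S = "cball x (h * M)" and f' = Df])
      fix z assume z: "z \<in> cball x (h * M)"
      then have zS: "z \<in> S" "z \<in> cball x \<rho>"
        using W[OF x] hM by auto
      show "(f has_derivative Df z) (at z within cball x (h * M))"
        using Df(1)[OF zS(1)] has_derivative_at_withinI by blast
      show "onorm (Df z - Df x) \<le> B * (h * M)"
      proof (rule onorm_bound)
        fix v :: "real \<times> (real^'n)"
        have "B * norm (z - x) * norm v \<le> B * (h * M) * norm v"
          using z B by (intro mult_right_mono mult_left_mono) (auto simp: dist_norm norm_minus_commute)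
        then show "norm ((Df z - Df x) v) \<le> B * (h * M) * norm v"
          using Df_lip[OF x zS(2), of v] by simp
      qed (use B M h in auto)
    qed (use seg h M in \<open>auto simp: dist_norm norm_minus_commute\<close>)
    also have "z2 - z1 = (0, e h x)"
      by (simp add: z2_def)
    also have "Df x (0, e h x) = A x *v e h x"
      by (simp add: A[OF xS])
    also have "norm ((0::real), e h x) * (B * (h * M)) \<le> (E * h ^ k) * (B * (h * M))"
      using eh B h M by (intro mult_right_mono) (auto simp: norm_Pair)
    finally have r1: "norm (f z2 - f z1 - A x *v e h x) \<le> B * M * E * h ^ Suc k"
      by (simp add: mult_ac)
    have "s * (real k * B) \<le> h * M"
      using s h B E by (simp add: M_def mult_mono)
    then have "norm (g 0 z1 - taylor_sum (Suc k) (\<lambda>l. g l x) s) \<le> C * s ^ Suc k"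
      unfolding z1_def using s hM by (intro C W x) auto
    also have "\<dots> \<le> C * h ^ Suc k"
      using s C(2) by (intro mult_left_mono power_mono) auto
    finally have d: "norm (g 0 z1 - taylor_sum (Suc k) (\<lambda>l. g l x) s) \<le> C * h ^ Suc k" .
    have sd: "snd (g 0 z1 - taylor_sum (Suc k) (\<lambda>l. g l x) s) = f z1 - taylor_sum (Suc k) (\<lambda>l. F l x) s"
      by (simp add: g0 aug_def taylor_sum_def F_def snd_sum del: sum.lessThan_Suc)
    have r2: "norm (f z1 - taylor_sum (Suc k) (\<lambda>l. F l x) s) \<le> C * h ^ Suc k"
      using order_trans[OF norm_snd_component_le d] unfolding sd .
    have "A x *v taylor_prim k (\<lambda>l. F l x) s = taylor_prim k (\<lambda>l. A x *v F l x) s"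
      unfolding taylor_prim_def by (simp only: linear_sum[OF matrix_vector_mul_linear] matrix_vector_mult_scaleR)
    moreover have "Y h x - snd x = e h x + taylor_prim k (\<lambda>l. F l x) s"
      by (simp add: e_def s_def)
    ultimately have "A x *v (Y h x - snd x) = A x *v e h x + taylor_prim k (\<lambda>l. A x *v F l x) s"
      by (simp only: matrix_vector_right_distrib)
    moreover have "taylor_sum (Suc k) (\<lambda>l. F l x) s = f x + taylor_prim k (\<lambda>l. F (Suc l) x) s"
      by (simp add: taylor_sum_shift F_0)
    moreover have "taylor_prim k (\<lambda>l. G l x) s = taylor_prim k (\<lambda>l. F (Suc l) x) s - taylor_prim k (\<lambda>l. A x *v F l x) s"
      by (simp add: taylor_prim_def G_def scaleR_diff_right sum_subtractf del: fact_Suc power_Suc)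
    ultimately have "f (fst x + c * h, Y h x) - f x - A x *v (Y h x - snd x) - (c * h) *\<^sub>R ft x
        - (taylor_prim k (\<lambda>l. G l x) (c * h) - (c * h) *\<^sub>R ft x)
      = (f z2 - f z1 - A x *v e h x) + (f z1 - taylor_sum (Suc k) (\<lambda>l. F l x) s)"
      by (simp add: z2 s_def)
    then show ?thesis
      using norm_triangle_mono[OF r1 r2] by (simp add: distrib_right)
  qed
  show ?thesis
    by (rule unif_OI[OF h1 main])
qed

end

section \<open>Partial derivatives and order conditions of the three schemes\<close>

context smooth_ode
begin

lemma f_y_eq:
  assumes "z \<in> S" shows "f_y f (fst z) (snd z) = A z"
proof -
  have "((\<lambda>w. f (fst z, w)) has_derivative (\<lambda>w. Df z (0, w))) (at (snd z))"
    by (rule has_derivative_compose[where f = "\<lambda>w. (fst z, w)" and g = f])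
      (auto intro!: derivative_eq_intros Df(1)[OF assms, simplified])
  then have "frechet_derivative (\<lambda>w. f (fst z, w)) (at (snd z)) = (\<lambda>w. A z *v w)"
    using frechet_derivative_at A[OF assms] by metis
  then show ?thesis
    by (simp add: f_y_def jacobian_def)
qed

lemma f_t_eq:
  assumes "z \<in> S" shows "f_t f (fst z) (snd z) = ft z"
proof -
  have "((\<lambda>t. f (t, snd z)) has_derivative (\<lambda>t. Df z (t, 0))) (at (fst z))"
    by (rule has_derivative_compose[where f = "\<lambda>t. (t, snd z)" and g = f])
      (auto intro!: derivative_eq_intros Df(1)[OF assms, simplified])
  moreover have "Df z (t, 0) = t *\<^sub>R ft z" for t
    using linear_scale[OF has_derivative_linear[OF Df(1)[OF assms]], of t "(1, 0)"] by (simp add: ft[OF assms])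
  ultimately show ?thesis
    by (simp add: f_t_def has_vector_derivative_def vector_derivative_at)
qed

end

text \<open>Abstracts from the amplification map: the order conditions see only linearity and
  agreement with truncated phi-series. \<open>q\<close> will be one more than the order of the
  method. \<Phi> carries \<open>h\<close> and \<open>x\<close> because the cutoff does, and the
  factor 1/2 occurs in the first inner stage of the fourth order scheme.\<close>

locale miiso_actions = smooth_ode f S W g Df \<rho> B A ft
  for f :: "real \<times> (real^'n) \<Rightarrow> real^'n" and S W g Df \<rho> B A ft +
  fixes \<Phi> :: "real \<Rightarrow> real \<times> (real^'n) \<Rightarrow> nat \<Rightarrow> real^'n^'n \<Rightarrow> real^'n \<Rightarrow> real^'n" and q :: nat
  assumes linear_\<Phi>: "\<And>h x j N. linear (\<Phi> h x j N)"
    and \<Phi>: "\<And>c j. c \<in> {1/2, 1} \<Longrightarrow> j < q \<Longrightarrow> \<exists>C. \<exists>h0>0. \<forall>h x v. 0 < h \<longrightarrow> h \<le> h0 \<longrightarrow> x \<in> W \<longrightarrow>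
      norm (\<Phi> h x j ((c * h) *\<^sub>R A x) v - (\<Sum>i<q - j. ((c * h) ^ i / fact (i + j)) *\<^sub>R ((*v) (A x) ^^ i) v))
        \<le> C * h ^ (q - j) * norm v"
begin

text \<open>A vector of size O(h^k) improves the accuracy of the action by \<open>k\<close> orders,
  which compensates for the low accuracy of the functions with large index.\<close>

lemma unif_O_action:
  assumes v: "unif_O W k v" and c: "c \<in> {1/2, 1}" and j: "j < q"
  shows "unif_O W (q - j + k) (\<lambda>h x. \<Phi> h x j ((c * h) *\<^sub>R A x) (v h x)
     - (\<Sum>i<q - j. ((c * h) ^ i / fact (i + j)) *\<^sub>R ((*v) (A x) ^^ i) (v h x)))"
proof -
  obtain D h1 where D: "0 < h1" "\<And>h x. 0 < h \<Longrightarrow> h \<le> h1 \<Longrightarrow> x \<in> W \<Longrightarrow> norm (v h x) \<le> D * h ^ k"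
    using v by (rule unif_OE) blast
  obtain C h0 where C: "0 < h0" "\<And>h x v. 0 < h \<Longrightarrow> h \<le> h0 \<Longrightarrow> x \<in> W \<Longrightarrow>
      norm (\<Phi> h x j ((c * h) *\<^sub>R A x) v - (\<Sum>i<q - j. ((c * h) ^ i / fact (i + j)) *\<^sub>R ((*v) (A x) ^^ i) v))
        \<le> C * h ^ (q - j) * norm v"
    using \<Phi>[OF c j] by blast
  show ?thesis
  proof (rule unif_OI[of "min h0 h1"])
    fix h x assume h: "0 < h" "h \<le> min h0 h1" and x: "x \<in> W"
    let ?u = "\<Phi> h x j ((c * h) *\<^sub>R A x) (v h x) - (\<Sum>i<q - j. ((c * h) ^ i / fact (i + j)) *\<^sub>R ((*v) (A x) ^^ i) (v h x))"
    have "norm ?u \<le> C * h ^ (q - j) * norm (v h x)"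
      using C(2)[of h x "v h x"] h x by simp
    also have "\<dots> \<le> \<bar>C\<bar> * h ^ (q - j) * norm (v h x)"
      using h by (intro mult_right_mono) auto
    also have "\<dots> \<le> \<bar>C\<bar> * h ^ (q - j) * (D * h ^ k)"
      using D(2)[of h x] h x by (intro mult_left_mono) auto
    finally show "norm ?u \<le> (\<bar>C\<bar> * D) * h ^ (q - j + k)"
      by (simp add: power_add mult_ac)
  qed (use C(1) D(1) in auto)
qed

lemma unif_O_f: "unif_O W 0 (\<lambda>h. f)"
  using unif_O_F[of 0] by (simp add: F_0[abs_def])

lemma unif_O_ft: "unif_O W 0 (\<lambda>h. ft)"
  by (rule unif_O_cong[OF unif_O_G[of 0], of 1]) (use G_0 W_S in auto)

lemmas step_algebra = vec_eq_iff field_simps power2_eq_square power3_eq_cube power4_eq_xxxx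

text \<open>With \<open>q = 3\<close> the first function is accurate to O(h^2). Its series gives the
  part of \<open>F 1\<close> that comes from the Jacobian, and the explicit time term of the scheme
  supplies the rest.\<close>

lemma miiso2_local_error:
  assumes "q = 3"
  shows "unif_O W 3 (\<lambda>h x. miiso2_step (\<Phi> h x) f h (fst x) (snd x) - (snd x + taylor_prim 2 (\<lambda>l. F l x) h))"
proof -
  define e where "e h x = \<Phi> h x 1 ((1 * h) *\<^sub>R A x) (f x)
     - (\<Sum>i<q - 1. ((1 * h) ^ i / fact (i + 1)) *\<^sub>R ((*v) (A x) ^^ i) (f x))" for h x
  have e: "unif_O W 2 e"
    using unif_O_action[OF unif_O_f, of 1 1] assms unfolding e_def by simp
  have \<Phi>1: "\<Phi> h x 1 (h *\<^sub>R A x) (f x) = e h x + f x + (h / 2) *\<^sub>R (A x *v f x)" for h x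
    by (simp add: e_def assms eval_nat_numeral)
  show ?thesis
  proof (rule unif_O_cong[of _ _ "\<lambda>h x. h *\<^sub>R e h x" 1])
    show "unif_O W 3 (\<lambda>h x. h *\<^sub>R e h x)"
      using unif_O_scaleR[OF e, of 1 1] by (simp add: eval_nat_numeral)
    fix h x assume "x \<in> W"
    then have x: "x \<in> S"
      by (rule W_S)
    show "miiso2_step (\<Phi> h x) f h (fst x) (snd x) - (snd x + taylor_prim 2 (\<lambda>l. F l x) h) = h *\<^sub>R e h x"
      unfolding miiso2_step_def f_y_eq[OF x] f_t_eq[OF x] \<Phi>1 prod.collapse
      by (simp add: taylor_prim_def eval_nat_numeral F_0 F_1[OF x, unfolded One_nat_def]) (simp add: step_algebra)
  qed simp
qed

text \<open>Since \<open>F 2\<close> is \<open>A\<close> applied to \<open>F 1\<close> plus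
  \<open>G 1\<close>, the linear terms give all of the Taylor polynomial but the part from
  \<open>G 1\<close>. The defect is h^2/2 times \<open>G 1\<close> up to O(h^3), and the third
  function is 1/6 at 0, so the weight \<open>2 * h\<close> produces the missing h^3/6.\<close>

lemma miiso3_local_error:
  assumes q: "q = 4"
  shows "unif_O W 4 (\<lambda>h x. miiso3_step (\<Phi> h x) f h (fst x) (snd x) - (snd x + taylor_prim 3 (\<lambda>l. F l x) h))"
proof -
  define e1 where "e1 h x = \<Phi> h x 1 ((1 * h) *\<^sub>R A x) (f x)
     - (\<Sum>i<q - 1. ((1 * h) ^ i / fact (i + 1)) *\<^sub>R ((*v) (A x) ^^ i) (f x))" for h x
  define e2 where "e2 h x = \<Phi> h x 2 ((1 * h) *\<^sub>R A x) (ft x)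
     - (\<Sum>i<q - 2. ((1 * h) ^ i / fact (i + 2)) *\<^sub>R ((*v) (A x) ^^ i) (ft x))" for h x
  have e1: "unif_O W 3 e1" and e2: "unif_O W 2 e2"
    using unif_O_action[OF unif_O_f, of 1 1] unif_O_action[OF unif_O_ft, of 1 2] q unfolding e1_def e2_def by simp_all
  have \<Phi>1: "\<Phi> h x 1 (h *\<^sub>R A x) (f x) = e1 h x + f x + (h / 2) *\<^sub>R (A x *v f x) + (h\<^sup>2 / 6) *\<^sub>R (A x *v (A x *v f x))" for h x
    by (simp add: e1_def q eval_nat_numeral)
  have \<Phi>2: "\<Phi> h x 2 (h *\<^sub>R A x) (ft x) = e2 h x + (1 / 2) *\<^sub>R ft x + (h / 6) *\<^sub>R (A x *v ft x)" for h x
    by (simp add: e2_def q eval_nat_numeral)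
  define Y where "Y h x = snd x + h *\<^sub>R \<Phi> h x 1 (h *\<^sub>R A x) (f x) + h\<^sup>2 *\<^sub>R \<Phi> h x 2 (h *\<^sub>R A x) (ft x)" for h x
  define D where "D h x = f (fst x + h, Y h x) - f x - A x *v (Y h x - snd x) - h *\<^sub>R ft x" for h x
  define d where "d h x = D h x - (h\<^sup>2 / 2) *\<^sub>R G 1 x" for h x
  have AF1: "A x *v F 1 x = A x *v ft x + A x *v (A x *v f x)" if "x \<in> S" for x
    unfolding F_1[OF that] by (rule matrix_vector_right_distrib)
  \<comment> \<open>Accuracy 2 of the stage determines the defect up to O(h^3); for that purpose the
    h^3 term of the stage may count as error.\<close>
  have Y: "unif_O W 2 (\<lambda>h x. Y h x - (snd x + taylor_prim 2 (\<lambda>l. F l x) (1 * h)))"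
  proof (rule unif_O_cong[of _ _ "\<lambda>h x. h *\<^sub>R e1 h x + h\<^sup>2 *\<^sub>R e2 h x + ((1/6) * h ^ 3) *\<^sub>R (A x *v F 1 x)" 1])
    show "unif_O W 2 (\<lambda>h x. h *\<^sub>R e1 h x + h\<^sup>2 *\<^sub>R e2 h x + ((1/6) * h ^ 3) *\<^sub>R (A x *v F 1 x))"
      using unif_O_scaleR[OF e1, of 1 1] unif_O_scaleR[OF e2, of 2 1] unif_O_scaleR[OF unif_O_A[OF unif_O_F[of 1]], of 3 "1/6"]
      by (intro unif_O_add) (auto elim: unif_O_mono)
    fix h x assume "x \<in> W"
    then have x: "x \<in> S"
      by (rule W_S)
    show "Y h x - (snd x + taylor_prim 2 (\<lambda>l. F l x) (1 * h)) = h *\<^sub>R e1 h x + h\<^sup>2 *\<^sub>R e2 h x + ((1/6) * h ^ 3) *\<^sub>R (A x *v F 1 x)"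
      unfolding Y_def \<Phi>1 \<Phi>2 AF1[OF x]
      by (simp add: taylor_prim_def eval_nat_numeral F_0 F_1[OF x, unfolded One_nat_def]) (simp add: step_algebra)
  qed simp
  have d: "unif_O W 3 d"
  proof (rule unif_O_cong[of _ _ _ 1])
    show "unif_O W 3 (\<lambda>h x. f (fst x + 1 * h, Y h x) - f x - A x *v (Y h x - snd x) - (1 * h) *\<^sub>R ft x
        - (taylor_prim 2 (\<lambda>l. G l x) (1 * h) - (1 * h) *\<^sub>R ft x))"
      using stage_defect[OF _ _ _ _ Y] by (simp add: eval_nat_numeral)
    fix h x assume "x \<in> W"
    then have x: "x \<in> S"
      by (rule W_S)
    show "d h x = f (fst x + 1 * h, Y h x) - f x - A x *v (Y h x - snd x) - (1 * h) *\<^sub>R ft x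
        - (taylor_prim 2 (\<lambda>l. G l x) (1 * h) - (1 * h) *\<^sub>R ft x)"
      by (simp add: d_def D_def taylor_prim_def eval_nat_numeral G_0[OF x])
  qed simp
  have D: "unif_O W 2 D"
  proof (rule unif_O_cong[of _ _ "\<lambda>h x. d h x + ((1/2) * h ^ 2) *\<^sub>R G 1 x" 1])
    show "unif_O W 2 (\<lambda>h x. d h x + ((1/2) * h ^ 2) *\<^sub>R G 1 x)"
      using unif_O_scaleR[OF unif_O_G[of 1], of 2 "1/2"] d by (intro unif_O_add) (auto elim: unif_O_mono)
  qed (simp_all add: d_def)
  define e3 where "e3 h x = \<Phi> h x 3 ((1 * h) *\<^sub>R A x) (D h x)
     - (\<Sum>i<q - 3. ((1 * h) ^ i / fact (i + 3)) *\<^sub>R ((*v) (A x) ^^ i) (D h x))" for h x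
  \<comment> \<open>Accuracy \<open>q - 3 = 1\<close> of the function plus order 2 of the
    defect.\<close>
  have e3: "unif_O W 3 e3"
    using unif_O_action[OF D, of 1 3] q unfolding e3_def by (simp add: numeral_3_eq_3)
  have \<Phi>3: "\<Phi> h x 3 (h *\<^sub>R A x) (D h x) = e3 h x + (1/6) *\<^sub>R (d h x + (h\<^sup>2 / 2) *\<^sub>R G 1 x)" for h x
    by (simp add: e3_def d_def q eval_nat_numeral)
  show ?thesis
  proof (rule unif_O_cong[of _ _ "\<lambda>h x. h *\<^sub>R e1 h x + h\<^sup>2 *\<^sub>R e2 h x + (2 * h) *\<^sub>R e3 h x + ((1/3) * h) *\<^sub>R d h x" 1])
    show "unif_O W 4 (\<lambda>h x. h *\<^sub>R e1 h x + h\<^sup>2 *\<^sub>R e2 h x + (2 * h) *\<^sub>R e3 h x + ((1/3) * h) *\<^sub>R d h x)"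
      using unif_O_scaleR[OF e1, of 1 1] unif_O_scaleR[OF e2, of 2 1] unif_O_scaleR[OF e3, of 1 2]
        unif_O_scaleR[OF d, of 1 "1/3"] by (intro unif_O_add) simp_all
    fix h x assume "x \<in> W"
    then have x: "x \<in> S"
      by (rule W_S)
    have "miiso3_step (\<Phi> h x) f h (fst x) (snd x) = Y h x + (2 * h) *\<^sub>R \<Phi> h x 3 (h *\<^sub>R A x) (D h x)"
      unfolding miiso3_step_def f_y_eq[OF x] f_t_eq[OF x] Let_def D_def Y_def prod.collapse ..
    also have "\<dots> - (snd x + taylor_prim 3 (\<lambda>l. F l x) h) = h *\<^sub>R e1 h x + h\<^sup>2 *\<^sub>R e2 h x + (2 * h) *\<^sub>R e3 h x + ((1/3) * h) *\<^sub>R d h x"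
      unfolding Y_def \<Phi>1 \<Phi>2 \<Phi>3 G_def AF1[OF x]
      by (simp add: taylor_prim_def eval_nat_numeral F_0 F_1[OF x, unfolded One_nat_def]) (simp add: step_algebra)
    finally show "miiso3_step (\<Phi> h x) f h (fst x) (snd x) - (snd x + taylor_prim 3 (\<lambda>l. F l x) h)
        = h *\<^sub>R e1 h x + h\<^sup>2 *\<^sub>R e2 h x + (2 * h) *\<^sub>R e3 h x + ((1/3) * h) *\<^sub>R d h x" .
  qed simp
qed

text \<open>At 0 the two weights are 16/6 - 48/24 = 2/3 and -2/6 + 12/24 = 1/6. With the nodes 1/2
  and 1 they satisfy 2/3 * 1/4 + 1/6 = 1/3 and 2/3 * 1/8 + 1/6 = 1/4, so the defects contribute
  \<open>G 1\<close> and \<open>G 2\<close> with coefficients h^3/6 and h^4/24. The linear term of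
  the third function adds h^4/24 times \<open>A\<close> applied to \<open>G 1\<close>, and together
  with the stage this makes up \<open>F 3\<close>.\<close>

lemma miiso4_local_error:
  assumes q: "q = 5"
  shows "unif_O W 5 (\<lambda>h x. miiso4_step (\<Phi> h x) f h (fst x) (snd x) - (snd x + taylor_prim 4 (\<lambda>l. F l x) h))"
proof -
  define e1 where "e1 c h x = \<Phi> h x 1 ((c * h) *\<^sub>R A x) (f x)
     - (\<Sum>i<q - 1. ((c * h) ^ i / fact (i + 1)) *\<^sub>R ((*v) (A x) ^^ i) (f x))" for c h x
  define e2 where "e2 c h x = \<Phi> h x 2 ((c * h) *\<^sub>R A x) (ft x)
     - (\<Sum>i<q - 2. ((c * h) ^ i / fact (i + 2)) *\<^sub>R ((*v) (A x) ^^ i) (ft x))" for c h x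
  have e1: "unif_O W 4 (e1 c)" and e2: "unif_O W 3 (e2 c)" if "c \<in> {1/2, 1}" for c
    using unif_O_action[OF unif_O_f that, of 1] unif_O_action[OF unif_O_ft that, of 2] q
    unfolding e1_def e2_def by simp_all
  have \<Phi>1: "\<Phi> h x 1 ((c * h) *\<^sub>R A x) (f x) = e1 c h x + f x + (c * h / 2) *\<^sub>R (A x *v f x)
      + ((c * h)\<^sup>2 / 6) *\<^sub>R (A x *v (A x *v f x)) + ((c * h) ^ 3 / 24) *\<^sub>R (A x *v (A x *v (A x *v f x)))" for c h x
    by (simp add: e1_def q eval_nat_numeral)
  have \<Phi>2: "\<Phi> h x 2 ((c * h) *\<^sub>R A x) (ft x) = e2 c h x + (1 / 2) *\<^sub>R ft x + (c * h / 6) *\<^sub>R (A x *v ft x)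
      + ((c * h)\<^sup>2 / 24) *\<^sub>R (A x *v (A x *v ft x))" for c h x
    by (simp add: e2_def q eval_nat_numeral)
  define Y where "Y c h x = snd x + (c * h) *\<^sub>R \<Phi> h x 1 ((c * h) *\<^sub>R A x) (f x)
      + (c * h)\<^sup>2 *\<^sub>R \<Phi> h x 2 ((c * h) *\<^sub>R A x) (ft x)" for c h x
  define D where "D c h x = f (fst x + c * h, Y c h x) - f x - A x *v (Y c h x - snd x) - (c * h) *\<^sub>R ft x" for c h x
  define d where "d c h x = D c h x - (((c * h)\<^sup>2 / 2) *\<^sub>R G 1 x + ((c * h) ^ 3 / 6) *\<^sub>R G 2 x)" for c h x
  have AF1: "A x *v F 1 x = A x *v ft x + A x *v (A x *v f x)" if "x \<in> S" for x
    unfolding F_1[OF that] by (rule matrix_vector_right_distrib)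
  have Y_eq: "Y c h x = snd x + ((c * h) *\<^sub>R e1 c h x + (c * h)\<^sup>2 *\<^sub>R e2 c h x) + (c * h) *\<^sub>R F 0 x
      + ((c * h)\<^sup>2 / 2) *\<^sub>R F 1 x + ((c * h) ^ 3 / 6) *\<^sub>R (A x *v F 1 x) + ((c * h) ^ 4 / 24) *\<^sub>R (A x *v (A x *v F 1 x))"
    if "x \<in> S" for c h x
    unfolding Y_def \<Phi>1 \<Phi>2 AF1[OF that] matrix_vector_right_distrib unfolding F_1[OF that] F_0
    by (simp add: step_algebra)
  \<comment> \<open>Accuracy 3 at both nodes determines the defects up to O(h^4), which includes
    their cubic terms.\<close>
  have Y: "unif_O W 3 (\<lambda>h x. Y c h x - (snd x + taylor_prim 3 (\<lambda>l. F l x) (c * h)))" if c: "c \<in> {1/2, 1}" for c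
  proof (rule unif_O_cong[of _ _ "\<lambda>h x. (c * h ^ 1) *\<^sub>R e1 c h x + (c\<^sup>2 * h\<^sup>2) *\<^sub>R e2 c h x
      + ((c ^ 3 / 6) * h ^ 3) *\<^sub>R (A x *v F 1 x - F 2 x) + ((c ^ 4 / 24) * h ^ 4) *\<^sub>R (A x *v (A x *v F 1 x))" 1])
    have "unif_O W 3 (\<lambda>h x. (c * h ^ 1) *\<^sub>R e1 c h x)"
      by (rule unif_O_mono[OF unif_O_scaleR[OF e1[OF c]]]) simp
    moreover have "unif_O W 3 (\<lambda>h x. (c\<^sup>2 * h\<^sup>2) *\<^sub>R e2 c h x)"
      by (rule unif_O_mono[OF unif_O_scaleR[OF e2[OF c]]]) simp
    moreover have "unif_O W 3 (\<lambda>h x. ((c ^ 3 / 6) * h ^ 3) *\<^sub>R (A x *v F 1 x - F 2 x))"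
      by (rule unif_O_mono[OF unif_O_scaleR[OF unif_O_diff[OF unif_O_A[OF unif_O_F] unif_O_F]]]) simp_all
    moreover have "unif_O W 3 (\<lambda>h x. ((c ^ 4 / 24) * h ^ 4) *\<^sub>R (A x *v (A x *v F 1 x)))"
      by (rule unif_O_mono[OF unif_O_scaleR[OF unif_O_A[OF unif_O_A[OF unif_O_F]]]]) simp_all
    ultimately show "unif_O W 3 (\<lambda>h x. (c * h ^ 1) *\<^sub>R e1 c h x + (c\<^sup>2 * h\<^sup>2) *\<^sub>R e2 c h x
      + ((c ^ 3 / 6) * h ^ 3) *\<^sub>R (A x *v F 1 x - F 2 x) + ((c ^ 4 / 24) * h ^ 4) *\<^sub>R (A x *v (A x *v F 1 x)))"
      by (intro unif_O_add)
    fix h x assume "x \<in> W"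
    then have x: "x \<in> S"
      by (rule W_S)
    show "Y c h x - (snd x + taylor_prim 3 (\<lambda>l. F l x) (c * h)) = (c * h ^ 1) *\<^sub>R e1 c h x + (c\<^sup>2 * h\<^sup>2) *\<^sub>R e2 c h x
      + ((c ^ 3 / 6) * h ^ 3) *\<^sub>R (A x *v F 1 x - F 2 x) + ((c ^ 4 / 24) * h ^ 4) *\<^sub>R (A x *v (A x *v F 1 x))"
      unfolding Y_eq[OF x] by (simp add: taylor_prim_def eval_nat_numeral) (simp add: step_algebra)
  qed simp
  have d: "unif_O W 4 (d c)" if c: "c \<in> {1/2, 1}" for c
  proof (rule unif_O_cong[of _ _ _ 1])
    show "unif_O W 4 (\<lambda>h x. f (fst x + c * h, Y c h x) - f x - A x *v (Y c h x - snd x) - (c * h) *\<^sub>R ft x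
        - (taylor_prim 3 (\<lambda>l. G l x) (c * h) - (c * h) *\<^sub>R ft x))"
      using stage_defect[OF _ _ _ _ Y[OF c]] c by (auto simp: eval_nat_numeral)
    fix h x assume "x \<in> W"
    then have x: "x \<in> S"
      by (rule W_S)
    show "d c h x = f (fst x + c * h, Y c h x) - f x - A x *v (Y c h x - snd x) - (c * h) *\<^sub>R ft x
        - (taylor_prim 3 (\<lambda>l. G l x) (c * h) - (c * h) *\<^sub>R ft x)"
      by (simp add: d_def D_def taylor_prim_def eval_nat_numeral G_0[OF x])
  qed simp
  have D_eq: "D c h x = d c h x + ((c * h)\<^sup>2 / 2) *\<^sub>R G 1 x + ((c * h) ^ 3 / 6) *\<^sub>R G 2 x" for c h x
    by (simp add: d_def)
  have D: "unif_O W 2 (D c)" if c: "c \<in> {1/2, 1}" for c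
  proof (rule unif_O_cong[of _ _ "\<lambda>h x. d c h x + ((c\<^sup>2 / 2) * h\<^sup>2) *\<^sub>R G 1 x + ((c ^ 3 / 6) * h ^ 3) *\<^sub>R G 2 x" 1])
    have "unif_O W 2 (\<lambda>h x. ((c\<^sup>2 / 2) * h\<^sup>2) *\<^sub>R G 1 x)"
      by (rule unif_O_mono[OF unif_O_scaleR[OF unif_O_G]]) simp_all
    moreover have "unif_O W 2 (\<lambda>h x. ((c ^ 3 / 6) * h ^ 3) *\<^sub>R G 2 x)"
      by (rule unif_O_mono[OF unif_O_scaleR[OF unif_O_G]]) simp_all
    moreover have "unif_O W 2 (d c)"
      by (rule unif_O_mono[OF d[OF c]]) simp
    ultimately show "unif_O W 2 (\<lambda>h x. d c h x + ((c\<^sup>2 / 2) * h\<^sup>2) *\<^sub>R G 1 x + ((c ^ 3 / 6) * h ^ 3) *\<^sub>R G 2 x)"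
      by (intro unif_O_add)
  qed (simp_all add: D_eq power_mult_distrib)
  define e3 where "e3 c h x = \<Phi> h x 3 ((1 * h) *\<^sub>R A x) (D c h x)
     - (\<Sum>i<q - 3. ((1 * h) ^ i / fact (i + 3)) *\<^sub>R ((*v) (A x) ^^ i) (D c h x))" for c h x
  have e3: "unif_O W 4 (e3 c)" if c: "c \<in> {1/2, 1}" for c
    using unif_O_action[OF D[OF c], of 1 3] q unfolding e3_def by simp
  have \<Phi>3: "\<Phi> h x 3 (h *\<^sub>R A x) (D c h x) = e3 c h x + (1/6) *\<^sub>R D c h x + (h / 24) *\<^sub>R (A x *v D c h x)" for c h x
    by (simp add: e3_def q eval_nat_numeral)
  text \<open>This combination is \<open>O(h\<^sup>3)\<close> although its two terms are only \<open>O(h\<^sup>2)\<close>, which makes up for the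
    low accuracy of the fourth function.\<close>
  define u where "u h x = 12 *\<^sub>R D 1 h x - 48 *\<^sub>R D (1/2) h x" for h x
  \<comment> \<open>The squares cancel because 12 = 48/4, and 12/6 - 48/48 = 1 is the coefficient of
    the cube.\<close>
  have u_eq: "u h x = (1 * h ^ 3) *\<^sub>R G 2 x + 12 *\<^sub>R d 1 h x - 48 *\<^sub>R d (1/2) h x" for h x
    unfolding u_def D_eq by (simp add: step_algebra)
  have "unif_O W 3 (\<lambda>h x. (1 * h ^ 3) *\<^sub>R G 2 x)"
    using unif_O_scaleR[OF unif_O_G[of 2], of 3 1] by simp
  moreover have "unif_O W 3 (\<lambda>h x. 12 *\<^sub>R d 1 h x)" "unif_O W 3 (\<lambda>h x. 48 *\<^sub>R d (1/2) h x)"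
    using d[of 1, THEN unif_O_mono, of 3] d[of "1/2", THEN unif_O_mono, of 3]
    by (intro unif_O_const_scaleR; simp)+
  ultimately have u: "unif_O W 3 u"
    unfolding u_eq[abs_def] by (intro unif_O_add unif_O_diff)
  define e4 where "e4 h x = \<Phi> h x 4 ((1 * h) *\<^sub>R A x) (u h x)
     - (\<Sum>i<q - 4. ((1 * h) ^ i / fact (i + 4)) *\<^sub>R ((*v) (A x) ^^ i) (u h x))" for h x
  have e4: "unif_O W 4 e4"
    using unif_O_action[OF u, of 1 4] q unfolding e4_def by (simp add: eval_nat_numeral)
  have \<Phi>4: "\<Phi> h x 4 (h *\<^sub>R A x) (u h x) = e4 h x + (1/24) *\<^sub>R u h x" for h x
    by (simp add: e4_def q eval_nat_numeral)
  \<comment> \<open>The factors 2/3 and 1/6 are the weights at 0; the last summand comes from the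
    linear term h/24 of the third function.\<close>
  let ?err = "\<lambda>h x. (1 * h ^ 1) *\<^sub>R (e1 1 h x + 16 *\<^sub>R e3 (1/2) h x - 2 *\<^sub>R e3 1 h x + e4 h x
      + (2/3) *\<^sub>R d (1/2) h x + (1/6) *\<^sub>R d 1 h x) + (1 * h\<^sup>2) *\<^sub>R e2 1 h x
      + ((1/24) * h\<^sup>2) *\<^sub>R (16 *\<^sub>R (A x *v d (1/2) h x) - 2 *\<^sub>R (A x *v d 1 h x))"
  show ?thesis
  proof (rule unif_O_cong[of _ _ ?err 1])
    have "unif_O W 4 (\<lambda>h x. e1 1 h x + 16 *\<^sub>R e3 (1/2) h x - 2 *\<^sub>R e3 1 h x + e4 h x
      + (2/3) *\<^sub>R d (1/2) h x + (1/6) *\<^sub>R d 1 h x)"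
      using e1[of 1] e3 e4 d by (intro unif_O_add unif_O_diff unif_O_const_scaleR) auto
    from unif_O_scaleR[OF this, of 1 1]
    have "unif_O W 5 (\<lambda>h x. (1 * h ^ 1) *\<^sub>R (e1 1 h x + 16 *\<^sub>R e3 (1/2) h x - 2 *\<^sub>R e3 1 h x + e4 h x
      + (2/3) *\<^sub>R d (1/2) h x + (1/6) *\<^sub>R d 1 h x))"
      by simp
    moreover have "unif_O W 5 (\<lambda>h x. (1 * h\<^sup>2) *\<^sub>R e2 1 h x)"
      using unif_O_scaleR[OF e2[of 1], of 2 1] by simp
    moreover have "unif_O W 4 (\<lambda>h x. 16 *\<^sub>R (A x *v d (1/2) h x) - 2 *\<^sub>R (A x *v d 1 h x))"
      using d by (intro unif_O_diff unif_O_const_scaleR unif_O_A) auto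
    then have "unif_O W 5 (\<lambda>h x. ((1/24) * h\<^sup>2) *\<^sub>R (16 *\<^sub>R (A x *v d (1/2) h x) - 2 *\<^sub>R (A x *v d 1 h x)))"
      by (rule unif_O_mono[OF unif_O_scaleR]) simp
    ultimately show "unif_O W 5 ?err"
      by (intro unif_O_add)
    fix h :: real and x assume "x \<in> W"
    then have x: "x \<in> S"
      by (rule W_S)
    have half: "h / 2 = (1/2) * h" "h\<^sup>2 / 4 = ((1/2) * h)\<^sup>2"
      by (simp_all add: power2_eq_square)
    have Y3: "snd x + h *\<^sub>R \<Phi> h x 1 (h *\<^sub>R A x) (f x) + h\<^sup>2 *\<^sub>R \<Phi> h x 2 (h *\<^sub>R A x) (ft x) = Y 1 h x"
      by (simp add: Y_def)
    have D3: "f (fst x + h, Y 1 h x) - f x - A x *v (Y 1 h x - snd x) - h *\<^sub>R ft x = D 1 h x"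
      by (simp add: D_def)
    have "miiso4_step (\<Phi> h x) f h (fst x) (snd x) = Y 1 h x + h *\<^sub>R ((16 *\<^sub>R \<Phi> h x 3 (h *\<^sub>R A x) (D (1/2) h x)
        - 48 *\<^sub>R \<Phi> h x 4 (h *\<^sub>R A x) (D (1/2) h x))
        + (- 2 *\<^sub>R \<Phi> h x 3 (h *\<^sub>R A x) (D 1 h x) + 12 *\<^sub>R \<Phi> h x 4 (h *\<^sub>R A x) (D 1 h x)))"
      unfolding miiso4_step_def f_y_eq[OF x] f_t_eq[OF x] Let_def prod.collapse Y3 D3
      unfolding half Y_def[symmetric] D_def[symmetric] ..
    \<comment> \<open>Linearity merges the two actions of the fourth function into one on
      \<open>u\<close>. Estimated separately, each would have an error O(h^3), one order
      short.\<close>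
    also have "\<dots> = Y 1 h x + h *\<^sub>R (16 *\<^sub>R \<Phi> h x 3 (h *\<^sub>R A x) (D (1/2) h x)
        - 2 *\<^sub>R \<Phi> h x 3 (h *\<^sub>R A x) (D 1 h x) + \<Phi> h x 4 (h *\<^sub>R A x) (u h x))"
      by (simp add: u_def linear_diff[OF linear_\<Phi>] linear_scale[OF linear_\<Phi>])
    finally have step: "miiso4_step (\<Phi> h x) f h (fst x) (snd x) = Y 1 h x + h *\<^sub>R (16 *\<^sub>R \<Phi> h x 3 (h *\<^sub>R A x) (D (1/2) h x)
        - 2 *\<^sub>R \<Phi> h x 3 (h *\<^sub>R A x) (D 1 h x) + \<Phi> h x 4 (h *\<^sub>R A x) (u h x))" .
    show "miiso4_step (\<Phi> h x) f h (fst x) (snd x) - (snd x + taylor_prim 4 (\<lambda>l. F l x) h) = ?err h x"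
    proof -
      have AG: "A x *v D c h x = A x *v d c h x + ((c * h)\<^sup>2 / 2) *\<^sub>R (A x *v F 2 x - A x *v (A x *v F 1 x))
          + ((c * h) ^ 3 / 6) *\<^sub>R (A x *v G 2 x)" for c
        unfolding D_eq matrix_vector_right_distrib matrix_vector_mult_scaleR
        by (simp add: G_def matrix_vector_mult_diff_distrib numeral_2_eq_2)
      have G12: "G 1 x = F 2 x - A x *v F 1 x" "G 2 x = F 3 x - A x *v F 2 x"
        by (simp_all add: G_def eval_nat_numeral)
      have T: "taylor_prim 4 (\<lambda>l. F l x) h = h *\<^sub>R F 0 x + (h\<^sup>2 / 2) *\<^sub>R F 1 x + (h ^ 3 / 6) *\<^sub>R F 2 x + (h ^ 4 / 24) *\<^sub>R F 3 x"
        by (simp add: taylor_prim_def eval_nat_numeral)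
      show ?thesis
        unfolding step \<Phi>3 \<Phi>4 unfolding AG Y_eq[OF x] T u_eq unfolding D_eq unfolding G12 by (simp add: step_algebra)
    qed
  qed simp
qed

end

section \<open>Convergence\<close>

text \<open>Discrete Gronwall. The recursion is available only while the error is at most
  \<epsilon>, so the induction carries along the bound \<open>K * h ^ p\<close>, which
  \<open>h0\<close> keeps below \<epsilon>. The other bound is the geometric sum of the local
  errors.\<close>

lemma iterates_convergence:
  fixes y :: "real \<Rightarrow> 'v::real_normed_vector" and Step :: "real \<Rightarrow> real \<Rightarrow> 'v \<Rightarrow> 'v"
  assumes "0 < \<epsilon>" "0 < h1" and L: "0 < L" and C: "0 \<le> C" and p: "1 \<le> p" and y: "y t0 = y0"
    and step: "\<And>h t w. \<lbrakk>0 < h; h \<le> h1; t0 \<le> t; t + h \<le> T; norm (w - y t) \<le> \<epsilon>\<rbrakk> \<Longrightarrow>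
      norm (Step h t w - y (t + h)) \<le> (1 + L * h) * norm (w - y t) + C * h ^ Suc p"
  shows "\<exists>K h0. 0 < h0 \<and> (\<forall>h n. 0 < h \<longrightarrow> h \<le> h0 \<longrightarrow> t0 + real n * h \<le> T \<longrightarrow>
      norm (iterates (Step h) h t0 y0 n - y (t0 + real n * h)) \<le> K * h ^ p)"
proof -
  define K where "K = C / L * exp (L * (T - t0))"
  define h0 where "h0 = min h1 (min 1 (\<epsilon> / (K + 1)))"
  have K: "0 \<le> K"
    using C L by (simp add: K_def)
  have h0: "0 < h0"
    using assms K by (simp add: h0_def add_nonneg_pos)
  have main: "norm (iterates (Step h) h t0 y0 n - y (t0 + real n * h)) \<le> C / L * h ^ p * ((1 + L * h) ^ n - 1) \<and>
      C / L * h ^ p * ((1 + L * h) ^ n - 1) \<le> K * h ^ p"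
    if h: "0 < h" "h \<le> h0" and n: "t0 + real n * h \<le> T" for h n
    using n
  proof (induction n)
    case 0
    then show ?case
      using y K C L h by simp
  next
    case (Suc n)
    have n: "t0 + real n * h \<le> T"
      using Suc.prems h by (simp add: algebra_simps)
    let ?e = "norm (iterates (Step h) h t0 y0 n - y (t0 + real n * h))"
    have e: "?e \<le> C / L * h ^ p * ((1 + L * h) ^ n - 1)" "C / L * h ^ p * ((1 + L * h) ^ n - 1) \<le> K * h ^ p"
      using Suc.IH[OF n] by auto
    have "h ^ p \<le> h ^ 1"
      using h p by (intro power_decreasing) (auto simp: h0_def)
    then have "K * h ^ p \<le> K * (\<epsilon> / (K + 1))"
      using h K by (intro mult_left_mono) (auto simp: h0_def)
    also have "\<dots> \<le> \<epsilon>"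
      using K \<open>0 < \<epsilon>\<close> by (simp add: field_simps)
    finally have "?e \<le> \<epsilon>"
      using e by linarith
    then have "norm (Step h (t0 + real n * h) (iterates (Step h) h t0 y0 n) - y (t0 + real n * h + h))
        \<le> (1 + L * h) * ?e + C * h ^ Suc p"
      using Suc.prems h by (intro step) (auto simp: h0_def algebra_simps)
    also have "\<dots> \<le> (1 + L * h) * (C / L * h ^ p * ((1 + L * h) ^ n - 1)) + C * h ^ Suc p"
      by (intro add_mono mult_left_mono[OF e(1)] order_refl) (use L h in auto)
    also have "\<dots> = C / L * h ^ p * ((1 + L * h) ^ Suc n - 1)"
      using L by (simp add: field_simps)
    finally have 1: "norm (iterates (Step h) h t0 y0 (Suc n) - y (t0 + real (Suc n) * h))
        \<le> C / L * h ^ p * ((1 + L * h) ^ Suc n - 1)"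
      by (simp add: algebra_simps)
    have "(1 + L * h) ^ Suc n \<le> exp (L * h) ^ Suc n"
      using L h by (intro power_mono exp_ge_add_one_self) auto
    also have "\<dots> = exp (L * (real (Suc n) * h))"
      by (simp add: exp_of_nat_mult[symmetric] mult_ac del: power_Suc of_nat_Suc)
    also have "\<dots> \<le> exp (L * (T - t0))"
      using Suc.prems L by simp
    finally have "C / L * h ^ p * ((1 + L * h) ^ Suc n - 1) \<le> C / L * h ^ p * exp (L * (T - t0))"
      using C L h by (intro mult_left_mono) auto
    then show ?case
      using 1 by (simp add: K_def mult_ac)
  qed
  show ?thesis
    using h0 main order_trans by blast
qed

section \<open>Uniform bounds in a tube around the trajectory\<close>

lemma lie_tower_mono:
  assumes tower: "lie_tower S V B m g" and "B \<le> B'"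
  shows "lie_tower S V B' m g"
  unfolding lie_tower_def
proof (intro ballI conjI allI impI)
  fix x assume x: "x \<in> S"
  show "norm (V x) \<le> B'"
    using lie_towerD(1)[OF tower x] assms(2) by simp
  fix j assume j: "j \<le> m"
  show "norm (g j x) \<le> B'"
    using lie_towerD(2)[OF tower x j] assms(2) by simp
  obtain D where D: "(g j has_derivative D) (at x)" "\<And>v. norm (D v) \<le> B * norm v" "D (V x) = g (Suc j) x"
    using tower x j unfolding lie_tower_def by blast
  have "norm (D v) \<le> B' * norm v" for v
    by (rule order_trans[OF D(2) mult_right_mono[OF assms(2) norm_ge_zero]])
  then show "\<exists>D. (g j has_derivative D) (at x) \<and> (\<forall>v. norm (D v) \<le> B' * norm v) \<and> D (V x) = g (Suc j) x"
    using D by blast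
qed

lemma smooth_bdd_aug:
  fixes f :: "real \<times> (real^'n) \<Rightarrow> real^'n"
  assumes "open S" "smooth_bdd k S f"
  shows "smooth_bdd k S (aug f)"
proof -
  have "bounded_linear (\<lambda>w::real^'n. (0::real, w))"
    by (rule bounded_linear_Pair[OF bounded_linear_zero bounded_linear_ident])
  then have "smooth_bdd k S (\<lambda>z. (1::real, 0) + (0, f z))"
    by (intro smooth_bdd_add smooth_bdd_const smooth_bdd_linear[of S "\<lambda>w. (0, w)"] assms)
  then show ?thesis
    by (simp add: aug_def[abs_def])
qed

text \<open>The mean value inequality is applied to the derivative in each basis direction, and the
  basis expansion assembles the results. Convexity of \<open>A\<close> supplies the
  segments.\<close>

lemma frechet_derivative_lipschitz:
  fixes F :: "'a::euclidean_space \<Rightarrow> 'b::euclidean_space"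
  assumes F: "smooth_bdd (Suc (Suc k)) S F"
  shows "\<exists>L. \<forall>A x z v. convex A \<longrightarrow> A \<subseteq> S \<longrightarrow> x \<in> A \<longrightarrow> z \<in> A \<longrightarrow>
    norm (frechet_derivative F (at z) v - frechet_derivative F (at x) v) \<le> L * norm (z - x) * norm v"
proof -
  have F': "smooth_bdd (Suc k) S (\<lambda>x. frechet_derivative F (at x) e)" for e
    using F by (simp only: smooth_bdd_Suc[of "Suc k"])
  obtain L where L: "\<And>e x v. x \<in> S \<Longrightarrow>
      norm (frechet_derivative (\<lambda>x. frechet_derivative F (at x) e) (at x) v) \<le> L e * norm v"
    using smooth_bdd_derivative_bound[OF F'] by metis
  have "norm (frechet_derivative F (at z) v - frechet_derivative F (at x) v) \<le> (\<Sum>e\<in>Basis. \<bar>L e\<bar>) * norm (z - x) * norm v"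
    if A: "convex A" "A \<subseteq> S" "x \<in> A" "z \<in> A" for A x z v
  proof -
    let ?D = "\<lambda>x. frechet_derivative F (at x)"
    have lin: "linear (?D w)" if "w \<in> S" for w
      using smooth_bdd_has_derivative[OF F that] by (rule has_derivative_linear)
    have e: "norm (?D z e - ?D x e) \<le> \<bar>L e\<bar> * norm (z - x)" for e
    proof (rule differentiable_bound[OF A(1) _ _ A(4,3)])
      fix w assume "w \<in> A"
      then have w: "w \<in> S"
        using A(2) by blast
      show "((\<lambda>x. ?D x e) has_derivative frechet_derivative (\<lambda>x. ?D x e) (at w)) (at w within A)"
        by (rule has_derivative_at_withinI[OF smooth_bdd_has_derivative[OF F' w]])
      have "L e * norm v \<le> \<bar>L e\<bar> * norm v" for v :: 'a
        by (intro mult_right_mono) auto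
      then show "onorm (frechet_derivative (\<lambda>x. ?D x e) (at w)) \<le> \<bar>L e\<bar>"
        by (intro onorm_bound order_trans[OF L[OF w]]) auto
    qed
    have expand: "?D w v = (\<Sum>e\<in>Basis. (v \<bullet> e) *\<^sub>R ?D w e)" if "w \<in> S" for w
    proof -
      have "?D w v = ?D w (\<Sum>e\<in>Basis. (v \<bullet> e) *\<^sub>R e)"
        by (simp only: euclidean_representation)
      then show ?thesis
        by (simp only: linear_sum[OF lin[OF that]] linear_scale[OF lin[OF that]])
    qed
    have xz: "x \<in> S" "z \<in> S"
      using A by auto
    have "?D z v - ?D x v = (\<Sum>e\<in>Basis. (v \<bullet> e) *\<^sub>R (?D z e - ?D x e))"
      unfolding expand[OF xz(1)] expand[OF xz(2)] by (simp add: sum_subtractf scaleR_diff_right)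
    also have "norm \<dots> \<le> (\<Sum>e\<in>Basis. norm v * (\<bar>L e\<bar> * norm (z - x)))"
      using e Basis_le_norm by (intro sum_norm_le) (auto intro!: mult_mono)
    finally show ?thesis
      by (simp add: sum_distrib_left sum_distrib_right mult_ac)
  qed
  then show ?thesis
    by blast
qed

text \<open>Radii \<epsilon>, \<epsilon>/2 and \<epsilon>/4 nest the sets: \<open>S\<close> is an
  open neighbourhood inside \<open>U\<close>, \<open>W\<close> is the tube in which the iterates
  stay, and balls of radius \<epsilon>/4 about points of \<open>W\<close> remain in
  \<open>S\<close>.\<close>

lemma smooth_ode_near_compact:
  fixes f :: "real \<times> (real^'n) \<Rightarrow> real^'n"
  assumes K0: "compact K0" "K0 \<subseteq> U" and U: "open U" and f: "bounded_derivs 5 U f"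
  shows "\<exists>S W \<epsilon> \<rho> B. 0 < \<epsilon> \<and> S \<subseteq> U \<and> (\<forall>z\<in>K0. cball z \<epsilon> \<subseteq> W) \<and>
    smooth_ode f S W (\<lambda>j. (lie (aug f) ^^ j) (aug f)) (\<lambda>z. frechet_derivative f (at z)) \<rho> B
      (\<lambda>z. matrix (\<lambda>w. frechet_derivative f (at z) (0, w))) (\<lambda>z. frechet_derivative f (at z) (1, 0))"
proof -
  obtain \<epsilon> where \<epsilon>: "0 < \<epsilon>" "(\<Union>x\<in>K0. cball x \<epsilon>) \<subseteq> U"
    using compact_subset_open_imp_cball_epsilon_subset[OF K0(1) U K0(2)] by blast
  define S where "S = (\<Union>x\<in>K0. ball x \<epsilon>)"
  define W where "W = (\<Union>x\<in>K0. cball x (\<epsilon> / 2))"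
  have S: "open S" "S \<subseteq> U"
    using order_trans[OF UN_mono[OF order_refl ball_subset_cball] \<epsilon>(2)] unfolding S_def by auto
  have W: "cball x (\<epsilon> / 4) \<subseteq> S" if "x \<in> W" for x
  proof
    fix w assume w: "w \<in> cball x (\<epsilon> / 4)"
    obtain z where z: "z \<in> K0" "dist z x \<le> \<epsilon> / 2"
      using \<open>x \<in> W\<close> by (auto simp: W_def)
    have "dist z w < \<epsilon>"
      using z(2) w dist_triangle[of z w x] \<epsilon>(1) by simp
    then show "w \<in> S"
      using z(1) by (auto simp: S_def)
  qed
  have diff: "f differentiable (at z)" if "z \<in> U" for z
    using f that by (simp add: numeral_eq_Suc)
  \<comment> \<open>A bound on \<open>f\<close> itself is not contained in
    \<open>bounded_derivs\<close>; it comes from continuity on the compact set of sums of a point of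
    \<open>K0\<close> and a vector of norm at most \<epsilon>.\<close>
  have "bounded (f ` S)"
  proof (rule bounded_subset)
    have "compact ((\<lambda>p. fst p + snd p) ` (K0 \<times> cball 0 \<epsilon>))"
      by (intro compact_continuous_image compact_Times K0 compact_cball continuous_intros)
    moreover have "(\<lambda>p. fst p + snd p) ` (K0 \<times> cball 0 \<epsilon>) \<subseteq> U"
      using \<epsilon>(2) by (force simp: dist_norm)
    then have "continuous_on ((\<lambda>p. fst p + snd p) ` (K0 \<times> cball 0 \<epsilon>)) f"
      by (intro continuous_at_imp_continuous_on ballI differentiable_imp_continuous_within diff) blast
    ultimately show "bounded (f ` (\<lambda>p. fst p + snd p) ` (K0 \<times> cball 0 \<epsilon>))"
      by (rule compact_imp_bounded[OF compact_continuous_image, rotated])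
    have "w \<in> (\<lambda>p. fst p + snd p) ` (K0 \<times> cball 0 \<epsilon>)" if w: "w \<in> S" for w
    proof -
      obtain z where "z \<in> K0" "dist z w < \<epsilon>"
        using w unfolding S_def UN_iff mem_ball by blast
      then show ?thesis
        by (intro image_eqI[of _ _ "(z, w - z)"]) (auto simp: dist_norm norm_minus_commute)
    qed
    then show "f ` S \<subseteq> f ` (\<lambda>p. fst p + snd p) ` (K0 \<times> cball 0 \<epsilon>)"
      by blast
  qed
  then have f5: "smooth_bdd 5 S f"
    using bounded_derivs_mono[OF f order_refl S(2)] by (simp add: smooth_bdd_def)
  then have f4: "smooth_bdd (Suc 3) S f"
    by (rule smooth_bdd_mono) simp
  obtain B1 where B1: "B1 > 0" "lie_tower S (aug f) B1 3 (\<lambda>j. (lie (aug f) ^^ j) (aug f))"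
    using lie_tower_exists[OF S(1) smooth_bdd_aug[OF S(1) f4] smooth_bdd_aug[OF S(1) f4]] by blast
  obtain B2 where B2: "\<And>z v. z \<in> S \<Longrightarrow> norm (frechet_derivative f (at z) v) \<le> B2 * norm v"
    using smooth_bdd_derivative_bound[OF f4] by blast
  obtain B3 where B3: "\<And>A x z v. \<lbrakk>convex A; A \<subseteq> S; x \<in> A; z \<in> A\<rbrakk> \<Longrightarrow>
      norm (frechet_derivative f (at z) v - frechet_derivative f (at x) v) \<le> B3 * norm (z - x) * norm v"
    using frechet_derivative_lipschitz[OF f4[unfolded numeral_3_eq_3]] by blast
  define B where "B = max B1 (max B2 B3)"
  have "smooth_ode f S W (\<lambda>j. (lie (aug f) ^^ j) (aug f)) (\<lambda>z. frechet_derivative f (at z)) (\<epsilon> / 4) B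
      (\<lambda>z. matrix (\<lambda>w. frechet_derivative f (at z) (0, w))) (\<lambda>z. frechet_derivative f (at z) (1, 0))"
  proof
    show "lie_tower S ((lie (aug f) ^^ 0) (aug f)) B 3 (\<lambda>j. (lie (aug f) ^^ j) (aug f))"
      using lie_tower_mono[OF B1(2), of B] by (simp add: B_def)
    show der: "(f has_derivative frechet_derivative f (at z)) (at z)" if "z \<in> S" for z
      using diff that S(2) frechet_derivative_works by blast
    have B': "B2 \<le> B" "B3 \<le> B"
      by (auto simp: B_def)
    show "norm (frechet_derivative f (at z) v) \<le> B * norm v" if "z \<in> S" for z v
      by (rule order_trans[OF B2[OF that] mult_right_mono[OF B'(1)]]) simp
    show "norm (frechet_derivative f (at z) v - frechet_derivative f (at x) v) \<le> B * norm (z - x) * norm v"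
      if "x \<in> W" "z \<in> cball x (\<epsilon> / 4)" for x z v
      by (rule order_trans[OF B3[OF convex_cball W[OF that(1)] _ that(2)]])
        (use \<epsilon>(1) B' in \<open>auto intro!: mult_right_mono\<close>)
    show "matrix (\<lambda>w. frechet_derivative f (at z) (0, w)) *v w = frechet_derivative f (at z) (0, w)"
      if "z \<in> S" for z and w :: "real^'n"
    proof -
      have "linear (\<lambda>w. frechet_derivative f (at z) (0, w))"
        using linear_compose[OF _ has_derivative_linear[OF der[OF that]], of "\<lambda>w. (0, w)"]
        by (simp add: o_def linear_iff)
      then show ?thesis
        by (simp add: matrix_works)
    qed
  qed (use S(1) \<epsilon>(1) W B1(1) in \<open>auto simp: B_def\<close>)
  moreover have "\<forall>z\<in>K0. cball z (\<epsilon> / 2) \<subseteq> W"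
    by (auto simp: W_def)
  moreover have "0 < \<epsilon> / 2"
    using \<epsilon>(1) by simp
  ultimately show ?thesis
    using S(2) by blast
qed

section \<open>Local errors with exact actions, and convergence in the tube\<close>

lemma matrix_scale_funpow:
  fixes A :: "real^'n^'n"
  shows "((*v) (c *\<^sub>R A) ^^ i) v = c ^ i *\<^sub>R ((*v) A ^^ i) v"
  by (induction i) (auto simp: scaleR_matrix_vector_assoc[symmetric] matrix_vector_mult_scaleR)

lemma linear_exact_action: "linear (exact_action \<phi> A)"
  by (rule linearI) (auto simp: exact_action_def vec_eq_iff cvector_def matrix_vector_mult_def
      distrib_left sum.distrib scaleR_sum_right[symmetric] algebra_simps sum_distrib_left)

context smooth_ode
begin

text \<open>For small \<open>h\<close> the eigenvalues of the scaled Jacobian lie in the disc where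
  the amplification map is controlled, and the condition number transfers the scalar estimate to
  matrices. The cutoff \<omega> is an arbitrary function of \<open>h\<close> and the state, which
  covers half of \<open>h J\<close> taken with the cutoff of \<open>h J\<close>.\<close>

lemma miiso_actions_exact:
  assumes r: "r < 1"
    and branches: "\<And>m n. (m, n) \<in> pade_used M \<Longrightarrow> arg_branch (pade m n) (\<alpha> m n)"
    and w3: "M = MIISO3 \<Longrightarrow> wedge_weight 3 \<theta>" and w4: "M = MIISO4 \<Longrightarrow> wedge_weight 4 \<theta>"
    and K: "\<And>x. x \<in> W \<Longrightarrow> \<exists>X d. diagonalizes (cmatrix (A x)) X d \<and>
      onorm ((*v) X) * onorm ((*v) (matrix_inv X)) \<le> K"
  shows "miiso_actions f S W g Df \<rho> B A ft
    (\<lambda>h x j. exact_action (mod_phi (amp_map \<alpha> \<theta> M r s (\<omega> h x)) j)) (Suc (miiso_order M))"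
proof (intro miiso_actions.intro miiso_actions_axioms.intro)
  show "smooth_ode f S W g Df \<rho> B A ft"
    by (rule smooth_ode_axioms)
  show "linear (exact_action (mod_phi (amp_map \<alpha> \<theta> M r s (\<omega> h x)) j) N)" for h x j and N :: "real^'n^'n"
    by (rule linear_exact_action)
next
  fix c :: real and j assume c: "c \<in> {1/2, 1}" and j: "j < Suc (miiso_order M)"
  let ?l = "Suc (miiso_order M) - j"
  obtain C \<rho>' where C: "0 \<le> C" "0 < \<rho>'" "\<And>\<omega>c z. cmod z \<le> \<rho>' \<Longrightarrow>
     cmod (amp_map \<alpha> \<theta> M r s \<omega>c z - exp z) \<le> C * cmod z ^ Suc (miiso_order M)"
    using amp_map_near_0[where \<alpha> = \<alpha>, OF r branches w3 w4] by metis
  \<comment> \<open>Keeps \<open>2 * (h * B)\<close> within the disc: \<open>B\<close> bounds the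
    Jacobian, 2 is the price of complexification, and the cap 1 keeps the scalar expansion
    valid.\<close>
  define h0 where "h0 = min \<rho>' 1 / (2 * B)"
  have h0: "0 < h0"
    using C(2) B by (simp add: h0_def)
  have main: "norm (exact_action (mod_phi (amp_map \<alpha> \<theta> M r s (\<omega> h x)) j) ((c * h) *\<^sub>R A x) v
      - (\<Sum>i<?l. ((c * h) ^ i / fact (i + j)) *\<^sub>R ((*v) (A x) ^^ i) v)) \<le> (K * (C + 3) * (2 * B) ^ ?l) * h ^ ?l * norm v"
    if h: "0 < h" "h \<le> h0" and x: "x \<in> W" for h x v
  proof -
    obtain X d where X: "diagonalizes (cmatrix (A x)) X d" "onorm ((*v) X) * onorm ((*v) (matrix_inv X)) \<le> K"
      using K[OF x] by blast
    have hB: "2 * (h * B) \<le> min \<rho>' 1"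
      using h(2) B by (simp add: h0_def pos_le_divide_eq mult_ac)
    have "norm (exact_action (mod_phi (amp_map \<alpha> \<theta> M r s (\<omega> h x)) j) ((c * h) *\<^sub>R A x) v
        - (\<Sum>i<?l. (1 / fact (i + j)) *\<^sub>R ((*v) ((c * h) *\<^sub>R A x) ^^ i) v)) \<le> K * ((C + 3) * (2 * (h * B)) ^ ?l) * norm v"
    proof (rule exact_action_expansion[OF diagonalizes_scale[OF X(1)] X(2)])
      show "norm (((c * h) *\<^sub>R A x) *v u) \<le> (h * B) * norm u" for u
      proof -
        have "norm (((c * h) *\<^sub>R A x) *v u) = (c * h) * norm (A x *v u)"
          using c h by (auto simp: scaleR_matrix_vector_assoc[symmetric])
        also have "\<dots> \<le> h * (B * norm u)"
          using c h by (intro mult_mono norm_A[OF W_S[OF x]]) auto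
        finally show ?thesis
          by simp
      qed
      show "0 \<le> h * B"
        using h B by simp
      fix z assume z: "cmod z \<le> 2 * (h * B)"
      have "cmod (mod_phi (amp_map \<alpha> \<theta> M r s (\<omega> h x)) j z - (\<Sum>i<?l. z ^ i / fact (i + j))) \<le> (C + 3) * cmod z ^ ?l"
        using z hB by (intro mod_phi_expansion C(3) j) auto
      also have "\<dots> \<le> (C + 3) * (2 * (h * B)) ^ ?l"
        using z C(1) by (intro mult_left_mono power_mono) auto
      finally show "cmod (mod_phi (amp_map \<alpha> \<theta> M r s (\<omega> h x)) j z - (\<Sum>i<?l. of_real (1 / fact (i + j)) * z ^ i))
          \<le> (C + 3) * (2 * (h * B)) ^ ?l"
        by simp
    qed
    then show ?thesis
      unfolding matrix_scale_funpow by (simp add: power_mult_distrib mult_ac)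
  qed
  show "\<exists>C. \<exists>h0>0. \<forall>h x v. 0 < h \<longrightarrow> h \<le> h0 \<longrightarrow> x \<in> W \<longrightarrow>
      norm (exact_action (mod_phi (amp_map \<alpha> \<theta> M r s (\<omega> h x)) j) ((c * h) *\<^sub>R A x) v
        - (\<Sum>i<?l. ((c * h) ^ i / fact (i + j)) *\<^sub>R ((*v) (A x) ^^ i) v)) \<le> C * h ^ ?l * norm v"
    using h0 main by blast
qed

lemma miiso_local_error:
  assumes r: "r < 1"
    and branches: "\<And>m n. (m, n) \<in> pade_used M \<Longrightarrow> arg_branch (pade m n) (\<alpha> m n)"
    and w3: "M = MIISO3 \<Longrightarrow> wedge_weight 3 \<theta>" and w4: "M = MIISO4 \<Longrightarrow> wedge_weight 4 \<theta>"
    and K: "\<And>x. x \<in> W \<Longrightarrow> \<exists>X d. diagonalizes (cmatrix (f_y f (fst x) (snd x))) X d \<and>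
      onorm ((*v) X) * onorm ((*v) (matrix_inv X)) \<le> K"
  shows "unif_O W (Suc (miiso_order M)) (\<lambda>h x. miiso_step \<alpha> \<theta> M r s k exact_action f h (fst x) (snd x)
    - (snd x + taylor_prim (miiso_order M) (\<lambda>l. F l x) h))"
proof -
  let ?\<Phi> = "\<lambda>h x j. exact_action (mod_phi (amp_map \<alpha> \<theta> M r s (eig_modulus k (h *\<^sub>R f_y f (fst x) (snd x)))) j)"
  have A: "A x = f_y f (fst x) (snd x)" if "x \<in> W" for x
    using f_y_eq[OF W_S[OF that]] by simp
  interpret miiso_actions f S W g Df \<rho> B A ft ?\<Phi> "Suc (miiso_order M)"
    by (rule miiso_actions_exact[where K = K]) (use r branches w3 w4 K A in auto)
  show ?thesis
  proof (cases M)
    case MIISO2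
    then show ?thesis
      using miiso2_local_error by (simp add: miiso_step_def numeral_3_eq_3 numeral_2_eq_2)
  next
    case MIISO3
    then show ?thesis
      using miiso3_local_error by (simp add: miiso_step_def)
  next
    case MIISO4
    then show ?thesis
      using miiso4_local_error by (simp add: miiso_step_def)
  qed
qed

text \<open>The error after one step splits into three parts: the step against the Taylor polynomial
  at the numerical state, that polynomial at the numerical against the exact state, and the
  polynomial against the exact solution. Only the middle part involves the accumulated
  error.\<close>

lemma convergence_from_local_error:
  fixes y :: "real \<Rightarrow> real^'n"
  assumes ode: "\<And>t. t \<in> {t0..T} \<Longrightarrow> (y has_vector_derivative f (t, y t)) (at t within {t0..T})"
    and init: "y t0 = y0"
    and \<epsilon>: "0 < \<epsilon>" "\<And>t. t \<in> {t0..T} \<Longrightarrow> cball (t, y t) \<epsilon> \<subseteq> W"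
    and p: "1 \<le> p" "p \<le> 4"
    and err: "unif_O W (Suc p) (\<lambda>h x. Step h (fst x) (snd x) - (snd x + taylor_prim p (\<lambda>l. F l x) h))"
  shows "\<exists>K h0. 0 < h0 \<and> (\<forall>h n. 0 < h \<longrightarrow> h \<le> h0 \<longrightarrow> t0 + real n * h \<le> T \<longrightarrow>
      norm (iterates (Step h) h t0 y0 n - y (t0 + real n * h)) \<le> K * h ^ p)"
proof -
  obtain C h1 where C: "0 \<le> C" "0 < h1" "h1 \<le> 1" "\<And>h x. 0 < h \<Longrightarrow> h \<le> h1 \<Longrightarrow> x \<in> W \<Longrightarrow>
      norm (Step h (fst x) (snd x) - (snd x + taylor_prim p (\<lambda>l. F l x) h)) \<le> C * h ^ Suc p"
    using err by (rule unif_OE) blast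
  define L where "L = real p * B"
  have "0 < L"
    using B p by (simp add: L_def)
  show ?thesis
  proof (rule iterates_convergence[of \<epsilon> h1 L "C + B * B * real p"])
    fix h t w
    assume h: "0 < h" "h \<le> h1" and t: "t0 \<le> t" "t + h \<le> T" and w: "norm (w - y t) \<le> \<epsilon>"
    define x z where "x = (t, w)" and "z = (t, y t)"
    have ball: "cball z \<epsilon> \<subseteq> W"
      using \<epsilon>(2)[of t] t h by (simp add: z_def)
    have xz: "x \<in> cball z \<epsilon>" "z \<in> cball z \<epsilon>"
      using w \<epsilon>(1) by (auto simp: x_def z_def dist_Pair_Pair dist_norm norm_minus_commute)
    have WS: "cball z \<epsilon> \<subseteq> S"
      using ball W_S by blast
    have h1: "h \<le> 1" "0 \<le> h"
      using h C(3) by auto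
    have tc: "snd (taylor_curve p g h x) = w + taylor_prim p (\<lambda>l. F l x) h"
      using taylor_curve_eq[of x p h] xz WS p by (auto simp: x_def)
    have 1: "norm (Step h t w - snd (taylor_curve p g h x)) \<le> C * h ^ Suc p"
      using C(4)[OF h, of x] xz(1) ball unfolding tc by (auto simp: x_def)
    have "norm (x - z) = norm (w - y t)"
      by (simp add: x_def z_def norm_Pair)
    then have "norm (taylor_curve p g h x - taylor_curve p g h z) \<le> (1 + L * h) * norm (w - y t)"
      using taylor_curve_lipschitz[OF tower B _ h1(2,1) convex_cball WS xz, of p] p by (simp add: L_def mult_ac)
    from order_trans[OF norm_snd_component_le this]
    have 2: "norm (snd (taylor_curve p g h x) - snd (taylor_curve p g h z)) \<le> (1 + L * h) * norm (w - y t)"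
      by simp
    \<comment> \<open>The solution with time attached is an integral curve of \<open>aug f\<close>
      that starts at \<open>z\<close>.\<close>
    define c where "c s = (t + s, y (t + s))" for s
    obtain i where i: "p = Suc i" "i \<le> 3"
      using p by (cases p) auto
    have "norm (c h - taylor_curve (Suc i) g h (c 0)) \<le> B * B * real (Suc i) * h ^ Suc (Suc i)"
    proof (rule solution_taylor_curve[OF tower B h1(1) _ _ i(2)])
      fix s assume s: "s \<in> {0..h}"
      then have ts: "t + s \<in> {t0..T}"
        using t by auto
      then show "c s \<in> S"
        unfolding c_def using \<epsilon>(2)[OF ts] \<epsilon>(1) by (intro W_S) (meson centre_in_cball less_imp_le subsetD)
      have img: "(\<lambda>s. t + s) ` {0..h} = {t..t + h}"
        by (simp add: image_add_atLeastAtMost)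
      have y': "(y has_vector_derivative f (t + s, y (t + s))) (at (t + s) within (\<lambda>s. t + s) ` {0..h})"
        unfolding img by (rule has_vector_derivative_within_subset[OF ode[OF ts]]) (use t in auto)
      have "((\<lambda>s. t + s) has_vector_derivative 1) (at s within {0..h})"
        by (auto intro!: derivative_eq_intros)
      from vector_diff_chain_within[OF this y']
      have "((y \<circ> (\<lambda>s. t + s)) has_vector_derivative (1 *\<^sub>R f (t + s, y (t + s)))) (at s within {0..h})" .
      then show "(c has_vector_derivative g 0 (c s)) (at s within {0..h})"
        unfolding c_def g0 aug_def
        by (intro has_vector_derivative_Pair) (auto intro!: derivative_eq_intros simp: o_def)
    qed (use h in auto)
    from order_trans[OF norm_snd_component_le this]
    have 3: "norm (snd (taylor_curve p g h z) - y (t + h)) \<le> B * B * real p * h ^ Suc p"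
      by (simp add: c_def z_def i norm_minus_commute del: power_Suc of_nat_Suc)
    have "Step h t w - y (t + h) = (Step h t w - snd (taylor_curve p g h x))
        + (snd (taylor_curve p g h x) - snd (taylor_curve p g h z)) + (snd (taylor_curve p g h z) - y (t + h))"
      by simp
    also have "norm \<dots> \<le> C * h ^ Suc p + (1 + L * h) * norm (w - y t) + B * B * real p * h ^ Suc p"
      by (intro norm_triangle_mono 1 2 3)
    finally show "norm (Step h t w - y (t + h)) \<le> (1 + L * h) * norm (w - y t) + (C + B * B * real p) * h ^ Suc p"
      by (simp add: algebra_simps)
  qed (use \<epsilon>(1) C(1,2) \<open>0 < L\<close> B p init in auto)
qed

end

theorem theorem5p18:
  fixes f :: "real \<times> (real^'n) \<Rightarrow> real^'n"
    and y :: "real \<Rightarrow> real^'n" and y0 :: "real^'n"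
    and t0 T r hmax :: real
    and s k :: nat
    and U :: "(real \<times> (real^'n)) set"
    and M :: miiso
    and \<alpha> :: "nat \<Rightarrow> nat \<Rightarrow> complex \<Rightarrow> real"
    and \<theta> :: "complex \<Rightarrow> real"
    and act :: "'n action"
  assumes "t0 < T"
    and init: "y t0 = y0"
    and ode: "\<And>t. t \<in> {t0..T} \<Longrightarrow> (y has_vector_derivative f (t, y t)) (at t within {t0..T})"
    and nbhd: "open U" "\<And>t. t \<in> {t0..T} \<Longrightarrow> (t, y t) \<in> U"
    and taper_params: "0 < r" "r < 1" "1 < s"
    and branches: "\<And>m n. (m, n) \<in> pade_used M \<Longrightarrow> arg_branch (pade m n) (\<alpha> m n)"
    and weight3: "M = MIISO3 \<Longrightarrow> wedge_weight 3 \<theta>"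
    and weight4: "M = MIISO4 \<Longrightarrow> wedge_weight 4 \<theta>"
    and hmax: "0 < hmax"
    and i: "bounded_derivs 5 U f"
    and ii: "\<exists>K. \<forall>(t, x)\<in>U. \<exists>X d. diagonalizes (cmatrix (f_y f t x)) X d \<and>
               onorm ((*v) X) * onorm ((*v) (matrix_inv X)) \<le> K"
    and k: "1 \<le> k" "k \<le> CARD('n)"
    and iii: "\<And>h t x. \<lbrakk>0 < h; h \<le> hmax; (t, x) \<in> U; k < CARD('n)\<rbrakk> \<Longrightarrow>
               eig_modulus (k + 1) (h *\<^sub>R f_y f t x) < eig_modulus k (h *\<^sub>R f_y f t x)"
    and iv: "\<And>h t x z m n. \<lbrakk>0 < h; h \<le> hmax; (t, x) \<in> U; z \<in># eigvals (h *\<^sub>R f_y f t x);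
               (m, n) \<in> pade_used M\<rbrakk> \<Longrightarrow> poly (pade_denom m n) z \<noteq> 0"
    and v: "act = exact_action \<or>
            (\<exists>m. act = arnoldi_action m \<and>
               (\<exists>C. \<forall>h. 0 < h \<longrightarrow> h \<le> hmax \<longrightarrow> (\<forall>(t, x)\<in>U.
                  norm (miiso_step \<alpha> \<theta> M r s k act f h t x
                        - miiso_step \<alpha> \<theta> M r s k exact_action f h t x)
                    \<le> C * h ^ (miiso_order M + 1))))"
  shows "\<exists>C h0. 0 < h0 \<and>
           (\<forall>h n. 0 < h \<longrightarrow> h \<le> h0 \<longrightarrow> t0 + real n * h \<le> T \<longrightarrow>
              norm (iterates (miiso_step \<alpha> \<theta> M r s k act f h) h t0 y0 n - y (t0 + real n * h))
                \<le> C * h ^ miiso_order M)"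
proof -
  let ?p = "miiso_order M"
  \<comment> \<open>The trajectory is compact, so \<open>U\<close> contains a tube around it with
    uniform bounds.\<close>
  have "continuous_on {t0..T} y"
    using ode has_vector_derivative_continuous continuous_on_eq_continuous_within by blast
  then have "compact ((\<lambda>t. (t, y t)) ` {t0..T})"
    by (intro compact_continuous_image continuous_on_Pair continuous_on_id compact_Icc)
  moreover have "(\<lambda>t. (t, y t)) ` {t0..T} \<subseteq> U"
    using nbhd(2) by blast
  ultimately have "\<exists>S W \<epsilon> \<rho> B. 0 < \<epsilon> \<and> S \<subseteq> U \<and> (\<forall>z\<in>(\<lambda>t. (t, y t)) ` {t0..T}. cball z \<epsilon> \<subseteq> W) \<and>
      smooth_ode f S W (\<lambda>j. (lie (aug f) ^^ j) (aug f)) (\<lambda>z. frechet_derivative f (at z)) \<rho> B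
        (\<lambda>z. matrix (\<lambda>w. frechet_derivative f (at z) (0, w))) (\<lambda>z. frechet_derivative f (at z) (1, 0))"
    by (rule smooth_ode_near_compact[OF _ _ nbhd(1) i])
  then obtain S W \<epsilon> \<rho> B where \<epsilon>: "0 < \<epsilon>" and SU: "S \<subseteq> U"
      and tube: "\<forall>z\<in>(\<lambda>t. (t, y t)) ` {t0..T}. cball z \<epsilon> \<subseteq> W"
      and S: "smooth_ode f S W (\<lambda>j. (lie (aug f) ^^ j) (aug f)) (\<lambda>z. frechet_derivative f (at z)) \<rho> B
        (\<lambda>z. matrix (\<lambda>w. frechet_derivative f (at z) (0, w))) (\<lambda>z. frechet_derivative f (at z) (1, 0))"
    by (elim exE conjE)
  interpret smooth_ode f S W "\<lambda>j. (lie (aug f) ^^ j) (aug f)" "\<lambda>z. frechet_derivative f (at z)" \<rho> B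
    "\<lambda>z. matrix (\<lambda>w. frechet_derivative f (at z) (0, w))" "\<lambda>z. frechet_derivative f (at z) (1, 0)"
    by (rule S)
  have WU: "x \<in> U" if "x \<in> W" for x
    using W_S[OF that] SU by blast
  obtain K where K: "\<forall>(t, x)\<in>U. \<exists>X d. diagonalizes (cmatrix (f_y f t x)) X d \<and>
      onorm ((*v) X) * onorm ((*v) (matrix_inv X)) \<le> K"
    using ii by blast
  have exact: "unif_O W (Suc ?p) (\<lambda>h x. miiso_step \<alpha> \<theta> M r s k exact_action f h (fst x) (snd x)
      - (snd x + taylor_prim ?p (\<lambda>l. F l x) h))"
    by (rule miiso_local_error[OF taper_params(2) branches weight3 weight4, where K = K])
      (use K WU in \<open>auto simp: case_prod_unfold\<close>)
  \<comment> \<open>The bound for projected actions compares whole steps from the same state, so it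
    simply adds to the local error at the same order.\<close>
  have "unif_O W (Suc ?p) (\<lambda>h x. miiso_step \<alpha> \<theta> M r s k act f h (fst x) (snd x)
      - miiso_step \<alpha> \<theta> M r s k exact_action f h (fst x) (snd x))"
    using v
  proof
    assume "act = exact_action"
    then show ?thesis
      by (intro unif_OI[of 1 _ _ 0]) auto
  next
    assume "\<exists>m. act = arnoldi_action m \<and>
               (\<exists>C. \<forall>h. 0 < h \<longrightarrow> h \<le> hmax \<longrightarrow> (\<forall>(t, x)\<in>U.
                  norm (miiso_step \<alpha> \<theta> M r s k act f h t x
                        - miiso_step \<alpha> \<theta> M r s k exact_action f h t x)
                    \<le> C * h ^ (miiso_order M + 1)))"
    then obtain C where C: "\<And>h x. 0 < h \<Longrightarrow> h \<le> hmax \<Longrightarrow> x \<in> U \<Longrightarrow>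
        norm (miiso_step \<alpha> \<theta> M r s k act f h (fst x) (snd x)
          - miiso_step \<alpha> \<theta> M r s k exact_action f h (fst x) (snd x)) \<le> C * h ^ (?p + 1)"
      by (auto simp: case_prod_unfold)
    show ?thesis
      by (rule unif_OI[OF hmax, where C = C]) (use C WU in auto)
  qed
  note err = unif_O_add[OF this exact]
  have "unif_O W (Suc ?p) (\<lambda>h x. miiso_step \<alpha> \<theta> M r s k act f h (fst x) (snd x)
      - (snd x + taylor_prim ?p (\<lambda>l. F l x) h))"
    by (rule unif_O_cong[OF err, of 1]) (auto simp: algebra_simps)
  moreover have "1 \<le> ?p" "?p \<le> 4"
    by (cases M; simp)+
  ultimately show ?thesis
    using convergence_from_local_error[OF ode init \<epsilon> tube[rule_format, OF imageI]] by blast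
qed

end
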